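(* Let $\pi\propto e^{-V}$ with $V$ $\alpha$-strongly convex and $\beta$-smooth over $\mathbb{R}^d$, given access to an evaluation oracle and a proximal oracle for $V$. Let $\pi_k$ denote the law of the $k$-th sample returned by the proximal sampler with target $\pi$. Given $q>1$ and $\varepsilon>0$, one can attain $\mathcal{R}_q(\pi_N\|\pi)\le\varepsilon$ using $\widetilde{O}(\kappa d\log\frac q\varepsilon)$ queries to both oracles, where $\kappa=\beta/\alpha$.
   Context: $\beta$-smooth means $\nabla V$ is $\beta$-Lipschitz. An evaluation oracle returns $V(x)$ at a queried $x$; a proximal oracle for $V$ with step size $h>0$ returns, for a queried $x\in\mathbb{R}^d$, the point $\arg\min\{V(\cdot)+\frac1{2h}\|\cdot-x\|^2\}$. Proximal sampler with step size $h$: starting from $x_0\sim\pi_0$, each iteration draws (i) $y_{k+1}\sim\mathcal{N}(x_k,hI_d)$ and (ii) $x_{k+1}$ from the density proportional to $e^{-V(x)-|x-y_{k+1}|^2/(2h)}$; $\pi_k$ is the law of $x_k$. Step (ii) is implemented by rejection sampling using the two oracles (query counts in expectation), and the initial distribution $\pi_0$ and $h$ may be chosen by the algorithm. For $\mu\ll\nu$ and $q\in(1,\infty)$, $\mathcal{R}_q(\mu\|\nu)=\frac{q}{q-1}\log\|\frac{d\mu}{d\nu}\|_{L^q(\nu)}$. $a=\widetilde{O}(b)$ means $a=O(b\,\mathrm{polylog}\,b)$ with universal constants. *)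

theory Defs
  imports "HOL-Probability.Probability"
begin

text \<open>
  The constants hidden in the complexity bound must not depend on the dimension, so the dimension
  \<open>d\<close> is a natural number that can be quantified inside a formula: the space of dimension \<open>d\<close> is
  the set of extensional functions on \<open>{..<d}\<close>, with the product Lebesgue measure.
\<close>

type_synonym point = "nat \<Rightarrow> real"

abbreviation leb :: "nat \<Rightarrow> point measure" where
  "leb d \<equiv> (\<Pi>\<^sub>M i\<in>{..<d}. lborel)"

abbreviation pts :: "nat \<Rightarrow> point set" where
  "pts d \<equiv> {..<d} \<rightarrow>\<^sub>E UNIV"

definition edist :: "nat \<Rightarrow> point \<Rightarrow> point \<Rightarrow> real" where
  "edist d x y = L2_set (\<lambda>i. x i - y i) {..<d}"

definition strongly_convex :: "nat \<Rightarrow> real \<Rightarrow> (point \<Rightarrow> real) \<Rightarrow> bool" where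
  "strongly_convex d \<alpha> V \<longleftrightarrow>
     (\<forall>x\<in>pts d. \<forall>y\<in>pts d. \<forall>t\<in>{0..1}.
        V (\<lambda>i\<in>{..<d}. (1 - t) * x i + t * y i)
          \<le> (1 - t) * V x + t * V y - \<alpha> / 2 * t * (1 - t) * (edist d x y)\<^sup>2)"

definition has_gradient :: "nat \<Rightarrow> (point \<Rightarrow> real) \<Rightarrow> point \<Rightarrow> point \<Rightarrow> bool" where
  "has_gradient d V g x \<longleftrightarrow>
     (\<forall>e>0. \<exists>\<delta>>0. \<forall>z\<in>pts d. edist d z x < \<delta> \<longrightarrow>
        \<bar>V z - V x - (\<Sum>i<d. g i * (z i - x i))\<bar> \<le> e * edist d z x)"

definition smooth :: "nat \<Rightarrow> real \<Rightarrow> (point \<Rightarrow> real) \<Rightarrow> bool" where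
  "smooth d \<beta> V \<longleftrightarrow>
     (\<exists>g. (\<forall>x\<in>pts d. has_gradient d V (g x) x) \<and>
          (\<forall>x\<in>pts d. \<forall>y\<in>pts d. edist d (g x) (g y) \<le> \<beta> * edist d x y))"

definition gibbs :: "nat \<Rightarrow> (point \<Rightarrow> real) \<Rightarrow> point measure" where
  "gibbs d V = density (leb d)
     (\<lambda>x. ennreal (exp (- V x)) / (\<integral>\<^sup>+z. ennreal (exp (- V z)) \<partial>leb d))"

definition gaussian :: "nat \<Rightarrow> point \<Rightarrow> real \<Rightarrow> point measure" where
  "gaussian d x h = (\<Pi>\<^sub>M i\<in>{..<d}. density lborel (normal_density (x i) (sqrt h)))"

definition regularized :: "nat \<Rightarrow> (point \<Rightarrow> real) \<Rightarrow> real \<Rightarrow> point \<Rightarrow> point \<Rightarrow> real" where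
  "regularized d V h y = (\<lambda>x. V x + (edist d x y)\<^sup>2 / (2 * h))"

text \<open>The value is \<open>\<infinity>\<close> if \<open>\<mu>\<close> is not absolutely continuous with respect to \<open>\<nu>\<close> or if the
  density is not in \<open>L\<^sup>q(\<nu>)\<close>.\<close>

definition renyi :: "real \<Rightarrow> 'a measure \<Rightarrow> 'a measure \<Rightarrow> ereal" where
  "renyi q \<mu> \<nu> =
     (if sets \<mu> = sets \<nu> \<and> absolutely_continuous \<nu> \<mu> \<and>
         integrable \<nu> (\<lambda>x. enn2real (RN_deriv \<nu> \<mu> x) powr q)
      then ereal (q / (q - 1) *
             ln ((\<integral>x. enn2real (RN_deriv \<nu> \<mu> x) powr q \<partial>\<nu>) powr (1 / q)))
      else \<infinity>)"

primrec proximal_law ::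
  "nat \<Rightarrow> (point \<Rightarrow> real) \<Rightarrow> real \<Rightarrow> point measure \<Rightarrow> nat \<Rightarrow> point measure" where
  "proximal_law d V h \<pi>0 0 = \<pi>0"
| "proximal_law d V h \<pi>0 (Suc k) =
     (proximal_law d V h \<pi>0 k \<bind> (\<lambda>x. gaussian d x h))
       \<bind> (\<lambda>y. gibbs d (regularized d V h y))"

text \<open>
  Algorithms see \<open>V\<close> only through the answers to their queries. A query tree is a deterministic
  adaptive sequence of queries that ends with a result; the step size of the proximal oracle is
  part of the query. Only positive step sizes are meaningful; for the others the oracle answers with
  the query point, which reveals nothing (in particular, \<open>h = 0\<close> would otherwise give the minimizer
  of \<open>V\<close> because of \<open>x / 0 = 0\<close>).
\<close>

datatype 'r query_tree =
    Return 'r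
  | Evaluate point "real \<Rightarrow> 'r query_tree"
  | Proximal real point "point \<Rightarrow> 'r query_tree"

definition prox_oracle :: "nat \<Rightarrow> (point \<Rightarrow> real) \<Rightarrow> real \<Rightarrow> point \<Rightarrow> point" where
  "prox_oracle d V h x = (if h > 0 then arg_min_on (regularized d V h x) (pts d) else x)"

text \<open>Result, number of evaluation queries, number of proximal queries.\<close>

primrec run_tree :: "nat \<Rightarrow> (point \<Rightarrow> real) \<Rightarrow> 'r query_tree \<Rightarrow> 'r \<times> nat \<times> nat" where
  "run_tree d V (Return r) = (r, 0, 0)"
| "run_tree d V (Evaluate x k) = (case run_tree d V (k (V x)) of (r, e, p) \<Rightarrow> (r, Suc e, p))"
| "run_tree d V (Proximal h x k) =
     (case run_tree d V (k (prox_oracle d V h x)) of (r, e, p) \<Rightarrow> (r, e, Suc p))"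

text \<open>
  Rejection sampling is given by a proposal law and, for each proposed point, a query tree for its
  acceptance probability. A round draws a point \<open>z\<close> from the proposal law and an independent \<open>u\<close>
  uniform on \<open>[0,1]\<close>; it accepts \<open>z\<close> if \<open>u\<close> is at most the acceptance probability.
\<close>

type_synonym rejection = "point measure \<times> (point \<Rightarrow> real query_tree)"

definition rounds :: "rejection \<Rightarrow> (point \<times> real) stream measure" where
  "rounds R = stream_space (fst R \<Otimes>\<^sub>M uniform_measure lborel {0..1})"

definition accepts :: "nat \<Rightarrow> (point \<Rightarrow> real) \<Rightarrow> rejection \<Rightarrow> point \<times> real \<Rightarrow> bool" where
  "accepts d V R = (\<lambda>(z, u). u \<le> fst (run_tree d V (snd R z)))"

text \<open>The accepted point and the numbers of queries made up to and including the accepting round.\<close>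

definition rejection_outcome ::
  "nat \<Rightarrow> (point \<Rightarrow> real) \<Rightarrow> rejection \<Rightarrow> (point \<times> real) stream \<Rightarrow> point \<times> nat \<times> nat" where
  "rejection_outcome d V R \<omega> =
     (let n = (LEAST n. accepts d V R (\<omega> !! n));
          cost = (\<lambda>i. snd (run_tree d V (snd R (fst (\<omega> !! i)))))
      in (fst (\<omega> !! n), \<Sum>i\<le>n. fst (cost i), \<Sum>i\<le>n. snd (cost i)))"

text \<open>What the algorithm chooses: the initial law, the step size, the number of iterations and, for
  each \<open>y\<close>, the queries that prepare the rejection sampler used in step (ii).\<close>

datatype sampler =
  Sampler (initial_law: "point measure") (step_size: real) (iterations: nat)
    (rgo: "point \<Rightarrow> rejection query_tree")

abbreviation run_space :: "nat \<Rightarrow> (point \<times> nat \<times> nat) measure" where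
  "run_space d \<equiv> leb d \<Otimes>\<^sub>M count_space UNIV \<Otimes>\<^sub>M count_space UNIV"

text \<open>Joint law of the point returned by step (ii) and of the numbers of queries it makes.\<close>

definition rgo_law ::
  "nat \<Rightarrow> (point \<Rightarrow> real) \<Rightarrow> sampler \<Rightarrow> point \<Rightarrow> (point \<times> nat \<times> nat) measure" where
  "rgo_law d V S y =
     (case run_tree d V (rgo S y) of (R, e, p) \<Rightarrow>
        distr (rounds R) (run_space d)
          (\<lambda>\<omega>. case rejection_outcome d V R \<omega> of (x, e', p') \<Rightarrow> (x, e + e', p + p')))"

text \<open>Step (ii) is correctly implemented: the rejection sampler terminates almost surely and returns
  an exact sample, and it depends measurably on \<open>y\<close>.\<close>

definition implements_proximal_sampler :: "nat \<Rightarrow> (point \<Rightarrow> real) \<Rightarrow> sampler \<Rightarrow> bool" where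
  "implements_proximal_sampler d V S \<longleftrightarrow>
     initial_law S \<in> space (prob_algebra (leb d)) \<and>
     step_size S > 0 \<and>
     rgo_law d V S \<in> leb d \<rightarrow>\<^sub>M prob_algebra (run_space d) \<and>
     (\<forall>y\<in>pts d.
        (let R = fst (run_tree d V (rgo S y)) in
           fst R \<in> space (prob_algebra (leb d)) \<and>
           (AE \<omega> in rounds R. \<exists>n. accepts d V R (\<omega> !! n))) \<and>
        distr (rgo_law d V S y) (leb d) fst = gibbs d (regularized d V (step_size S) y))"

text \<open>Joint law of the current point and of the numbers of queries made so far, after \<open>k\<close> iterations,
  when \<open>e\<close> and \<open>p\<close> queries were made before the first iteration.\<close>

primrec run_law ::
  "nat \<Rightarrow> (point \<Rightarrow> real) \<Rightarrow> sampler \<Rightarrow> nat \<Rightarrow> nat \<Rightarrow> nat \<Rightarrow> (point \<times> nat \<times> nat) measure" where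
  "run_law d V S e p 0 = distr (initial_law S) (run_space d) (\<lambda>x. (x, e, p))"
| "run_law d V S e p (Suc k) =
     run_law d V S e p k \<bind> (\<lambda>(x, e1, p1).
       gaussian d x (step_size S) \<bind> (\<lambda>y.
         rgo_law d V S y \<bind> (\<lambda>(x', e2, p2).
           return (run_space d) (x', e1 + e2, p1 + p2))))"

text \<open>
  An algorithm first makes some queries and then chooses the sampler. It attains accuracy \<open>\<epsilon>\<close> with
  budget \<open>B\<close> if the last iterate is \<open>\<epsilon>\<close>-close to the target and if the expected number of queries
  to each oracle, over the whole run, is at most \<open>B\<close>.
\<close>

definition attains ::
  "nat \<Rightarrow> (point \<Rightarrow> real) \<Rightarrow> sampler query_tree \<Rightarrow> real \<Rightarrow> real \<Rightarrow> real \<Rightarrow> bool" where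
  "attains d V A q \<epsilon> B \<longleftrightarrow>
     (case run_tree d V A of (S, e, p) \<Rightarrow>
        implements_proximal_sampler d V S \<and>
        renyi q (proximal_law d V (step_size S) (initial_law S) (iterations S)) (gibbs d V)
          \<le> ereal \<epsilon> \<and>
        (\<integral>\<^sup>+(x, ev, pr). of_nat ev \<partial>run_law d V S e p (iterations S)) \<le> ennreal B \<and>
        (\<integral>\<^sup>+(x, ev, pr). of_nat pr \<partial>run_law d V S e p (iterations S)) \<le> ennreal B)"

end

theory Submission
  imports Defs "HOL-Real_Asymp.Real_Asymp"
begin

text \<open>
  Write \<open>K\<close> for the Markov kernel of one Gaussian step followed by \<open>n\<close> full iterations of the sampler.
  All conditional laws in step (ii) are \<open>(\<alpha> + 1/h)\<close>-strongly log-concave, so by the Prekopa-Leindler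
  inequality they satisfy a transport-entropy and a logarithmic Sobolev inequality. The first gives a reverse
  logarithmic Sobolev inequality \<open>|D K f|\<^sup>2 \<le> C * K f * (K (f ln f) - K f * ln (K f))\<close> for one kernel, and both
  together show that \<open>C\<close> shrinks by the factor \<open>1 / (1 + \<alpha> * h)\<^sup>2\<close> in each iteration. Interpolation in the
  exponent turns it into the Harnack inequality
  \<open>(K f x)\<^sup>p \<le> K (f\<^sup>p) y * exp (p * C * |x - y|\<^sup>2 / (2 * (p - 1)))\<close>; integrating over \<open>y\<close> in the invariant
  target bounds the Renyi divergence from a point mass at \<open>x\<close>, for every \<open>q\<close>, by \<open>q * C / 2\<close> times the second
  moment of the target about \<open>x\<close>.

  With \<open>h = 1 / (\<beta> * d)\<close>, rejection sampling from the Gaussian centred at the proximal point of \<open>y\<close> accepts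
  with probability at least \<open>(1 + 1/d) powr (-d/2) \<ge> exp (-1/2)\<close>, so an iteration costs \<open>O(1)\<close> queries, and
  \<open>1 / (\<alpha> * h) = \<kappa> * d\<close> iterations contract by a constant factor.
\<close>

text \<open>A point mass has infinite Renyi divergence from the target, so no divergence is
  contracted from the start; what contracts is the smoothing constant of the kernel, which a single
  Gaussian step makes finite. As that constant does not involve \<open>q\<close>, the order enters
  the final bound as a plain factor and costs one logarithm.

  The factor per iteration is a product of two curvatures. With \<open>m = \<alpha> + 1 / h\<close>,
  transport-entropy bounds the squared gradient of
  \<open>y \<mapsto> \<integral>x. f x \<partial>mu y\<close> by \<open>2 / (h^2 * m)\<close> times
  mean times entropy, and the logarithmic Sobolev inequality bounds the entropy by
  \<open>1 / (2 * m)\<close> times the gradient bound already known for \<open>f\<close>. Together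
  they give \<open>1 / (h * m)^2\<close>, and \<open>h * m = 1 + \<alpha> * h\<close>. A Gaussian
  step is the case of zero potential, \<open>m = 1 / h\<close>, with factor 1.

  Regularity in the starting point is carried by first-order expansions with a uniform quadratic
  remainder: kernel images satisfy them, and the Sobolev and Harnack arguments need nothing
  smoother.

  The second moment is bounded only up to a factor of order \<kappa>; a polynomial loss in
  \<open>\<kappa> * d\<close> is absorbed by the logarithm in the iteration count.\<close>

section \<open>The Prekopa-Leindler inequality\<close>

text \<open>Exhausts an arbitrary set by pieces lying below one of its own elements, so that
  Brunn-Minkowski reduces to sets with a greatest element, without compactness or boundedness. If
  there is no maximum, a sequence in \<open>A\<close> tending to the extended supremum passes every
  element.\<close>

lemma cofinal_sequence:
  fixes A :: "real set"
  assumes "A \<noteq> {}"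
  shows "\<exists>a :: nat \<Rightarrow> real. incseq a \<and> (\<forall>n. a n \<in> A) \<and> (\<forall>x\<in>A. \<exists>n. x \<le> a n)"
proof (cases "\<exists>m\<in>A. \<forall>x\<in>A. x \<le> m")
  case True
  then obtain m where "m \<in> A" "\<forall>x\<in>A. x \<le> m" by blast
  then show ?thesis by (intro exI[of _ "\<lambda>_. m"]) (auto simp: incseq_def)
next
  case False
  have "ereal ` A \<noteq> {}" using assms by auto
  from Sup_countable_SUP[OF this] obtain f where f: "incseq f" "range f \<subseteq> ereal ` A"
    "Sup (ereal ` A) = (SUP i. f i)" by blast
  then have "\<forall>n. \<exists>a\<in>A. f n = ereal a" by auto
  then obtain a where a: "\<And>n. a n \<in> A" "\<And>n. f n = ereal (a n)" by metis
  have "\<exists>n. x \<le> a n" if x: "x \<in> A" for x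
  proof -
    obtain y where "y \<in> A" "x < y" using False x by (meson not_le)
    then have "ereal x < Sup (ereal ` A)" by (metis SUP_upper ereal_less(2) less_ereal.simps(1) order_less_le_trans)
    then have "ereal x < (SUP i. f i)" using f(3) by simp
    then obtain n where "ereal x < f n" by (auto simp: less_SUP_iff)
    then show ?thesis using a(2) by (metis ereal_less_eq(3) less_imp_le)
  qed
  moreover have "incseq a" using f(1) a(2) by (auto simp: incseq_def)
  ultimately show ?thesis using a(1) by blast
qed

lemma emeasure_lborel_affine_vimage:
  fixes s c :: real
  assumes "s > 0" and [measurable]: "A \<in> sets borel"
  shows "emeasure lborel {z. (z - c) / s \<in> A} = ennreal s * emeasure lborel A"
proof -
  have [measurable]: "{z. (z - c) / s \<in> A} \<in> sets borel" by measurable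
  have "emeasure lborel {z. (z - c) / s \<in> A} = (\<integral>\<^sup>+z. indicator {z. (z - c) / s \<in> A} z \<partial>lborel)"
    by simp
  also have "\<dots> = ennreal \<bar>s\<bar> * (\<integral>\<^sup>+x. indicator {z. (z - c) / s \<in> A} (c + s * x) \<partial>lborel)"
    using assms by (intro nn_integral_real_affine) auto
  also have "(\<integral>\<^sup>+x. indicator {z. (z - c) / s \<in> A} (c + s * x) \<partial>lborel) = (\<integral>\<^sup>+x. indicator A x \<partial>lborel)"
    using assms by (intro nn_integral_cong) (auto simp: indicator_def)
  finally show ?thesis using assms by simp
qed

text \<open>If \<open>A\<close> has greatest element \<open>u\<close> and \<open>B\<close> least
  element \<open>v\<close>, the scaled translates of \<open>A\<close> through \<open>v\<close> and
  of \<open>B\<close> through \<open>u\<close> both lie in \<open>C\<close>, on opposite sides of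
  \<open>(1 - t) * u + t * v\<close>; they meet in at most that point and their measures add up.
  Working with a measurable \<open>C\<close> avoids measurability of the Minkowski sum.\<close>

lemma brunn_minkowski_lborel:
  fixes A B C :: "real set"
  assumes [measurable]: "A \<in> sets borel" "B \<in> sets borel" "C \<in> sets borel"
    and ne: "A \<noteq> {}" "B \<noteq> {}" and t: "0 < t" "t < 1"
    and AB: "\<And>a b. a \<in> A \<Longrightarrow> b \<in> B \<Longrightarrow> (1 - t) * a + t * b \<in> C"
  shows "ennreal (1 - t) * emeasure lborel A + ennreal t * emeasure lborel B \<le> emeasure lborel C"
proof -
  obtain u where u: "incseq u" "\<And>n. u n \<in> A" "\<And>x. x \<in> A \<Longrightarrow> \<exists>n. x \<le> u n"
    using cofinal_sequence[OF ne(1)] by blast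
  have "uminus ` B \<noteq> {}" using ne by auto
  from cofinal_sequence[OF this] obtain v' where v': "incseq v'" "\<And>n. v' n \<in> uminus ` B"
    "\<And>x. x \<in> uminus ` B \<Longrightarrow> \<exists>n. x \<le> v' n" by blast
  define v where "v n = - v' n" for n
  have v: "decseq v" "\<And>n. v n \<in> B" "\<And>x. x \<in> B \<Longrightarrow> \<exists>n. v n \<le> x"
  proof -
    show "decseq v" using v'(1) by (auto simp: v_def incseq_def decseq_def)
    show "v n \<in> B" for n using v'(2)[of n] by (auto simp: v_def)
    show "\<exists>n. v n \<le> x" if "x \<in> B" for x using v'(3)[of "-x"] that by (auto simp: v_def) (metis minus_le_iff)
  qed
  have le: "ennreal (1 - t) * emeasure lborel (A \<inter> {..u n}) + ennreal t * emeasure lborel (B \<inter> {v n..})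
     \<le> emeasure lborel C" for n
  proof -
    define p where "p = (1 - t) * u n + t * v n"
    define C1 where "C1 = {z. (z - t * v n) / (1 - t) \<in> A \<inter> {..u n}}"
    define C2 where "C2 = {z. (z - (1 - t) * u n) / t \<in> B \<inter> {v n..}}"
    have [measurable]: "C1 \<in> sets borel" "C2 \<in> sets borel" unfolding C1_def C2_def by measurable
    have e1: "emeasure lborel C1 = ennreal (1 - t) * emeasure lborel (A \<inter> {..u n})"
      unfolding C1_def using t by (intro emeasure_lborel_affine_vimage) auto
    have e2: "emeasure lborel C2 = ennreal t * emeasure lborel (B \<inter> {v n..})"
      unfolding C2_def using t by (intro emeasure_lborel_affine_vimage) auto
    have "C1 \<subseteq> C"
    proof
      fix z assume "z \<in> C1"
      then have "(1 - t) * ((z - t * v n) / (1 - t)) + t * v n \<in> C"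
        using v(2) by (intro AB) (auto simp: C1_def)
      then show "z \<in> C" using t by simp
    qed
    moreover have "C2 \<subseteq> C"
    proof
      fix z assume "z \<in> C2"
      then have "(1 - t) * u n + t * ((z - (1 - t) * u n) / t) \<in> C"
        using u(2) by (intro AB) (auto simp: C2_def)
      then show "z \<in> C" using t by simp
    qed
    moreover have "C1 \<inter> C2 \<subseteq> {p}"
      using t by (auto simp: C1_def C2_def p_def field_simps)
    then have "emeasure lborel (C1 \<inter> C2) \<le> emeasure lborel {p}" by (intro emeasure_mono) auto
    then have "C1 \<inter> C2 \<in> null_sets lborel" by (auto simp: null_sets_def)
    then have "emeasure lborel (C1 \<union> C2) = emeasure lborel C1 + emeasure lborel C2"
      by (intro emeasure_Un') auto
    ultimately have "emeasure lborel C1 + emeasure lborel C2 \<le> emeasure lborel C"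
      by (metis \<open>C1 \<subseteq> C\<close> \<open>C2 \<subseteq> C\<close> Un_least assms(3) emeasure_mono sets_lborel)
    then show ?thesis using e1 e2 by simp
  qed
  have "(\<lambda>n. emeasure lborel (A \<inter> {..u n})) \<longlonglongrightarrow> emeasure lborel (\<Union>n. A \<inter> {..u n})"
    using u(1) by (intro Lim_emeasure_incseq) (auto simp: incseq_def intro: order_trans)
  moreover have "(\<Union>n. A \<inter> {..u n}) = A" using u(3) by auto
  ultimately have 1: "(\<lambda>n. emeasure lborel (A \<inter> {..u n})) \<longlonglongrightarrow> emeasure lborel A" by simp
  have "(\<lambda>n. emeasure lborel (B \<inter> {v n..})) \<longlonglongrightarrow> emeasure lborel (\<Union>n. B \<inter> {v n..})"
    using v(1) by (intro Lim_emeasure_incseq) (auto simp: incseq_def decseq_def intro: order_trans)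
  moreover have "(\<Union>n. B \<inter> {v n..}) = B" using v(3) by auto
  ultimately have 2: "(\<lambda>n. emeasure lborel (B \<inter> {v n..})) \<longlonglongrightarrow> emeasure lborel B" by simp
  have "(\<lambda>n. ennreal (1 - t) * emeasure lborel (A \<inter> {..u n}) + ennreal t * emeasure lborel (B \<inter> {v n..}))
    \<longlonglongrightarrow> ennreal (1 - t) * emeasure lborel A + ennreal t * emeasure lborel B"
    by (intro tendsto_add ennreal_tendsto_cmult 1 2) auto
  then show ?thesis using le by (intro LIMSEQ_le_const2) auto
qed

text \<open>Levels are written as \<open>s * r\<close> with \<open>r\<close> in the unit interval,
  so that functions with different suprema are integrated over the same range of
  \<open>r\<close>.\<close>

lemma layer_cake_bounded:
  fixes F :: "real \<Rightarrow> ennreal"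
  assumes [measurable]: "F \<in> borel_measurable borel" and s: "s > 0" and b: "\<And>x. F x \<le> ennreal s"
  shows "(\<integral>\<^sup>+x. F x \<partial>lborel) = ennreal s * (\<integral>\<^sup>+r. indicator {0<..<1} r * emeasure lborel {x. ennreal (s * r) <
    F x} \<partial>lborel)"
proof -
  have pt: "F x = ennreal s * (\<integral>\<^sup>+r. indicator {0<..<1} r * indicator {x. ennreal (s * r) < F x} x \<partial>lborel)" for x
  proof -
    obtain y where y: "F x = ennreal y" "0 \<le> y" "y \<le> s"
      using b[of x] s by (cases "F x") (auto simp: top_unique)
    have "(\<integral>\<^sup>+r. indicator {0<..<1} r * indicator {x. ennreal (s * r) < F x} x \<partial>lborel)
      = (\<integral>\<^sup>+r. indicator {0<..<y / s} r \<partial>lborel)"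
    proof (intro nn_integral_cong)
      fix r :: real
      have "r < 1" if "s * r < y" using that y s
        by (metis mult.right_neutral mult_less_cancel_left_pos order_less_le_trans)
      then show "indicator {0<..<1} r * indicator {x. ennreal (s * r) < F x} x = (indicator {0<..<y / s} r :: ennreal)"
        using y s by (auto simp: indicator_def ennreal_less_iff field_simps)
    qed
    also have "\<dots> = ennreal (y / s)" using y s by simp
    finally show ?thesis using y s by (simp add: ennreal_mult[symmetric])
  qed
  have "(\<integral>\<^sup>+x. F x \<partial>lborel) = (\<integral>\<^sup>+x. ennreal s * (\<integral>\<^sup>+r. indicator {0<..<1} r * indicator {x. ennreal (s * r) <
    F x} x \<partial>lborel) \<partial>lborel)"
    by (intro nn_integral_cong pt)
  also have "\<dots> = ennreal s * (\<integral>\<^sup>+x. (\<integral>\<^sup>+r. indicator {0<..<1} r * indicator {x. ennreal (s * r) < F x} x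
    \<partial>lborel) \<partial>lborel)"
    by (subst nn_integral_cmult) measurable
  also have "(\<integral>\<^sup>+x. (\<integral>\<^sup>+r. indicator {0<..<1} r * indicator {x. ennreal (s * r) < F x} x \<partial>lborel) \<partial>lborel)
     = (\<integral>\<^sup>+r. (\<integral>\<^sup>+x. indicator {0<..<1} r * indicator {x. ennreal (s * r) < F x} x \<partial>lborel) \<partial>lborel)"
    by (subst lborel_pair.Fubini') measurable
  also have "\<dots> = (\<integral>\<^sup>+r. indicator {0<..<1} r * emeasure lborel {x. ennreal (s * r) < F x} \<partial>lborel)"
    by (intro nn_integral_cong, subst nn_integral_cmult) auto
  finally show ?thesis .
qed

text \<open>For a possibly unbounded function the levels up to \<open>s\<close> give only a lower
  bound of the integral. Non-strict level sets are used because that is what the convexity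
  hypothesis delivers for \<open>H\<close>.\<close>

lemma layer_cake_le:
  fixes H :: "real \<Rightarrow> ennreal"
  assumes [measurable]: "H \<in> borel_measurable borel" and s: "s > 0"
  shows "ennreal s * (\<integral>\<^sup>+r. indicator {0<..<1} r * emeasure lborel {x. ennreal (s * r) \<le> H x} \<partial>lborel) \<le>
    (\<integral>\<^sup>+x. H x \<partial>lborel)"
proof -
  have pt: "ennreal s * (\<integral>\<^sup>+r. indicator {0<..<1} r * indicator {x. ennreal (s * r) \<le> H x} x \<partial>lborel) \<le> H x" for x
  proof -
    have "(\<integral>\<^sup>+r. indicator {0<..<1} r * indicator {x. ennreal (s * r) \<le> H x} x \<partial>lborel)
      \<le> (\<integral>\<^sup>+r. indicator {0..enn2real (min (H x) s) / s} r \<partial>lborel)"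
    proof (intro nn_integral_mono)
      fix r :: real
      have "r \<le> enn2real (min (H x) s) / s" if "0 < r" "r < 1" "ennreal (s * r) \<le> H x"
      proof -
        have "ennreal (s * r) \<le> min (H x) s" using that s by (auto intro: ennreal_leI)
        then have "s * r \<le> enn2real (min (H x) s)" using that s
          by (metis enn2real_ennreal enn2real_mono ennreal_less_top less_eq_real_def min_less_iff_disj mult_pos_pos)
        then show ?thesis using s by (simp add: field_simps)
      qed
      then show "indicator {0<..<1} r * indicator {x. ennreal (s * r) \<le> H x} x \<le>
        (indicator {0..enn2real (min (H x) s) / s} r :: ennreal)"
        by (auto simp: indicator_def)
    qed
    also have "\<dots> = ennreal (enn2real (min (H x) s) / s)" using s by simp
    finally have "ennreal s * (\<integral>\<^sup>+r. indicator {0<..<1} r * indicator {x. ennreal (s * r) \<le> H x} x \<partial>lborel)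
      \<le> ennreal s * ennreal (enn2real (min (H x) s) / s)" by (rule mult_left_mono) simp
    also have "\<dots> = ennreal (enn2real (min (H x) s))" using s by (simp add: ennreal_mult[symmetric])
    also have "\<dots> = min (H x) s" by (simp add: min_less_iff_disj)
    finally show ?thesis by (rule order_trans) simp
  qed
  have "ennreal s * (\<integral>\<^sup>+r. indicator {0<..<1} r * emeasure lborel {x. ennreal (s * r) \<le> H x} \<partial>lborel)
   = ennreal s * (\<integral>\<^sup>+r. (\<integral>\<^sup>+x. indicator {0<..<1} r * indicator {x. ennreal (s * r) \<le> H x} x \<partial>lborel) \<partial>lborel)"
    by (intro arg_cong2[where f="(*)"] refl nn_integral_cong, subst nn_integral_cmult) auto
  also have "\<dots> = ennreal s * (\<integral>\<^sup>+x. (\<integral>\<^sup>+r. indicator {0<..<1} r * indicator {x. ennreal (s * r) \<le>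
    H x} x \<partial>lborel) \<partial>lborel)"
    by (subst lborel_pair.Fubini') measurable
  also have "\<dots> = (\<integral>\<^sup>+x. ennreal s * (\<integral>\<^sup>+r. indicator {0<..<1} r * indicator {x. ennreal (s * r) \<le>
    H x} x \<partial>lborel) \<partial>lborel)"
    by (subst nn_integral_cmult) measurable
  also have "\<dots> \<le> (\<integral>\<^sup>+x. H x \<partial>lborel)" by (intro nn_integral_mono pt)
  finally show ?thesis .
qed

lemma young_weighted:
  fixes a b t :: real
  assumes "0 < a" "0 < b" "0 < t" "t < 1"
  shows "a powr (1 - t) * b powr t \<le> (1 - t) * a + t * b"
  using Youngs_inequality_0[of "1 - t" t a b] assms by simp

text \<open>Dividing \<open>F\<close> and \<open>G\<close> by their suprema makes both superlevel
  sets nonempty at every level \<open>r < 1\<close>, so Brunn-Minkowski applies level by level.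
  Integrating over \<open>r\<close> controls the arithmetic mean of the normalized integrals, which
  dominates their geometric mean.\<close>

lemma prekopa_leindler_bounded:
  fixes F G H :: "real \<Rightarrow> ennreal"
  assumes [measurable]: "F \<in> borel_measurable borel" "G \<in> borel_measurable borel" "H \<in> borel_measurable borel"
    and t: "0 < t" "t < 1"
    and FGH: "\<And>x y a b. 0 < a \<Longrightarrow> 0 < b \<Longrightarrow> ennreal a \<le> F x \<Longrightarrow> ennreal b \<le> G y \<Longrightarrow>
       ennreal (a powr (1 - t) * b powr t) \<le> H ((1 - t) * x + t * y)"
    and bF: "\<And>x. F x \<le> ennreal K" and bG: "\<And>x. G x \<le> ennreal K"
    and a: "0 < a" "ennreal a \<le> (\<integral>\<^sup>+x. F x \<partial>lborel)" and b: "0 < b" "ennreal b \<le> (\<integral>\<^sup>+x. G x \<partial>lborel)"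
  shows "ennreal (a powr (1 - t) * b powr t) \<le> (\<integral>\<^sup>+x. H x \<partial>lborel)"
proof -
  have sup: "\<exists>s>0. (\<forall>x. F x \<le> ennreal s) \<and> (\<forall>r<s. \<exists>x. ennreal r < F x)"
    if bF: "\<And>x. F x \<le> ennreal K" and a: "0 < a" "ennreal a \<le> (\<integral>\<^sup>+x. F x \<partial>lborel)"
    for F :: "real \<Rightarrow> ennreal" and a
  proof -
    define s where "s = (SUP x. F x)"
    have "s \<le> ennreal K" unfolding s_def using bF by (auto intro: SUP_least)
    then have "s < \<top>" by (simp add: le_less_trans)
    then obtain s' where s': "s = ennreal s'" "0 \<le> s'" by (cases s) auto
    have le: "F x \<le> ennreal s'" for x using s' by (metis SUP_upper UNIV_I s_def)
    have "s' \<noteq> 0"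
    proof
      assume "s' = 0"
      then have "F = (\<lambda>_. 0)" using le by auto
      then show False using a by simp
    qed
    moreover have "\<exists>x. ennreal r < F x" if "r < s'" for r
    proof -
      have "ennreal r < s" using that s' by (metis ennreal_lessI \<open>s' \<noteq> 0\<close> order_le_less)
      then show ?thesis by (auto simp: s_def less_SUP_iff)
    qed
    ultimately show ?thesis using le s'(2) by (intro exI[of _ s']) auto
  qed
  obtain sF where sF: "sF > 0" "\<And>x. F x \<le> ennreal sF" "\<And>r. r < sF \<Longrightarrow> \<exists>x. ennreal r < F x"
    using sup[OF bF a] by blast
  obtain sG where sG: "sG > 0" "\<And>x. G x \<le> ennreal sG" "\<And>r. r < sG \<Longrightarrow> \<exists>x. ennreal r < G x"
    using sup[OF bG b] by blast
  define S where "S = sF powr (1 - t) * sG powr t"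
  have S: "S > 0" using sF(1) sG(1) by (simp add: S_def)
  define IF where "IF = (\<integral>\<^sup>+r. indicator {0<..<1} r * emeasure lborel {x. ennreal (sF * r) < F x} \<partial>lborel)"
  define IG where "IG = (\<integral>\<^sup>+r. indicator {0<..<1} r * emeasure lborel {x. ennreal (sG * r) < G x} \<partial>lborel)"
  have eF: "(\<integral>\<^sup>+x. F x \<partial>lborel) = ennreal sF * IF" unfolding IF_def
    by (rule layer_cake_bounded) (use sF in auto)
  have eG: "(\<integral>\<^sup>+x. G x \<partial>lborel) = ennreal sG * IG" unfolding IG_def
    by (rule layer_cake_bounded) (use sG in auto)
  have aF: "ennreal (a / sF) \<le> IF"
  proof -
    have "ennreal (a / sF) = ennreal (1 / sF) * ennreal a" using sF(1) a by (simp add: ennreal_mult[symmetric])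
    also have "\<dots> \<le> ennreal (1 / sF) * (ennreal sF * IF)" using a(2) eF by (intro mult_left_mono) auto
    also have "\<dots> = IF" using sF(1) by (simp add: mult.assoc[symmetric] ennreal_mult[symmetric])
    finally show ?thesis .
  qed
  have bG': "ennreal (b / sG) \<le> IG"
  proof -
    have "ennreal (b / sG) = ennreal (1 / sG) * ennreal b" using sG(1) b by (simp add: ennreal_mult[symmetric])
    also have "\<dots> \<le> ennreal (1 / sG) * (ennreal sG * IG)" using b(2) eG by (intro mult_left_mono) auto
    also have "\<dots> = IG" using sG(1) by (simp add: mult.assoc[symmetric] ennreal_mult[symmetric])
    finally show ?thesis .
  qed
  have "a powr (1 - t) * b powr t = S * ((a / sF) powr (1 - t) * (b / sG) powr t)"
    using a b sF(1) sG(1) by (simp add: S_def powr_divide)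
  also have "\<dots> \<le> S * ((1 - t) * (a / sF) + t * (b / sG))"
    using a b sF(1) sG(1) t S by (intro mult_left_mono young_weighted) auto
  finally have "ennreal (a powr (1 - t) * b powr t) \<le> ennreal (S * ((1 - t) * (a / sF) + t * (b / sG)))"
    by (rule ennreal_leI)
  also have "\<dots> = ennreal S * (ennreal (1 - t) * ennreal (a / sF) + ennreal t * ennreal (b / sG))"
    using a b sF(1) sG(1) t S by (simp add: ennreal_mult[symmetric] ennreal_plus[symmetric] del: ennreal_plus)
  also have "\<dots> \<le> ennreal S * (ennreal (1 - t) * IF + ennreal t * IG)"
    by (intro mult_left_mono add_mono aF bG') auto
  also have "ennreal (1 - t) * IF + ennreal t * IG =
     (\<integral>\<^sup>+r. ennreal (1 - t) * (indicator {0<..<1} r * emeasure lborel {x. ennreal (sF * r) < F x}) +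
       ennreal t * (indicator {0<..<1} r * emeasure lborel {x. ennreal (sG * r) < G x}) \<partial>lborel)"
    unfolding IF_def IG_def
    by (subst nn_integral_add) (auto simp: nn_integral_cmult)
  also have "\<dots> \<le> (\<integral>\<^sup>+r. indicator {0<..<1} r * emeasure lborel {x. ennreal (S * r) \<le> H x} \<partial>lborel)"
  proof (rule nn_integral_mono)
    fix r :: real
    have "ennreal (1 - t) * emeasure lborel {x. ennreal (sF * r) < F x}
      + ennreal t * emeasure lborel {x. ennreal (sG * r) < G x}
      \<le> emeasure lborel {x. ennreal (S * r) \<le> H x}" if r: "0 < r" "r < 1"
    proof (rule brunn_minkowski_lborel)
      have "sF * r < sF" "sG * r < sG" using r sF(1) sG(1) by auto
      then show "{x. ennreal (sF * r) < F x} \<noteq> {}" "{x. ennreal (sG * r) < G x} \<noteq> {}"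
        using sF(3) sG(3) by auto
      fix x y assume "x \<in> {x. ennreal (sF * r) < F x}" "y \<in> {x. ennreal (sG * r) < G x}"
      then have "ennreal ((sF * r) powr (1 - t) * (sG * r) powr t) \<le> H ((1 - t) * x + t * y)"
        using r sF(1) sG(1) by (intro FGH) auto
      moreover have "(sF * r) powr (1 - t) * (sG * r) powr t = S * r"
      proof -
        have "r powr (1 - t) * r powr t = r" using r by (simp add: powr_add[symmetric])
        then show ?thesis using r sF(1) sG(1) by (simp add: S_def powr_mult algebra_simps)
      qed
      ultimately show "(1 - t) * x + t * y \<in> {x. ennreal (S * r) \<le> H x}" by simp
    qed (use t in auto)
    then show "ennreal (1 - t) * (indicator {0<..<1} r * emeasure lborel {x. ennreal (sF * r) < F x}) +
       ennreal t * (indicator {0<..<1} r * emeasure lborel {x. ennreal (sG * r) < G x}) \<le>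
       indicator {0<..<1} r * emeasure lborel {x. ennreal (S * r) \<le> H x}"
      by (auto simp: indicator_def)
  qed
  also have "ennreal S * (\<integral>\<^sup>+r. indicator {0<..<1} r * emeasure lborel {x. ennreal (S * r) \<le> H x} \<partial>lborel) \<le>
    (\<integral>\<^sup>+x. H x \<partial>lborel)"
    using S by (intro layer_cake_le) auto
  finally show ?thesis by (simp add: mult_left_mono)
qed

text \<open>Comparing the three functions through finite lower bounds \<open>a\<close>, \<open>b\<close> avoids powers of infinite
  values and lets the conclusion for the fibres serve as the hypothesis for the marginals.\<close>

lemma prekopa_leindler_real:
  fixes F G H :: "real \<Rightarrow> ennreal"
  assumes [measurable]: "F \<in> borel_measurable borel" "G \<in> borel_measurable borel" "H \<in> borel_measurable borel"
    and t: "0 < t" "t < 1"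
    and FGH: "\<And>x y a b. 0 < a \<Longrightarrow> 0 < b \<Longrightarrow> ennreal a \<le> F x \<Longrightarrow> ennreal b \<le> G y \<Longrightarrow>
       ennreal (a powr (1 - t) * b powr t) \<le> H ((1 - t) * x + t * y)"
    and a: "0 < a" "ennreal a \<le> (\<integral>\<^sup>+x. F x \<partial>lborel)" and b: "0 < b" "ennreal b \<le> (\<integral>\<^sup>+x. G x \<partial>lborel)"
  shows "ennreal (a powr (1 - t) * b powr t) \<le> (\<integral>\<^sup>+x. H x \<partial>lborel)"
proof -
  have trunc: "(\<lambda>n. \<integral>\<^sup>+x. min (F x) (of_nat n) \<partial>lborel) \<longlonglongrightarrow> (\<integral>\<^sup>+x. F x \<partial>lborel)"
    if [measurable]: "F \<in> borel_measurable borel" for F :: "real \<Rightarrow> ennreal"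
  proof (rule nn_integral_LIMSEQ)
    show "incseq (\<lambda>n x. min (F x) (of_nat n))"
      by (simp add: incseq_def le_fun_def min.coboundedI1 min.coboundedI2)
    show "(\<lambda>n. min (F x) (of_nat n)) \<longlonglongrightarrow> F x" for x
    proof -
      have "(\<lambda>n. min (F x) (of_nat n)) \<longlonglongrightarrow> min (F x) \<top>"
        by (intro tendsto_min tendsto_const of_nat_tendsto_top_ennreal)
      then show ?thesis by simp
    qed
  qed auto
  \<comment> \<open>The truncated functions need only have integrals above \<open>r * a\<close> and
    \<open>r * b\<close>. By homogeneity the factor \<open>r\<close> passes through the geometric
    mean and is sent to 1 at the end.\<close>
  have *: "ennreal (r * (a powr (1 - t) * b powr t)) \<le> (\<integral>\<^sup>+x. H x \<partial>lborel)" if r: "0 < r" "r < 1" for r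
  proof -
    have "ennreal (r * a) < (\<integral>\<^sup>+x. F x \<partial>lborel)"
      using r a by (intro less_le_trans[OF _ a(2)]) (auto intro!: ennreal_lessI)
    then have "\<forall>\<^sub>F n in sequentially. ennreal (r * a) < (\<integral>\<^sup>+x. min (F x) (of_nat n) \<partial>lborel)"
      by (intro order_tendstoD(1)[OF trunc]) auto
    moreover have "ennreal (r * b) < (\<integral>\<^sup>+x. G x \<partial>lborel)"
      using r b by (intro less_le_trans[OF _ b(2)]) (auto intro!: ennreal_lessI)
    then have "\<forall>\<^sub>F n in sequentially. ennreal (r * b) < (\<integral>\<^sup>+x. min (G x) (of_nat n) \<partial>lborel)"
      by (intro order_tendstoD(1)[OF trunc]) auto
    ultimately have "\<forall>\<^sub>F n in sequentially. ennreal (r * a) < (\<integral>\<^sup>+x. min (F x) (of_nat n) \<partial>lborel) \<and>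
       ennreal (r * b) < (\<integral>\<^sup>+x. min (G x) (of_nat n) \<partial>lborel)" by (rule eventually_conj)
    then obtain n where n: "ennreal (r * a) < (\<integral>\<^sup>+x. min (F x) (of_nat n) \<partial>lborel)"
       "ennreal (r * b) < (\<integral>\<^sup>+x. min (G x) (of_nat n) \<partial>lborel)"
      by (auto simp: eventually_sequentially)
    have "ennreal ((r * a) powr (1 - t) * (r * b) powr t) \<le> (\<integral>\<^sup>+x. H x \<partial>lborel)"
      by (rule prekopa_leindler_bounded[of "\<lambda>x. min (F x) (of_nat n)" "\<lambda>x. min (G x) (of_nat n)" H t "real n"])
        (use n r a b t FGH in \<open>auto simp: ennreal_of_nat_eq_real_of_nat\<close>)
    moreover have "(r * a) powr (1 - t) * (r * b) powr t = r * (a powr (1 - t) * b powr t)"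
    proof -
      have "r powr (1 - t) * r powr t = r" using r by (simp add: powr_add[symmetric])
      then show ?thesis using r a b by (simp add: powr_mult algebra_simps)
    qed
    ultimately show ?thesis by simp
  qed
  have "(\<lambda>n. ennreal ((1 - 1 / real (Suc (Suc n))) * (a powr (1 - t) * b powr t))) \<longlonglongrightarrow>
    ennreal ((1 - 0) * (a powr (1 - t) * b powr t))"
  proof (intro tendsto_intros)
    show "(\<lambda>n. 1 / real (Suc (Suc n))) \<longlonglongrightarrow> 0"
      using LIMSEQ_Suc[OF LIMSEQ_inverse_real_of_nat] by (simp add: inverse_eq_divide)
  qed
  then show ?thesis
    by (intro LIMSEQ_le_const2[where X="\<lambda>n. ennreal ((1 - 1 / real (Suc (Suc n))) * (a powr (1 - t) * b powr t))"])
      (auto intro!: exI[of _ 0] * )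
qed

text \<open>Induction on the coordinates with Tonelli: the induction hypothesis for two fibres is
  exactly the one-dimensional hypothesis for the fibre integrals.\<close>

lemma prekopa_leindler:
  fixes F G H :: "('i \<Rightarrow> real) \<Rightarrow> ennreal"
  assumes "finite I"
    and "F \<in> borel_measurable (\<Pi>\<^sub>M i\<in>I. lborel)" "G \<in> borel_measurable (\<Pi>\<^sub>M i\<in>I. lborel)" "H \<in>
      borel_measurable (\<Pi>\<^sub>M i\<in>I. lborel)"
    and t: "0 < t" "t < 1"
    and "\<And>x y a b. x \<in> I \<rightarrow>\<^sub>E UNIV \<Longrightarrow> y \<in> I \<rightarrow>\<^sub>E UNIV \<Longrightarrow> 0 < a \<Longrightarrow> 0 < b \<Longrightarrow> ennreal a \<le> F x \<Longrightarrow> ennreal b \<le> G y \<Longrightarrow>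
       ennreal (a powr (1 - t) * b powr t) \<le> H (\<lambda>i\<in>I. (1 - t) * x i + t * y i)"
    and "0 < a" "ennreal a \<le> (\<integral>\<^sup>+x. F x \<partial>(\<Pi>\<^sub>M i\<in>I. lborel))" and "0 < b" "ennreal b \<le> (\<integral>\<^sup>+x. G x \<partial>(\<Pi>\<^sub>M i\<in>I. lborel))"
  shows "ennreal (a powr (1 - t) * b powr t) \<le> (\<integral>\<^sup>+x. H x \<partial>(\<Pi>\<^sub>M i\<in>I. lborel))"
  using assms(1-4,7-)
proof (induction I arbitrary: F G H a b rule: finite_induct)
  case empty
  interpret product_sigma_finite "\<lambda>_::'i. lborel :: real measure" by standard
  show ?case using empty by (auto simp: PiM_empty nn_integral_count_space_finite restrict_def)
next
  case (insert i J)
  interpret product_sigma_finite "\<lambda>_::'i. lborel :: real measure" by standard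
  note [measurable] = insert.prems(1-3)
  have m: "(\<lambda>z. F ((snd z)(i := fst z))) \<in> borel_measurable (lborel \<Otimes>\<^sub>M (\<Pi>\<^sub>M i\<in>J. lborel))"
    if [measurable]: "F \<in> borel_measurable (\<Pi>\<^sub>M i\<in>insert i J. lborel)" for F :: "('i \<Rightarrow> real) \<Rightarrow> ennreal"
    by measurable
  interpret J: sigma_finite_measure "\<Pi>\<^sub>M i\<in>J. lborel :: real measure" by (rule sigma_finite) (use insert in auto)
  have mi: "(\<lambda>y. \<integral>\<^sup>+x. F (x(i := y)) \<partial>(\<Pi>\<^sub>M i\<in>J. lborel)) \<in> borel_measurable borel"
    if F: "F \<in> borel_measurable (\<Pi>\<^sub>M i\<in>insert i J. lborel)" for F :: "('i \<Rightarrow> real) \<Rightarrow> ennreal"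
    using J.borel_measurable_nn_integral[of "\<lambda>y x. F (x(i := y))" lborel] m[OF F] by (simp add: case_prod_unfold)
  have ms: "(\<lambda>x. F (x(i := y))) \<in> borel_measurable (\<Pi>\<^sub>M i\<in>J. lborel)"
    if F: "F \<in> borel_measurable (\<Pi>\<^sub>M i\<in>insert i J. lborel)" for F :: "('i \<Rightarrow> real) \<Rightarrow> ennreal" and y
    using measurable_compose[OF measurable_Pair1'[of y lborel] m[OF F]] by simp
  note e = product_nn_integral_insert_rev[OF insert.hyps(1,2)]
  show ?case
    unfolding e[OF insert.prems(3)]
  proof (rule prekopa_leindler_real[OF mi[OF insert.prems(1)] mi[OF insert.prems(2)] mi[OF insert.prems(3)] t])
    show "0 < a" "0 < b" using insert.prems by auto
    show "ennreal a \<le> (\<integral>\<^sup>+ y. \<integral>\<^sup>+ x. F (x(i := y)) \<partial>Pi\<^sub>M J (\<lambda>i. lborel) \<partial>lborel)"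
      using insert.prems(6) by (simp add: e)
    show "ennreal b \<le> (\<integral>\<^sup>+ y. \<integral>\<^sup>+ x. G (x(i := y)) \<partial>Pi\<^sub>M J (\<lambda>i. lborel) \<partial>lborel)"
      using insert.prems(8) by (simp add: e)
    fix u v a' b' :: real
    assume ab: "0 < a'" "0 < b'" "ennreal a' \<le> (\<integral>\<^sup>+ x. F (x(i := u)) \<partial>Pi\<^sub>M J (\<lambda>i. lborel))"
      "ennreal b' \<le> (\<integral>\<^sup>+ x. G (x(i := v)) \<partial>Pi\<^sub>M J (\<lambda>i. lborel))"
    show "ennreal (a' powr (1 - t) * b' powr t) \<le> (\<integral>\<^sup>+ x. H (x(i := (1 - t) * u + t * v)) \<partial>Pi\<^sub>M J (\<lambda>i. lborel))"
    proof (rule insert.IH[OF ms[OF insert.prems(1)] ms[OF insert.prems(2)] ms[OF insert.prems(3)] _ ab(1,3,2,4)])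
      fix x y a'' b''
      assume xy: "x \<in> J \<rightarrow>\<^sub>E UNIV" "y \<in> J \<rightarrow>\<^sub>E UNIV" and *: "0 < a''" "0 < b''" "ennreal a'' \<le>
        F (x(i := u))" "ennreal b'' \<le> G (y(i := v))"
      have "ennreal (a'' powr (1 - t) * b'' powr t) \<le> H (\<lambda>j\<in>insert i J. (1 - t) * (x(i := u)) j + t * (y(i := v)) j)"
        using xy by (intro insert.prems(4) * ) (auto simp: PiE_iff extensional_def)
      moreover have "(\<lambda>j\<in>insert i J. (1 - t) * (x(i := u)) j + t * (y(i := v)) j) =
         (\<lambda>j\<in>J. (1 - t) * x j + t * y j)(i := (1 - t) * u + t * v)"
        using insert.hyps by (auto simp: fun_eq_iff)
      ultimately show "ennreal (a'' powr (1 - t) * b'' powr t) \<le>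
        H ((\<lambda>j\<in>J. (1 - t) * x j + t * y j)(i := (1 - t) * u + t * v))"
        by simp
    qed
  qed
qed

section \<open>Gaussian measures\<close>

definition ip :: "nat \<Rightarrow> point \<Rightarrow> point \<Rightarrow> real" where
  "ip d x y = (\<Sum>i<d. x i * y i)"

definition padd :: "nat \<Rightarrow> point \<Rightarrow> point \<Rightarrow> point" where
  "padd d x w = (\<lambda>i\<in>{..<d}. x i + w i)"

lemma edist_sq: "(edist d x y)\<^sup>2 = (\<Sum>i<d. (x i - y i)\<^sup>2)"
  by (simp add: edist_def L2_set_def sum_nonneg)

lemma edist_nonneg [simp]: "0 \<le> edist d x y"
  by (simp add: edist_def)

lemma edist_commute: "edist d x y = edist d y x"
  by (simp add: edist_def L2_set_def power2_commute)

lemma space_leb: "space (leb d) = pts d"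
  by (simp add: space_PiM)

lemma padd_pts [simp]: "padd d x w \<in> pts d"
  by (simp add: padd_def)

lemma comb_pts [simp]: "(\<lambda>i\<in>{..<d}. f i) \<in> pts d"
  by simp

lemma measurable_ip [measurable]: "(\<lambda>x. ip d w x) \<in> borel_measurable (leb d)"
  unfolding ip_def by measurable

lemma measurable_edist [measurable]:
  assumes [measurable]: "f \<in> M \<rightarrow>\<^sub>M leb d" "g \<in> M \<rightarrow>\<^sub>M leb d"
  shows "(\<lambda>x. edist d (f x) (g x)) \<in> borel_measurable M"
proof -
  have [measurable]: "(\<lambda>x. f x i) \<in> borel_measurable M" "(\<lambda>x. g x i) \<in> borel_measurable M" if "i \<in> {..<d}" for i
    using measurable_compose[OF assms(1) measurable_component_singleton[OF that]]
      measurable_compose[OF assms(2) measurable_component_singleton[OF that]] by auto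
  show ?thesis unfolding edist_def L2_set_def by measurable
qed

lemma measurable_edist_const [measurable]: "(\<lambda>x. edist d x c) \<in> borel_measurable (leb d)"
  unfolding edist_def L2_set_def by measurable

lemma ip_nonneg: "0 \<le> ip d x x"
  by (simp add: ip_def sum_nonneg)

lemma ip_scale: "ip d (\<lambda>i. c * x i) y = c * ip d x y"
  by (simp add: ip_def sum_distrib_left algebra_simps)

lemma ip_cauchy_schwarz: "(ip d x y)\<^sup>2 \<le> ip d x x * ip d y y"
  using Cauchy_Schwarz_ineq_sum[of x y "{..<d}"] by (simp add: ip_def power2_eq_square)

lemma nn_integral_gauss_leb:
  assumes v: "v > 0"
  shows "(\<integral>\<^sup>+x. ennreal (exp (- (edist d x c)\<^sup>2 / (2 * v))) \<partial>leb d) = ennreal ((2 * pi * v) powr (real d / 2))"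
proof -
  interpret product_sigma_finite "\<lambda>_::nat. lborel :: real measure" by standard
  have "(\<integral>\<^sup>+x. ennreal (exp (- (edist d x c)\<^sup>2 / (2 * v))) \<partial>leb d) =
     (\<integral>\<^sup>+x. (\<Prod>i<d. ennreal (exp (- (x i - c i)\<^sup>2 / (2 * v)))) \<partial>leb d)"
    by (intro nn_integral_cong)
      (simp add: edist_sq sum_divide_distrib sum_negf prod_ennreal exp_sum[symmetric])
  also have "\<dots> = (\<Prod>i<d. \<integral>\<^sup>+x. ennreal (exp (- (x - c i)\<^sup>2 / (2 * v))) \<partial>lborel)"
    by (intro product_nn_integral_prod) auto
  also have "\<dots> = (\<Prod>i<d. ennreal (sqrt (2 * pi * v)))"
  proof (intro prod.cong refl)
    fix i
    have "(\<integral>\<^sup>+x. ennreal (exp (- (x - c i)\<^sup>2 / (2 * v))) \<partial>lborel) =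
       (\<integral>\<^sup>+x. ennreal (sqrt (2 * pi * v)) * ennreal (normal_density (c i) (sqrt v) x) \<partial>lborel)"
      using v by (intro nn_integral_cong) (simp add: normal_density_def ennreal_mult[symmetric])
    also have "\<dots> = ennreal (sqrt (2 * pi * v)) * (\<integral>\<^sup>+x. ennreal (normal_density (c i) (sqrt v) x) \<partial>lborel)"
      by (intro nn_integral_cmult) auto
    also have "(\<integral>\<^sup>+x. ennreal (normal_density (c i) (sqrt v) x) \<partial>lborel) = 1"
      using v by (subst nn_integral_eq_integral) (auto simp: integral_normal_density)
    finally show "(\<integral>\<^sup>+x. ennreal (exp (- (x - c i)\<^sup>2 / (2 * v))) \<partial>lborel) = ennreal (sqrt (2 * pi * v))" by simp
  qed
  also have "\<dots> = ennreal (sqrt (2 * pi * v) ^ d)" using v by (simp add: ennreal_power)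
  also have "sqrt (2 * pi * v) ^ d = (2 * pi * v) powr (real d / 2)"
    using v by (simp add: powr_half_sqrt[symmetric] powr_realpow[symmetric] powr_powr)
  finally show ?thesis .
qed

lemma gaussian_eq_density:
  assumes v: "v > 0"
  shows "gaussian d c v = density (leb d) (\<lambda>x. ennreal (exp (- (edist d x c)\<^sup>2 / (2 * v)) / (2 * pi * v) powr
    (real d / 2)))"
proof -
  interpret product_sigma_finite "\<lambda>_::nat. lborel :: real measure" by standard
  interpret N: product_sigma_finite "\<lambda>i::nat. density lborel (normal_density (c i) (sqrt v))"
    using v by (intro product_sigma_finite.intro prob_space_imp_sigma_finite prob_space_normal_density) auto
  let ?D = "density (leb d) (\<lambda>x. ennreal (exp (- (edist d x c)\<^sup>2 / (2 * v)) / (2 * pi * v) powr (real d / 2)))"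
  have "?D = (\<Pi>\<^sub>M i\<in>{..<d}. density lborel (normal_density (c i) (sqrt v)))"
  proof (rule N.PiM_eqI)
    show "sets ?D = sets (\<Pi>\<^sub>M i\<in>{..<d}. density lborel (normal_density (c i) (sqrt v)))"
      by (auto intro!: sets_PiM_cong)
    fix A :: "nat \<Rightarrow> real set" assume A: "\<And>i. i \<in> {..<d} \<Longrightarrow> A i \<in> sets (density lborel (normal_density (c i) (sqrt v)))"
    then have [measurable]: "\<And>i. i < d \<Longrightarrow> A i \<in> sets borel" by auto
    have [measurable]: "Pi\<^sub>E {..<d} A \<in> sets (leb d)" by (intro sets_PiM_I_finite) auto
    have "emeasure ?D (Pi\<^sub>E {..<d} A) =
      (\<integral>\<^sup>+x. ennreal (exp (- (edist d x c)\<^sup>2 / (2 * v)) / (2 * pi * v) powr (real d / 2)) * indicator (Pi\<^sub>E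
        {..<d} A) x \<partial>leb d)"
      by (subst emeasure_density) auto
    also have "\<dots> = (\<integral>\<^sup>+x. (\<Prod>i<d. ennreal (normal_density (c i) (sqrt v) (x i)) * indicator (A i) (x i)) \<partial>leb d)"
    proof (intro nn_integral_cong)
      fix x :: point assume "x \<in> space (leb d)"
      then have x: "x \<in> extensional {..<d}" by (auto simp: space_PiM PiE_def)
      have "(2 * pi * v) powr (real d / 2) = sqrt (2 * pi * v) ^ d"
        using v by (simp add: powr_half_sqrt[symmetric] powr_realpow[symmetric] powr_powr)
      then have "exp (- (edist d x c)\<^sup>2 / (2 * v)) / (2 * pi * v) powr (real d / 2) =
        (\<Prod>i<d. normal_density (c i) (sqrt v) (x i))"
        using v by (simp add: normal_density_def prod_dividef edist_sq sum_divide_distrib sum_negf[symmetric] exp_sum)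
      moreover have "(indicator (Pi\<^sub>E {..<d} A) x :: ennreal) = (\<Prod>i<d. indicator (A i) (x i))"
        using x by (auto simp: indicator_def PiE_def Pi_def prod_zero_iff)
      ultimately show "ennreal (exp (- (edist d x c)\<^sup>2 / (2 * v)) / (2 * pi * v) powr (real d / 2)) * indicator
        (Pi\<^sub>E {..<d} A) x =
         (\<Prod>i<d. ennreal (normal_density (c i) (sqrt v) (x i)) * indicator (A i) (x i))"
        by (simp add: prod_ennreal prod.distrib)
    qed
    also have "\<dots> = (\<Prod>i<d. \<integral>\<^sup>+x. ennreal (normal_density (c i) (sqrt v) x) * indicator (A i) x \<partial>lborel)"
      by (intro product_nn_integral_prod) auto
    also have "\<dots> = (\<Prod>i<d. emeasure (density lborel (normal_density (c i) (sqrt v))) (A i))"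
      by (intro prod.cong refl) (auto simp: emeasure_density)
    finally show "emeasure ?D (Pi\<^sub>E {..<d} A) =
      (\<Prod>i\<in>{..<d}. emeasure (density lborel (normal_density (c i) (sqrt v))) (A i))" .
  qed auto
  then show ?thesis by (simp add: gaussian_def)
qed

text \<open>Makes the forward Gaussian step an instance of the locale for step (ii), with zero
  potential, so that both half steps share one theory.\<close>

lemma gaussian_eq_gibbs:
  assumes v: "v > 0"
  shows "gaussian d c v = gibbs d (regularized d (\<lambda>_. 0) v c)"
proof -
  have "(2 * pi * v) powr (real d / 2) > 0" using v by simp
  then show ?thesis
    using v unfolding gaussian_eq_density[OF v] gibbs_def regularized_def
    by (simp add: nn_integral_gauss_leb[unfolded minus_divide_left[symmetric]] divide_ennreal)
qed

section \<open>Strongly log-concave measures\<close>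

locale potential =
  fixes d :: nat and V :: "point \<Rightarrow> real" and \<alpha> h :: real
  assumes V_measurable [measurable]: "V \<in> borel_measurable (leb d)"
    and V_convex: "strongly_convex d \<alpha> V"
    and \<alpha>_nonneg: "0 \<le> \<alpha>" and h_pos: "0 < h"
    and V_bounded_below: "\<exists>B. \<forall>x\<in>pts d. B \<le> V x"
begin

abbreviation "U y \<equiv> regularized d V h y"
abbreviation "mu y \<equiv> gibbs d (regularized d V h y)"
text \<open>The modulus of strong convexity of \<open>U y\<close>: the quadratic term contributes
  exactly \<open>1 / h\<close>.\<close>

definition m where "m = \<alpha> + 1 / h"
definition z where "z y = (\<integral>x. exp (- U y x) \<partial>leb d)"

lemma m_pos: "m > 0"
  using \<alpha>_nonneg h_pos by (simp add: m_def add_nonneg_pos)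

lemma U_measurable [measurable]: "U y \<in> borel_measurable (leb d)"
  unfolding regularized_def by measurable

lemma U_convex:
  assumes a: "a \<in> pts d" and b: "b \<in> pts d" and t: "0 \<le> t" "t \<le> 1"
  shows "U y (\<lambda>i\<in>{..<d}. (1 - t) * a i + t * b i) \<le> (1 - t) * U y a + t * U y b - m / 2 * t * (1 - t) * (edist d a b)\<^sup>2"
proof -
  define c where "c = (\<lambda>i\<in>{..<d}. (1 - t) * a i + t * b i)"
  have V: "V c \<le> (1 - t) * V a + t * V b - \<alpha> / 2 * t * (1 - t) * (edist d a b)\<^sup>2"
    using V_convex a b t unfolding strongly_convex_def c_def by auto
  have eq: "(edist d c y)\<^sup>2 = (1 - t) * (edist d a y)\<^sup>2 + t * (edist d b y)\<^sup>2 - t * (1 - t) * (edist d a b)\<^sup>2"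
    unfolding edist_sq sum_distrib_left sum_subtractf[symmetric] sum.distrib[symmetric]
    by (intro sum.cong refl) (simp add: c_def power2_eq_square algebra_simps)
  have "(edist d c y)\<^sup>2 / (2 * h) = (1 - t) * ((edist d a y)\<^sup>2 / (2 * h)) + t * ((edist d b y)\<^sup>2 / (2 * h))
      - 1 / h / 2 * t * (1 - t) * (edist d a b)\<^sup>2"
    unfolding eq using h_pos by (simp add: field_simps)
  moreover have "m / 2 * t * (1 - t) * (edist d a b)\<^sup>2 =
    \<alpha> / 2 * t * (1 - t) * (edist d a b)\<^sup>2 + 1 / h / 2 * t * (1 - t) * (edist d a b)\<^sup>2"
    by (simp add: m_def add_divide_distrib distrib_right)
  ultimately have "U y c \<le> (1 - t) * U y a + t * U y b - m / 2 * t * (1 - t) * (edist d a b)\<^sup>2"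
    using V unfolding regularized_def distrib_left by linarith
  then show ?thesis unfolding c_def .
qed

text \<open>A linear tilt is absorbed into a shift of the Gaussian centre by \<open>h * w\<close>;
  hence \<open>mu y\<close> has exponential moments in every direction.\<close>

lemma complete_square:
  "- (edist d x y)\<^sup>2 / (2 * h) + ip d w x = - (edist d x (\<lambda>i. y i + h * w i))\<^sup>2 / (2 * h) + (ip d w y
    + h * ip d w w / 2)"
proof -
  have eq: "(edist d x (\<lambda>i. y i + h * w i))\<^sup>2 =
    (edist d x y)\<^sup>2 - 2 * h * ip d w x + 2 * h * ip d w y + h * h * ip d w w"
    unfolding edist_sq ip_def sum_distrib_left sum_subtractf[symmetric] sum.distrib[symmetric]
    by (intro sum.cong refl) (simp add: power2_eq_square algebra_simps)
  show ?thesis unfolding eq using h_pos by (simp add: field_simps)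
qed

lemma integrable_exp_leb: "integrable (leb d) (\<lambda>x. exp (- U y x + (ip d w x + c)))"
proof (rule integrableI_nonneg)
  obtain B where B: "\<And>x. x \<in> pts d \<Longrightarrow> B \<le> V x" using V_bounded_below by blast
  let ?y = "\<lambda>i. y i + h * w i"
  define K where "K = exp (c - B + (ip d w y + h * ip d w w / 2))"
  have "(\<integral>\<^sup>+x. ennreal (exp (- U y x + (ip d w x + c))) \<partial>leb d) \<le>
     (\<integral>\<^sup>+x. ennreal K * ennreal (exp (- (edist d x ?y)\<^sup>2 / (2 * h))) \<partial>leb d)"
  proof (rule nn_integral_mono)
    fix x :: point assume "x \<in> space (leb d)"
    then have "B \<le> V x" using B by (simp add: space_leb)
    then have "- U y x + (ip d w x + c) \<le> (c - B + (ip d w y + h * ip d w w / 2)) + (- (edist d x ?y)\<^sup>2 / (2 * h))"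
      using complete_square[of x y w] unfolding regularized_def by simp
    then have "exp (- U y x + (ip d w x + c)) \<le> K * exp (- (edist d x ?y)\<^sup>2 / (2 * h))"
      unfolding K_def by (metis exp_add exp_le_cancel_iff)
    then show "ennreal (exp (- U y x + (ip d w x + c))) \<le> ennreal K * ennreal (exp (- (edist d x ?y)\<^sup>2 / (2 * h)))"
      by (metis ennreal_leI ennreal_mult'' exp_ge_zero)
  qed
  also have "\<dots> = ennreal K * (\<integral>\<^sup>+x. ennreal (exp (- (edist d x ?y)\<^sup>2 / (2 * h))) \<partial>leb d)"
    by (intro nn_integral_cmult) measurable
  also have "\<dots> < \<infinity>" by (subst nn_integral_gauss_leb[OF h_pos]) (simp add: ennreal_mult_less_top)
  finally show "(\<integral>\<^sup>+x. ennreal (exp (- U y x + (ip d w x + c))) \<partial>leb d) < \<infinity>" .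
qed auto

lemma integrable_exp_U: "integrable (leb d) (\<lambda>x. exp (- U y x))"
  using integrable_exp_leb[of y "\<lambda>_. 0" 0] by (simp add: ip_def)

lemma nn_integral_exp_U: "(\<integral>\<^sup>+x. ennreal (exp (- U y x)) \<partial>leb d) = ennreal (z y)"
  unfolding z_def by (intro nn_integral_eq_integral integrable_exp_U) auto

lemma leb_not_null: "emeasure (leb d) (space (leb d)) \<noteq> 0"
proof
  assume "emeasure (leb d) (space (leb d)) = 0"
  then have "AE x in leb d. ennreal (exp (- (edist d x (\<lambda>_. 0))\<^sup>2 / (2 * 1))) = 0"
    by (intro AE_I[of _ _ "space (leb d)"]) auto
  then have "(\<integral>\<^sup>+x. ennreal (exp (- (edist d x (\<lambda>_. 0))\<^sup>2 / (2 * 1))) \<partial>leb d) = 0"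
    by (subst nn_integral_0_iff_AE) auto
  then show False using nn_integral_gauss_leb[of 1 d "\<lambda>_. 0"] by simp
qed

lemma z_pos: "z y > 0"
proof (rule ccontr)
  assume "\<not> z y > 0"
  then have "(\<integral>\<^sup>+x. ennreal (exp (- U y x)) \<partial>leb d) = 0" by (simp add: nn_integral_exp_U ennreal_neg)
  then have "AE x in leb d. ennreal (exp (- U y x)) = 0"
    by (subst (asm) nn_integral_0_iff_AE) auto
  then have "AE x in leb d. False" by simp
  then show False using leb_not_null by (auto simp: AE_iff_measurable[OF _ refl])
qed

lemma mu_eq: "mu y = density (leb d) (\<lambda>x. ennreal (exp (- U y x) / z y))"
  unfolding gibbs_def nn_integral_exp_U using z_pos[of y] by (simp add: divide_ennreal)

lemma sets_mu [simp, measurable_cong]: "sets (mu y) = sets (leb d)"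
  by (simp add: gibbs_def)

lemma space_mu [simp]: "space (mu y) = pts d"
  by (simp add: gibbs_def space_leb)

lemma nn_integral_mu:
  assumes [measurable]: "f \<in> borel_measurable (leb d)"
  shows "(\<integral>\<^sup>+x. f x \<partial>mu y) = (\<integral>\<^sup>+x. ennreal (exp (- U y x)) * f x \<partial>leb d) / ennreal (z y)"
proof -
  have "(\<integral>\<^sup>+x. f x \<partial>mu y) = (\<integral>\<^sup>+x. ennreal (exp (- U y x) / z y) * f x \<partial>leb d)"
    unfolding mu_eq by (intro nn_integral_density) measurable
  also have "\<dots> = (\<integral>\<^sup>+x. ennreal (exp (- U y x)) * f x / ennreal (z y) \<partial>leb d)"
    using z_pos[of y] by (intro nn_integral_cong) (simp add: divide_ennreal[symmetric] ennreal_times_divide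
      mult.commute)
  also have "\<dots> = (\<integral>\<^sup>+x. ennreal (exp (- U y x)) * f x \<partial>leb d) / ennreal (z y)"
    by (intro nn_integral_divide) measurable
  finally show ?thesis .
qed

lemma prob_space_mu: "prob_space (mu y)"
proof
  have "emeasure (mu y) (space (mu y)) = (\<integral>\<^sup>+x. 1 \<partial>mu y)" by simp
  also have "\<dots> = ennreal (z y) / ennreal (z y)" by (subst nn_integral_mu) (auto simp: nn_integral_exp_U)
  also have "\<dots> = 1" using z_pos[of y] by (simp add: divide_ennreal)
  finally show "emeasure (mu y) (space (mu y)) = 1" .
qed

lemma integral_mu:
  fixes f :: "point \<Rightarrow> real"
  assumes [measurable]: "f \<in> borel_measurable (leb d)"
  shows "(\<integral>x. f x \<partial>mu y) = (\<integral>x. exp (- U y x) * f x \<partial>leb d) / z y"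
proof -
  have "(\<integral>x. f x \<partial>mu y) = (\<integral>x. (exp (- U y x) / z y) * f x \<partial>leb d)"
    unfolding mu_eq using z_pos[of y] by (subst integral_density) (auto simp: less_imp_le)
  then show ?thesis by simp
qed

lemma integrable_mu:
  fixes f :: "point \<Rightarrow> real"
  assumes [measurable]: "f \<in> borel_measurable (leb d)"
  shows "integrable (mu y) f \<longleftrightarrow> integrable (leb d) (\<lambda>x. exp (- U y x) * f x)"
proof -
  have "integrable (mu y) f \<longleftrightarrow> integrable (leb d) (\<lambda>x. (1 / z y) * (exp (- U y x) * f x))"
    unfolding mu_eq using z_pos[of y] by (subst integrable_density) (auto simp: less_imp_le)
  also have "\<dots> \<longleftrightarrow> integrable (leb d) (\<lambda>x. exp (- U y x) * f x)"
    using z_pos[of y] by (simp only: integrable_mult_left_iff) auto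
  finally show ?thesis .
qed

lemma integrable_mu_exp [simp]: "integrable (mu y) (\<lambda>x. exp (ip d w x + c))"
proof -
  have "(\<lambda>x. exp (- U y x + (ip d w x + c))) = (\<lambda>x. exp (- U y x) * exp (ip d w x + c))"
    by (simp only: exp_add)
  then have "integrable (leb d) (\<lambda>x. exp (- U y x) * exp (ip d w x + c))"
    using integrable_exp_leb[of y w c] by simp
  moreover have "(\<lambda>x. exp (ip d w x + c)) \<in> borel_measurable (leb d)" by measurable
  ultimately show ?thesis by (simp only: integrable_mu)
qed

lemma integrable_mu_bounded:
  fixes f :: "point \<Rightarrow> real"
  assumes [measurable]: "f \<in> borel_measurable (leb d)" and "\<And>x. x \<in> pts d \<Longrightarrow> \<bar>f x\<bar> \<le> B"
  shows "integrable (mu y) f"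
proof -
  interpret prob_space "mu y" by (rule prob_space_mu)
  show ?thesis by (rule integrable_const_bound[of _ B]) (use assms in \<open>auto intro!: AE_I2\<close>)
qed

lemma integral_mu_exp_pos:
  fixes f :: "point \<Rightarrow> real"
  assumes "integrable (mu y) (\<lambda>x. exp (f x))"
  shows "(\<integral>x. exp (f x) \<partial>mu y) > 0"
proof -
  interpret prob_space "mu y" by (rule prob_space_mu)
  have "(\<integral>x. exp (f x) \<partial>mu y) \<noteq> 0"
    using assms by (subst integral_nonneg_eq_0_iff_AE) (auto simp: AE_False)
  moreover have "(\<integral>x. exp (f x) \<partial>mu y) \<ge> 0" by (intro integral_nonneg_AE) auto
  ultimately show ?thesis by linarith
qed

lemma nn_integral_leb_exp:
  fixes f :: "point \<Rightarrow> real"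
  assumes [measurable]: "f \<in> borel_measurable (leb d)" and i: "integrable (mu y) (\<lambda>x. exp (f x))"
  shows "(\<integral>\<^sup>+x. ennreal (exp (f x - U y x)) \<partial>leb d) = ennreal (z y * (\<integral>x. exp (f x) \<partial>mu y))"
proof -
  have "(\<integral>\<^sup>+x. ennreal (exp (f x - U y x)) \<partial>leb d) = (\<integral>\<^sup>+x. ennreal (exp (- U y x) * exp (f x)) \<partial>leb d)"
    by (intro nn_integral_cong) (simp add: exp_add[symmetric])
  also have "\<dots> = ennreal (\<integral>x. exp (- U y x) * exp (f x) \<partial>leb d)"
    using i by (intro nn_integral_eq_integral) (auto simp: integrable_mu)
  also have "(\<integral>x. exp (- U y x) * exp (f x) \<partial>leb d) = z y * (\<integral>x. exp (f x) \<partial>mu y)"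
    using z_pos[of y] by (subst integral_mu) auto
  finally show ?thesis .
qed

text \<open>The convexity surplus of \<open>U y\<close> reappears as slack in the hypothesis on
  \<open>\<phi>\<close>, \<open>\<psi>\<close>, \<open>\<eta>\<close>. The normalizing constant
  cancels because the two weights add up to 1.\<close>

lemma mu_prekopa_leindler:
  fixes \<phi> \<psi> \<eta> :: "point \<Rightarrow> real"
  assumes [measurable]: "\<phi> \<in> borel_measurable (leb d)" "\<psi> \<in> borel_measurable (leb d)" "\<eta> \<in> borel_measurable (leb d)"
    and i: "integrable (mu y) (\<lambda>x. exp (\<phi> x))" "integrable (mu y) (\<lambda>x. exp (\<psi> x))" "integrable (mu y) (\<lambda>x. exp (\<eta> x))"
    and t: "0 < t" "t < 1"
    and le: "\<And>a b. a \<in> pts d \<Longrightarrow> b \<in> pts d \<Longrightarrow> (1 - t) * \<phi> a + t * \<psi> b \<le>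
       \<eta> (\<lambda>i\<in>{..<d}. (1 - t) * a i + t * b i) + m / 2 * t * (1 - t) * (edist d a b)\<^sup>2"
  shows "(\<integral>x. exp (\<phi> x) \<partial>mu y) powr (1 - t) * (\<integral>x. exp (\<psi> x) \<partial>mu y) powr t \<le> (\<integral>x. exp (\<eta> x) \<partial>mu y)"
proof -
  note p = i[THEN integral_mu_exp_pos] z_pos[of y]
  let ?A = "z y * (\<integral>x. exp (\<phi> x) \<partial>mu y)" and ?B = "z y * (\<integral>x. exp (\<psi> x) \<partial>mu y)"
  have "ennreal (?A powr (1 - t) * ?B powr t) \<le> (\<integral>\<^sup>+x. ennreal (exp (\<eta> x - U y x)) \<partial>leb d)"
  proof (rule prekopa_leindler[where F="\<lambda>x. ennreal (exp (\<phi> x - U y x))" and G="\<lambda>x. ennreal (exp (\<psi> x - U y x))"])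
    fix a b :: point and u v :: real
    assume ab: "a \<in> pts d" "b \<in> pts d" and uv: "0 < u" "0 < v" "ennreal u \<le>
      ennreal (exp (\<phi> a - U y a))" "ennreal v \<le> ennreal (exp (\<psi> b - U y b))"
    let ?c = "\<lambda>i\<in>{..<d}. (1 - t) * a i + t * b i"
    have "ln u \<le> \<phi> a - U y a" "ln v \<le> \<psi> b - U y b"
      using uv by (metis ennreal_le_iff exp_ge_zero exp_gt_zero ln_exp ln_le_cancel_iff)+
    then have "(1 - t) * ln u + t * ln v \<le> (1 - t) * (\<phi> a - U y a) + t * (\<psi> b - U y b)"
      using t by (intro add_mono mult_left_mono) auto
    also have "\<dots> \<le> \<eta> ?c - U y ?c"
      using le[OF ab] U_convex[OF ab, of t y] t by (simp add: algebra_simps)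
    finally have "u powr (1 - t) * v powr t \<le> exp (\<eta> ?c - U y ?c)"
      using uv by (simp add: powr_def exp_add[symmetric])
    then show "ennreal (u powr (1 - t) * v powr t) \<le> ennreal (exp (\<eta> ?c - U y ?c))"
      by (rule ennreal_leI)
  qed (use t p i in \<open>auto simp: nn_integral_leb_exp\<close>)
  then have "?A powr (1 - t) * ?B powr t \<le> z y * (\<integral>x. exp (\<eta> x) \<partial>mu y)"
    using p i by (simp add: nn_integral_leb_exp ennreal_le_iff)
  moreover have "?A powr (1 - t) * ?B powr t =
    z y * ((\<integral>x. exp (\<phi> x) \<partial>mu y) powr (1 - t) * (\<integral>x. exp (\<psi> x) \<partial>mu y) powr t)"
  proof -
    have "z y powr (1 - t) * z y powr t = z y" using p by (simp add: powr_add[symmetric])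
    then show ?thesis using p by (simp add: powr_mult algebra_simps)
  qed
  ultimately show ?thesis using p by simp
qed

lemma measure_mu [simp]: "measure (mu y) (pts d) = 1"
  using prob_space.prob_space[OF prob_space_mu[of y]] by simp

definition mean where "mean y = (\<lambda>i. \<integral>x. x i \<partial>mu y)"

lemma integrable_ip [simp]: "integrable (mu y) (\<lambda>x. ip d w x)"
proof (rule Bochner_Integration.integrable_bound)
  show "integrable (mu y) (\<lambda>x. exp (ip d w x + 0) + exp (ip d (\<lambda>i. (-1) * w i) x + 0))"
    by (intro Bochner_Integration.integrable_add integrable_mu_exp)
  have "\<bar>u\<bar> \<le> exp u + exp (- u)" for u :: real
    using exp_ge_add_one_self[of u] exp_ge_add_one_self[of "-u"] exp_gt_zero[of u] exp_gt_zero[of "-u"] by linarith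
  then show "AE x in mu y. norm (ip d w x) \<le> norm (exp (ip d w x + 0) + exp (ip d (\<lambda>i. (-1) * w i) x + 0))"
    by (intro AE_I2) (simp add: ip_scale[of d "-1", simplified] add_pos_pos)
qed measurable

lemma integrable_coord: "i < d \<Longrightarrow> integrable (mu y) (\<lambda>x. x i)"
  using integrable_ip[of y "\<lambda>j. if j = i then 1 else 0"] by (simp add: ip_def if_distrib[of "\<lambda>u. u * _"] cong: if_cong)

lemma integral_ip: "(\<integral>x. ip d w x \<partial>mu y) = ip d w (mean y)"
  unfolding ip_def mean_def by (subst Bochner_Integration.integral_sum) (auto intro: integrable_coord)

definition X where "X w y x = ip d w x - ip d w (mean y)"

lemma X_measurable [measurable]: "X w y \<in> borel_measurable (leb d)"
  unfolding X_def by measurable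

lemma integrable_X [simp]: "integrable (mu y) (X w y)"
proof -
  interpret prob_space "mu y" by (rule prob_space_mu)
  show ?thesis unfolding X_def by simp
qed

lemma integral_X: "(\<integral>x. X w y x \<partial>mu y) = 0"
proof -
  interpret prob_space "mu y" by (rule prob_space_mu)
  show ?thesis unfolding X_def by (simp add: integral_ip prob_space)
qed

lemma X_scale: "X (\<lambda>i. s * w i) y x = s * X w y x"
  by (simp add: X_def ip_scale right_diff_distrib)

lemma integrable_exp_X [simp]: "integrable (mu y) (\<lambda>x. exp (X w y x))"
  using integrable_mu_exp[of y w "- ip d w (mean y)"] by (simp add: X_def)

lemma integrable_exp_sX [simp]: "integrable (mu y) (\<lambda>x. exp (s * X w y x))"
  using integrable_exp_X[of y "\<lambda>i. s * w i"] by (simp add: X_scale)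

text \<open>Convexity of exp between 0 and \<open>u\<close>; it supplies the integrable majorant for
  the difference quotients at 0.\<close>

lemma exp_scaled_le:
  fixes u t :: real
  assumes "0 < t" "t < 1"
  shows "exp (t * u) - 1 \<le> t * (exp u - 1)"
  using young_weighted[of 1 "exp u" t] assms by (simp add: powr_def algebra_simps)

lemma expm1_scaled_tendsto:
  fixes u :: real
  shows "(\<lambda>n. (exp (1 / (real n + 2) * u) - 1) / (1 / (real n + 2))) \<longlonglongrightarrow> u"
proof (cases u "0::real" rule: linorder_cases)
  case less
  then show ?thesis by real_asymp
next
  case equal
  then show ?thesis by simp
next
  case greater
  then show ?thesis by real_asymp
qed

text \<open>The Prekopa-Leindler inequality makes \<open>\<theta> \<mapsto> ln (\<integral>x. exp (ip d \<theta> x) \<partial>mu y) - ip d \<theta> \<theta> / (2 * m)\<close> concave;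
  comparing it with its tangent at \<open>0\<close> gives the sub-Gaussian bound with the sharp constant.\<close>

lemma mgf_bound: "(\<integral>x. exp (X w y x) \<partial>mu y) \<le> exp (ip d w w / (2 * m))"
proof -
  interpret prob_space "mu y" by (rule prob_space_mu)
  define Q where "Q = ip d w w / (2 * m)"
  define L where "L = (\<integral>x. exp (X w y x) \<partial>mu y)"
  have L: "L > 0" unfolding L_def by (intro integral_mu_exp_pos) simp
  have le: "ln L - Q \<le> (\<integral>x. (exp (t * X w y x) - 1) / t \<partial>mu y)" if t: "0 < t" "t < 1" for t
  proof -
    \<comment> \<open>Prekopa-Leindler for the functions 0 and \<open>X w y\<close>. The constant
      \<open>Q\<close> is what Young's inequality leaves when the linear increment along
      \<open>b - a\<close> is paid for by \<open>m / 2 * |a - b|^2\<close>.\<close>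
    have pl: "(\<integral>x. exp (0::real) \<partial>mu y) powr (1 - t) * L powr t \<le> (\<integral>x. exp (t * X w y x + t * (1 - t) * Q) \<partial>mu y)"
      unfolding L_def
    proof (rule mu_prekopa_leindler)
      show "integrable (mu y) (\<lambda>x. exp (t * X w y x + t * (1 - t) * Q))"
        by (simp add: exp_add)
      fix a b assume ab: "a \<in> pts d" "b \<in> pts d"
      let ?c = "\<lambda>i\<in>{..<d}. (1 - t) * a i + t * b i"
      have "X w y b - X w y ?c = (1 - t) * (\<Sum>i<d. w i * (b i - a i))"
        unfolding X_def ip_def sum_distrib_left
        by (simp add: sum_subtractf[symmetric] algebra_simps)
      moreover have "(\<Sum>i<d. w i * (b i - a i)) \<le> (\<Sum>i<d. w i * w i / (2 * m) + m / 2 * (a i - b i)\<^sup>2)"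
      proof (rule sum_mono)
        fix i
        have "0 \<le> (w i - m * (b i - a i))\<^sup>2 / (2 * m)" using m_pos by simp
        also have "\<dots> = w i * w i / (2 * m) + m / 2 * (a i - b i)\<^sup>2 - w i * (b i - a i)"
          using m_pos by (simp add: power2_eq_square field_simps)
        finally show "w i * (b i - a i) \<le> w i * w i / (2 * m) + m / 2 * (a i - b i)\<^sup>2" by simp
      qed
      moreover have "(\<Sum>i<d. w i * w i / (2 * m) + m / 2 * (a i - b i)\<^sup>2) = Q + m / 2 * (edist d a b)\<^sup>2"
        by (simp add: Q_def ip_def edist_sq sum.distrib sum_divide_distrib sum_distrib_left)
      ultimately have "X w y b - X w y ?c \<le> (1 - t) * (Q + m / 2 * (edist d a b)\<^sup>2)"
        using t by (auto intro!: mult_left_mono)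
      then have "t * (X w y b - X w y ?c) \<le> t * ((1 - t) * (Q + m / 2 * (edist d a b)\<^sup>2))"
        using t by (intro mult_left_mono) auto
      moreover have "t * ((1 - t) * (Q + m / 2 * (edist d a b)\<^sup>2)) =
        t * (1 - t) * Q + m / 2 * t * (1 - t) * (edist d a b)\<^sup>2"
        by (simp add: distrib_left)
      ultimately show "(1 - t) * 0 + t * X w y b \<le>
        t * X w y ?c + t * (1 - t) * Q + m / 2 * t * (1 - t) * (edist d a b)\<^sup>2"
        unfolding right_diff_distrib by linarith
    qed (use t in auto)
    define E where "E = (\<integral>x. exp (t * X w y x) \<partial>mu y)"
    have E: "E > 0" unfolding E_def by (intro integral_mu_exp_pos) simp
    have "(\<integral>x. exp (t * X w y x + t * (1 - t) * Q) \<partial>mu y) = exp (t * (1 - t) * Q) * E"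
      by (simp add: E_def exp_add)
    with pl have "L powr t \<le> exp (t * (1 - t) * Q) * E" by (simp add: prob_space)
    then have "ln (L powr t) \<le> ln (exp (t * (1 - t) * Q) * E)"
      using L E by (subst ln_le_cancel_iff) auto
    then have "t * ln L \<le> t * (1 - t) * Q + ln E" using L E by (simp add: ln_powr ln_mult)
    \<comment> \<open>Replacing \<open>ln E\<close> by \<open>E - 1\<close> leaves a difference
      quotient under the integral, so dominated convergence suffices and no logarithm of an integral
      is differentiated.\<close>
    moreover have "ln E \<le> E - 1" using E by (simp add: ln_le_minus_one)
    moreover have "t * (1 - t) * Q \<le> t * Q"
      using t m_pos by (intro mult_right_mono) (auto simp: Q_def ip_nonneg)
    ultimately have "t * (ln L - Q) \<le> E - 1" by (simp add: right_diff_distrib)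
    then have "ln L - Q \<le> (E - 1) / t" using t by (simp add: field_simps)
    also have "(E - 1) / t = (\<integral>x. (exp (t * X w y x) - 1) / t \<partial>mu y)"
      by (simp add: E_def prob_space)
    finally show ?thesis .
  qed
  \<comment> \<open>The shift by 2 keeps the weight strictly between 0 and 1 for every
    \<open>n\<close>. The limit of the quotients is the mean of \<open>X w y\<close>, which vanishes
    by centring.\<close>
  define t where "t n = 1 / (real n + 2)" for n
  have t: "0 < t n" "t n < 1" for n by (auto simp: t_def)
  have "(\<lambda>n. \<integral>x. (exp (t n * X w y x) - 1) / t n \<partial>mu y) \<longlonglongrightarrow> (\<integral>x. X w y x \<partial>mu y)"
  proof (rule integral_dominated_convergence[where w="\<lambda>x. \<bar>X w y x\<bar> + exp (X w y x) + 1"])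
    show "AE x in mu y. (\<lambda>n. (exp (t n * X w y x) - 1) / t n) \<longlonglongrightarrow> X w y x"
    proof (intro AE_I2)
      fix x
      show "(\<lambda>n. (exp (t n * X w y x) - 1) / t n) \<longlonglongrightarrow> X w y x"
        unfolding t_def by (rule expm1_scaled_tendsto)
    qed
    fix n
    show "AE x in mu y. norm ((exp (t n * X w y x) - 1) / t n) \<le> \<bar>X w y x\<bar> + exp (X w y x) + 1"
    proof (intro AE_I2)
      fix x
      have "exp (t n * X w y x) - 1 \<le> t n * (exp (X w y x) - 1)" by (rule exp_scaled_le[OF t])
      moreover have "t n * X w y x \<le> exp (t n * X w y x) - 1" using exp_ge_add_one_self[of "t n * X w y x"] by linarith
      ultimately have "(exp (t n * X w y x) - 1) / t n \<le> exp (X w y x) - 1" "X w y x \<le> (exp (t n * X w y x) - 1) / t n"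
        using t[of n] by (auto simp: field_simps)
      then show "norm ((exp (t n * X w y x) - 1) / t n) \<le> \<bar>X w y x\<bar> + exp (X w y x) + 1"
        using exp_gt_zero[of "X w y x"] unfolding real_norm_def by linarith
    qed
  qed auto
  then have "ln L - Q \<le> 0" unfolding integral_X
    by (rule LIMSEQ_le_const) (use le t in auto)
  then have "exp (ln L) \<le> exp Q" by simp
  then have "L \<le> exp Q" using L by simp
  then show ?thesis by (simp add: L_def Q_def)
qed

lemma mgf_ge_1: "1 \<le> (\<integral>x. exp (X w y x) \<partial>mu y)"
proof -
  interpret prob_space "mu y" by (rule prob_space_mu)
  have "(\<integral>x. 1 + X w y x \<partial>mu y) \<le> (\<integral>x. exp (X w y x) \<partial>mu y)"
    by (intro integral_mono) auto
  then show ?thesis by (simp add: integral_X prob_space)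
qed

end

section \<open>Transport-entropy and logarithmic Sobolev inequalities\<close>

text \<open>Two-sided bounds keep logarithms, real powers and entropies bounded, and they survive
  averaging by probability kernels and positive powers. Other test functions are reached only in the
  duality argument for the Renyi divergence.\<close>

definition bounded_pos :: "nat \<Rightarrow> (point \<Rightarrow> real) \<Rightarrow> bool" where
  "bounded_pos d f \<longleftrightarrow> f \<in> borel_measurable (leb d) \<and> (\<exists>\<delta> D. 0 < \<delta> \<and> (\<forall>x\<in>pts d. \<delta> \<le> f x \<and> f x \<le> D))"

lemma bounded_posE:
  assumes "bounded_pos d f"
  obtains \<delta> D where "0 < \<delta>" "\<delta> \<le> D" "f \<in> borel_measurable (leb d)" "\<And>x. x \<in> pts d \<Longrightarrow> \<delta> \<le> f x" "\<And>x. x \<in> pts d \<Longrightarrow> f x \<le> D"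
proof -
  obtain \<delta> D where *: "0 < \<delta>" "\<And>x. x \<in> pts d \<Longrightarrow> \<delta> \<le> f x \<and> f x \<le> D" "f \<in> borel_measurable (leb d)"
    using assms unfolding bounded_pos_def by blast
  have "\<delta> \<le> D" using *(2)[of "\<lambda>i\<in>{..<d}. 0"] by simp
  with * show ?thesis using that by blast
qed

text \<open>Discriminant argument: the best choice is \<open>s = A / B\<close>, and for
  \<open>B = 0\<close> the value \<open>s = (E + 1) / A\<close> forces \<open>A = 0\<close>.\<close>

lemma quadratic_bound:
  fixes A B E :: real
  assumes "\<And>s. s * A \<le> E + s\<^sup>2 * B / 2" and "0 \<le> B"
  shows "A\<^sup>2 \<le> 2 * B * E"
proof (cases "B = 0")
  case True
  have "A = 0"
  proof (rule ccontr)
    assume "A \<noteq> 0"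
    then show False using assms(1)[of "(E + 1) / A"] True by simp
  qed
  then show ?thesis using True by simp
next
  case False
  then have B: "B > 0" using assms(2) by simp
  have "A / B * A \<le> E + (A / B)\<^sup>2 * B / 2" by (rule assms(1))
  then show ?thesis using B by (simp add: field_simps power2_eq_square)
qed

text \<open>Fenchel-Young duality between entropy and exponential, with equality at
  \<open>u = ln (f / F)\<close>.\<close>

lemma young_entropy:
  fixes f u F :: real
  assumes "0 < f" "0 < F"
  shows "f * u \<le> f * ln f - f * ln F - f + F * exp u"
proof -
  have "1 + (u - ln f + ln F) \<le> exp (u - ln f + ln F)" by (rule exp_ge_add_one_self)
  also have "\<dots> = exp u * F / f" using assms by (simp add: exp_add exp_diff)
  finally have "f * (1 + (u - ln f + ln F)) \<le> f * (exp u * F / f)" using assms by (intro mult_left_mono) auto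
  then show ?thesis using assms by (simp add: algebra_simps)
qed

lemma ip_scale2: "ip d (\<lambda>i. s * w i) (\<lambda>i. s * w i) = s\<^sup>2 * ip d w w"
  by (simp add: ip_def sum_distrib_left power2_eq_square algebra_simps)

context potential
begin

definition ent where "ent y f = (\<integral>x. f x * ln (f x) \<partial>mu y) - (\<integral>x. f x \<partial>mu y) * ln (\<integral>x. f x \<partial>mu y)"

text \<open>The gradient of \<open>y \<mapsto> \<integral>x. f x \<partial>mu y\<close>:
  differentiating the Gaussian factor together with the normalizing constant leaves the covariance
  of \<open>f\<close> with \<open>x\<close>, divided by \<open>h\<close>.\<close>

definition grad where "grad y f = (\<lambda>i. (\<integral>x. f x * (x i - mean y i) \<partial>mu y) / h)"

lemma integral_bounds:
  fixes f :: "point \<Rightarrow> real"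
  assumes [measurable]: "f \<in> borel_measurable (leb d)" and b: "\<And>x. x \<in> pts d \<Longrightarrow> \<delta> \<le> f x" "\<And>x. x \<in> pts d \<Longrightarrow> f x \<le> D"
  shows "integrable (mu y) f" "\<delta> \<le> (\<integral>x. f x \<partial>mu y)" "(\<integral>x. f x \<partial>mu y) \<le> D"
proof -
  interpret prob_space "mu y" by (rule prob_space_mu)
  have "\<bar>f x\<bar> \<le> \<bar>\<delta>\<bar> + \<bar>D\<bar>" if "x \<in> pts d" for x using b[OF that] by linarith
  then show i: "integrable (mu y) f" by (intro integrable_mu_bounded) auto
  show "\<delta> \<le> (\<integral>x. f x \<partial>mu y)" using b i by (intro integral_ge_const) auto
  show "(\<integral>x. f x \<partial>mu y) \<le> D" using b i by (intro integral_le_const) auto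
qed

lemma integrable_bounded_times:
  fixes f g :: "point \<Rightarrow> real"
  assumes [measurable]: "f \<in> borel_measurable (leb d)" and b: "\<And>x. x \<in> pts d \<Longrightarrow> \<bar>f x\<bar> \<le> D" and g: "integrable (mu y) g"
  shows "integrable (mu y) (\<lambda>x. f x * g x)"
proof (rule Bochner_Integration.integrable_bound)
  show "integrable (mu y) (\<lambda>x. D * g x)" using g by simp
  have "D \<ge> 0" using b[of "\<lambda>i\<in>{..<d}. 0"] by simp
  then show "AE x in mu y. norm (f x * g x) \<le> norm (D * g x)"
    using b by (intro AE_I2) (auto simp: abs_mult intro!: mult_right_mono)
  have [measurable]: "g \<in> borel_measurable (leb d)" using borel_measurable_integrable[OF g] by simp
  show "(\<lambda>x. f x * g x) \<in> borel_measurable (mu y)" by measurable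
qed

lemma mult_ln_bounds:
  fixes f \<delta> D :: real
  assumes "0 < \<delta>" "\<delta> \<le> f" "f \<le> D"
  shows "\<bar>f * ln f\<bar> \<le> D * (\<bar>ln \<delta>\<bar> + \<bar>ln D\<bar>)"
proof -
  have "ln \<delta> \<le> ln f" "ln f \<le> ln D" using assms by auto
  then have "\<bar>ln f\<bar> \<le> \<bar>ln \<delta>\<bar> + \<bar>ln D\<bar>" by linarith
  then show ?thesis using assms unfolding abs_mult by (intro mult_mono) auto
qed

lemma integrable_f_ln:
  assumes "bounded_pos d f"
  shows "integrable (mu y) (\<lambda>x. f x * ln (f x))"
proof -
  obtain \<delta> D where *: "0 < \<delta>" "\<And>x. x \<in> pts d \<Longrightarrow> \<delta> \<le> f x" "\<And>x. x \<in> pts d \<Longrightarrow> f x \<le> D"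
    and [measurable]: "f \<in> borel_measurable (leb d)" using bounded_posE[OF assms] by metis
  show ?thesis
    by (rule integrable_mu_bounded[where B="D * (\<bar>ln \<delta>\<bar> + \<bar>ln D\<bar>)"]) (use * in \<open>auto intro: mult_ln_bounds\<close>)
qed

text \<open>This is \<open>young_entropy\<close> at \<open>u = 0\<close> with \<open>F\<close> the
  mean of \<open>f\<close>, integrated.\<close>

lemma ent_nonneg:
  assumes f: "bounded_pos d f"
  shows "0 \<le> ent y f"
proof -
  interpret prob_space "mu y" by (rule prob_space_mu)
  obtain \<delta> D where *: "0 < \<delta>" "\<And>x. x \<in> pts d \<Longrightarrow> \<delta> \<le> f x" "\<And>x. x \<in> pts d \<Longrightarrow> f x \<le> D"
    and [measurable]: "f \<in> borel_measurable (leb d)" using bounded_posE[OF f] by metis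
  define F where "F = (\<integral>x. f x \<partial>mu y)"
  have i: "integrable (mu y) f" and F: "F \<ge> \<delta>" using integral_bounds[of f \<delta> D y] * by (auto simp: F_def)
  have Fp: "F > 0" using F * by simp
  have "(\<integral>x. f x * 0 \<partial>mu y) \<le> (\<integral>x. f x * ln (f x) - f x * ln F - f x + F * exp 0 \<partial>mu y)"
  proof (rule integral_mono)
    fix x assume "x \<in> space (mu y)"
    then have "f x > 0" using *(1) *(2)[of x] by auto
    then show "f x * 0 \<le> f x * ln (f x) - f x * ln F - f x + F * exp 0"
      by (rule young_entropy[OF _ Fp])
  qed (use integrable_f_ln[OF f] i in auto)
  also have "\<dots> = ent y f" using integrable_f_ln[OF f] i by (simp add: ent_def F_def[symmetric])
  finally show ?thesis by simp
qed

text \<open>The entropy duality is tested on \<open>s * X w y\<close> minus its sub-Gaussian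
  exponent, so that the exponential integral is at most 1; the resulting bound is linear plus
  quadratic in \<open>s\<close> and is optimized by \<open>quadratic_bound\<close>.\<close>

lemma transport_entropy:
  assumes f: "bounded_pos d f"
  shows "(\<integral>x. f x * X w y x \<partial>mu y)\<^sup>2 \<le> 2 * ((\<integral>x. f x \<partial>mu y) * (ip d w w / m)) * ent y f"
proof (rule quadratic_bound)
  interpret prob_space "mu y" by (rule prob_space_mu)
  obtain \<delta> D where *: "0 < \<delta>" "\<And>x. x \<in> pts d \<Longrightarrow> \<delta> \<le> f x" "\<And>x. x \<in> pts d \<Longrightarrow> f x \<le> D"
    and [measurable]: "f \<in> borel_measurable (leb d)" using bounded_posE[OF f] by metis
  have ab: "\<bar>f x\<bar> \<le> D" if "x \<in> pts d" for x using *(1) *(2,3)[OF that] by linarith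
  define F where "F = (\<integral>x. f x \<partial>mu y)"
  have i: "integrable (mu y) f" and F: "F \<ge> \<delta>" using integral_bounds[of f \<delta> D y] * by (auto simp: F_def)
  have Fp: "F > 0" using F * by simp
  show "0 \<le> (\<integral>x. f x \<partial>mu y) * (ip d w w / m)" using Fp m_pos by (simp add: F_def ip_nonneg)
  fix s :: real
  define c where "c = s\<^sup>2 * ip d w w / (2 * m)"
  have mgf: "(\<integral>x. exp (s * X w y x) \<partial>mu y) \<le> exp c"
    using mgf_bound[where w="\<lambda>i. s * w i" and y=y] by (simp add: X_scale c_def ip_scale2)
  have iX: "integrable (mu y) (\<lambda>x. f x * X w y x)"
    by (rule integrable_bounded_times[OF _ ab]) auto
  have "(\<integral>x. f x * (s * X w y x - c) \<partial>mu y) \<le> (\<integral>x. f x * ln (f x) - f x * ln F - f x + F * exp (s * X w y x - c) \<partial>mu y)"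
  proof (rule integral_mono)
    show "integrable (mu y) (\<lambda>x. f x * (s * X w y x - c))"
      by (rule integrable_bounded_times[OF _ ab]) auto
    show "integrable (mu y) (\<lambda>x. f x * ln (f x) - f x * ln F - f x + F * exp (s * X w y x - c))"
      using integrable_f_ln[OF f] i by (simp add: exp_diff)
    fix x assume "x \<in> space (mu y)"
    then have "f x > 0" using *(1) *(2)[of x] by auto
    then show "f x * (s * X w y x - c) \<le> f x * ln (f x) - f x * ln F - f x + F * exp (s * X w y x - c)"
      by (rule young_entropy[OF _ Fp])
  qed
  also have "\<dots> = ent y f - F + F * ((\<integral>x. exp (s * X w y x) \<partial>mu y) / exp c)"
    using integrable_f_ln[OF f] i by (simp add: exp_diff ent_def F_def[symmetric])
  also have "\<dots> \<le> ent y f - F + F * 1"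
    using Fp mgf by (intro add_left_mono mult_left_mono) (auto simp: divide_le_eq)
  also have "(\<integral>x. f x * (s * X w y x - c) \<partial>mu y) = (\<integral>x. s * (f x * X w y x) - c * f x \<partial>mu y)"
    by (intro Bochner_Integration.integral_cong) (auto simp: algebra_simps)
  also have "\<dots> = s * (\<integral>x. f x * X w y x \<partial>mu y) - c * F"
    using iX i by (simp add: F_def)
  finally have "s * (\<integral>x. f x * X w y x \<partial>mu y) \<le> ent y f + c * F" by simp
  also have "c * F = s\<^sup>2 * (F * (ip d w w / m)) / 2" using m_pos by (simp add: c_def field_simps)
  finally show "s * (\<integral>x. f x * X w y x \<partial>mu y) \<le> ent y f + s\<^sup>2 * ((\<integral>x. f x \<partial>mu y) * (ip d w w / m)) / 2"
    by (simp add: F_def)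
qed

lemma ip_grad:
  fixes f :: "point \<Rightarrow> real"
  assumes [measurable]: "f \<in> borel_measurable (leb d)" and b: "\<And>x. x \<in> pts d \<Longrightarrow> \<bar>f x\<bar> \<le> D"
  shows "ip d w (grad y f) = (\<integral>x. f x * X w y x \<partial>mu y) / h"
proof -
  interpret prob_space "mu y" by (rule prob_space_mu)
  have i: "integrable (mu y) (\<lambda>x. f x * (x i - mean y i))" if "i < d" for i
    using that by (intro integrable_bounded_times[OF _ b]) (auto intro!: integrable_coord)
  have "(\<integral>x. f x * X w y x \<partial>mu y) = (\<integral>x. (\<Sum>i<d. w i * (f x * (x i - mean y i))) \<partial>mu y)"
    by (intro Bochner_Integration.integral_cong)
      (auto simp: X_def ip_def sum_distrib_left sum_subtractf[symmetric] algebra_simps)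
  also have "\<dots> = (\<Sum>i<d. w i * (\<integral>x. f x * (x i - mean y i) \<partial>mu y))"
    using i by (subst Bochner_Integration.integral_sum) auto
  finally show ?thesis by (simp add: ip_def grad_def sum_divide_distrib)
qed

text \<open>Applying \<open>transport_entropy\<close> in the direction of the gradient itself bounds
  the square of its squared length by that squared length times the right-hand side; one factor then
  cancels.\<close>

lemma grad_bound:
  assumes f: "bounded_pos d f"
  shows "ip d (grad y f) (grad y f) \<le> 2 / (h\<^sup>2 * m) * (\<integral>x. f x \<partial>mu y) * ent y f"
proof -
  obtain \<delta> D where *: "0 < \<delta>" "\<And>x. x \<in> pts d \<Longrightarrow> \<delta> \<le> f x" "\<And>x. x \<in> pts d \<Longrightarrow> f x \<le> D"
    and [measurable]: "f \<in> borel_measurable (leb d)" using bounded_posE[OF f] by metis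
  have ab: "\<bar>f x\<bar> \<le> D" if "x \<in> pts d" for x using *(1) *(2,3)[OF that] by linarith
  let ?g = "grad y f"
  define G where "G = ip d ?g ?g"
  define R where "R = 2 / (h\<^sup>2 * m) * (\<integral>x. f x \<partial>mu y) * ent y f"
  have "G = (\<integral>x. f x * X ?g y x \<partial>mu y) / h"
    unfolding G_def by (rule ip_grad[OF _ ab]) auto
  then have "G\<^sup>2 = (\<integral>x. f x * X ?g y x \<partial>mu y)\<^sup>2 / h\<^sup>2" by (simp add: power_divide)
  also have "\<dots> \<le> 2 * ((\<integral>x. f x \<partial>mu y) * (G / m)) * ent y f / h\<^sup>2"
    unfolding G_def by (intro divide_right_mono transport_entropy f) auto
  also have "\<dots> = G * R" by (simp add: R_def field_simps)
  finally have GR: "G * G \<le> G * R" by (simp add: power2_eq_square)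
  have "G \<ge> 0" by (simp add: G_def ip_nonneg)
  moreover have "0 \<le> R"
    using m_pos ent_nonneg[OF f] integral_bounds(2)[of f \<delta> D y] * by (auto simp: R_def)
  ultimately have "G \<le> R" using GR by (cases "G = 0") (auto simp: mult_le_cancel_left)
  then show ?thesis by (simp add: G_def R_def)
qed

end

text \<open>\<open>gradient_entropy_bound d c f F\<close> records a gradient \<open>g\<close> of \<open>f\<close> with a quadratic remainder and the reverse
  logarithmic
  Sobolev bound \<open>|g|\<^sup>2 \<le> c f (F - f ln f)\<close>; \<open>F\<close> will be the image of \<open>u ln u\<close> under the Markov kernel that
  maps \<open>u\<close> to \<open>f\<close>.\<close>

definition gradient_entropy_bound :: "nat \<Rightarrow> real \<Rightarrow> (point \<Rightarrow> real) \<Rightarrow> (point \<Rightarrow> real) \<Rightarrow> bool" where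
  "gradient_entropy_bound d c f F \<longleftrightarrow> bounded_pos d f \<and> F \<in> borel_measurable (leb d) \<and> (\<exists>K. \<forall>x\<in>pts d. \<bar>F x\<bar> \<le> K) \<and> 0 \<le> c \<and>
     (\<exists>L g. \<forall>x\<in>pts d. (\<forall>w\<in>pts d. \<bar>f (padd d x w) - f x - ip d w (g x)\<bar> \<le> L * ip d w w) \<and>
        ip d (g x) (g x) \<le> c * f x * (F x - f x * ln (f x)))"

lemma exp_minus_one_le:
  fixes s :: real
  assumes "0 \<le> s" "s \<le> 1"
  shows "exp (s / 2) - 1 \<le> s" "exp s \<le> 1 + s + s\<^sup>2"
proof -
  show "exp s \<le> 1 + s + s\<^sup>2" using assms by (rule exp_bound)
  have "exp (s / 2) \<le> 1 + s / 2 + (s / 2)\<^sup>2" using assms by (intro exp_bound) auto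
  moreover have "s / 2 * (s / 2) \<le> s / 2 * 1" using assms by (intro mult_left_mono) auto
  ultimately show "exp (s / 2) - 1 \<le> s" unfolding power2_eq_square by linarith
qed

section \<open>Dependence of the conditional measures on their centre\<close>

context potential
begin

text \<open>Moving the centre by \<open>w\<close> tilts the measure by
  \<open>exp (ip d w x / h)\<close>. All questions about nearby centres thus become questions about
  exponential moments under one measure \<open>mu y\<close>.\<close>

lemma integral_mu_shift:
  fixes f :: "point \<Rightarrow> real"
  assumes [measurable]: "f \<in> borel_measurable (leb d)"
  shows "(\<integral>x. f x \<partial>mu (padd d y w)) = (\<integral>x. f x * exp (X (\<lambda>i. (1 / h) * w i) y x) \<partial>mu y) / (\<integral>x. exp (X (\<lambda>i. (1 /
    h) * w i) y x) \<partial>mu y)"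
proof -
  let ?w = "\<lambda>i. (1 / h) * w i"
  define K where "K = ip d w y / h + ip d w w / (2 * h) - ip d w (mean y) / h"
  have U: "U (padd d y w) x = U y x - X ?w y x + K" for x
  proof -
    have "(edist d x (padd d y w))\<^sup>2 = (edist d x y)\<^sup>2 - 2 * ip d w x + 2 * ip d w y + ip d w w"
      unfolding edist_sq ip_def sum_distrib_left sum_subtractf[symmetric] sum.distrib[symmetric]
      by (intro sum.cong refl) (simp add: padd_def power2_eq_square algebra_simps)
    then have "(edist d x (padd d y w))\<^sup>2 / (2 * h) =
      (edist d x y)\<^sup>2 / (2 * h) - ip d w x / h + ip d w y / h + ip d w w / (2 * h)"
      using h_pos by (simp add: add_divide_distrib diff_divide_distrib)
    moreover have "X ?w y x = ip d w x / h - ip d w (mean y) / h"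
      unfolding X_def ip_scale by simp
    ultimately show ?thesis unfolding regularized_def K_def by linarith
  qed
  have e: "exp (- U (padd d y w) x) = exp (- K) * (exp (- U y x) * exp (X ?w y x))" for x
    unfolding U by (simp add: exp_add[symmetric])
  have N: "(\<integral>x. exp (X ?w y x) \<partial>mu y) > 0" by (intro integral_mu_exp_pos) simp
  have z: "z (padd d y w) = exp (- K) * (z y * (\<integral>x. exp (X ?w y x) \<partial>mu y))"
    unfolding z_def[of "padd d y w"] e using z_pos[of y] by (subst integral_mu) auto
  have "(\<integral>x. f x \<partial>mu (padd d y w)) = (\<integral>x. exp (- U (padd d y w) x) * f x \<partial>leb d) / z (padd d y w)"
    by (rule integral_mu) simp
  also have "(\<integral>x. exp (- U (padd d y w) x) * f x \<partial>leb d) =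
    exp (- K) * (\<integral>x. exp (- U y x) * (f x * exp (X ?w y x)) \<partial>leb d)"
    unfolding e by (subst integral_mult_right_zero[symmetric]) (simp add: mult_ac)
  also have "(\<integral>x. exp (- U y x) * (f x * exp (X ?w y x)) \<partial>leb d) = z y * (\<integral>x. f x * exp (X ?w y x) \<partial>mu y)"
    using z_pos[of y] by (subst integral_mu) auto
  finally show ?thesis unfolding z using z_pos[of y] N by simp
qed

text \<open>The remainder constant is uniform in \<open>y\<close> and \<open>w\<close>, which is
  what later permits optimizing over arbitrary displacements. The natural unit is
  \<open>\<sigma>\<close>, the squared displacement relative to the sub-Gaussian scale: small
  \<open>\<sigma>\<close> uses the expansion, large \<open>\<sigma>\<close> crude bounds.\<close>

lemma shift_expansion:
  assumes f: "bounded_pos d f"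
  shows "\<exists>L. \<forall>y w. \<bar>(\<integral>x. f x \<partial>mu (padd d y w)) - (\<integral>x. f x \<partial>mu y) - ip d w (grad y f)\<bar> \<le> L * ip d w w"
proof -
  obtain \<delta> D where *: "0 < \<delta>" "\<delta> \<le> D" "\<And>x. x \<in> pts d \<Longrightarrow> \<delta> \<le> f x" "\<And>x. x \<in> pts d \<Longrightarrow> f x \<le> D"
    and fm [measurable]: "f \<in> borel_measurable (leb d)" using bounded_posE[OF f] by metis
  have ab: "\<bar>f x\<bar> \<le> D" if "x \<in> pts d" for x using *(1) *(3,4)[OF that] by linarith
  define E where "E = D * (\<bar>ln \<delta>\<bar> + \<bar>ln D\<bar>)"
  have E: "E \<ge> 0" using *(1,2) by (simp add: E_def)
  define G where "G = 4 * D * E"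
  have G: "G \<ge> 0" using E *(1,2) by (simp add: G_def)
  define L where "L = (2 * D + 1 + G) / (h\<^sup>2 * m)"
  have "\<bar>(\<integral>x. f x \<partial>mu (padd d y w)) - (\<integral>x. f x \<partial>mu y) - ip d w (grad y f)\<bar> \<le> L * ip d w w" for y w
  proof -
    interpret prob_space "mu y" by (rule prob_space_mu)
    define w' where "w' = (\<lambda>i. (1 / h) * w i)"
    have Xw: "X w' y x = X w y x / h" for x unfolding w'_def X_scale by simp
    define \<sigma> where "\<sigma> = ip d w w / (h\<^sup>2 * m)"
    have \<sigma>: "\<sigma> \<ge> 0" using m_pos by (simp add: \<sigma>_def ip_nonneg)
    have ipw: "ip d w' w' / m = \<sigma>" unfolding w'_def ip_scale2 \<sigma>_def by (simp add: power_divide)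
    define N where "N = (\<integral>x. exp (X w' y x) \<partial>mu y)"
    define P where "P = (\<integral>x. f x * exp (X w' y x) \<partial>mu y)"
    define A where "A = (\<integral>x. f x \<partial>mu y)"
    define B where "B = (\<integral>x. f x * X w' y x \<partial>mu y)"
    have A: "integrable (mu y) f" "\<delta> \<le> A" "A \<le> D" using integral_bounds[of f \<delta> D y] * by (auto simp: A_def)
    have N1: "1 \<le> N" unfolding N_def by (rule mgf_ge_1)
    have N2: "N \<le> exp (\<sigma> / 2)"
      using mgf_bound[where w="w'" and y=y] ipw
        by (simp add: N_def mult.commute[of 2 m] divide_divide_eq_left[symmetric] del: divide_divide_eq_left)
    have B: "ip d w (grad y f) = B"
      using ip_grad[OF fm ab, of w y] by (simp add: B_def Xw)
    have M': "(\<integral>x. f x \<partial>mu (padd d y w)) = P / N" unfolding P_def N_def w'_def by (rule integral_mu_shift) simp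
    have iP: "integrable (mu y) (\<lambda>x. f x * exp (X w' y x))" by (rule integrable_bounded_times[OF _ ab]) auto
    have iB: "integrable (mu y) (\<lambda>x. f x * X w' y x)" by (rule integrable_bounded_times[OF _ ab]) auto
    have PAB: "P - A - B = (\<integral>x. f x * (exp (X w' y x) - 1 - X w' y x) \<partial>mu y)"
      unfolding P_def A_def B_def using iP iB A(1) by (simp add: right_diff_distrib)
    have N': "N - 1 = (\<integral>x. exp (X w' y x) - 1 - X w' y x \<partial>mu y)"
      unfolding N_def by (simp add: integral_X)
    have iR: "integrable (mu y) (\<lambda>x. exp (X w' y x) - 1 - X w' y x)" by simp
    have r0: "0 \<le> exp (X w' y x) - 1 - X w' y x" for x using exp_ge_add_one_self[of "X w' y x"] by linarith
    have "0 \<le> P - A - B" unfolding PAB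
    proof (intro integral_nonneg_AE AE_I2)
      fix x assume "x \<in> space (mu y)"
      then have "0 \<le> f x" using *(1) *(3)[of x] by simp
      then show "0 \<le> f x * (exp (X w' y x) - 1 - X w' y x)" using r0 by simp
    qed
    \<comment> \<open>The Taylor remainder of exp is nonnegative, so \<open>f\<close> may be
      replaced by its upper bound; since \<open>X\<close> is centred, what remains is
      \<open>N - 1\<close>.\<close>
    moreover have "P - A - B \<le> D * (N - 1)"
      unfolding PAB N' integral_mult_right_zero[symmetric]
    proof (rule integral_mono)
      show "integrable (mu y) (\<lambda>x. f x * (exp (X w' y x) - 1 - X w' y x))"
        by (rule integrable_bounded_times[OF _ ab]) (use iR in auto)
      show "integrable (mu y) (\<lambda>x. D * (exp (X w' y x) - 1 - X w' y x))" using iR by simp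
      show "f x * (exp (X w' y x) - 1 - X w' y x) \<le> D * (exp (X w' y x) - 1 - X w' y x)" if "x \<in> space (mu y)" for x
        using r0 *(4)[of x] that by (intro mult_right_mono) auto
    qed
    ultimately have r: "\<bar>P - A - B\<bar> \<le> D * (N - 1)" by simp
    have "ent y f \<le> 2 * E"
    proof -
      have "(\<integral>x. f x * ln (f x) \<partial>mu y) \<le> E"
      proof (rule integral_bounds(3)[of _ "- E"])
        fix x assume x: "x \<in> pts d"
        show "- E \<le> f x * ln (f x)" "f x * ln (f x) \<le> E"
          using mult_ln_bounds[OF *(1) *(3)[OF x] *(4)[OF x]] unfolding E_def by linarith+
      qed measurable
      moreover have "\<bar>A * ln A\<bar> \<le> E" unfolding E_def by (rule mult_ln_bounds[OF *(1) A(2,3)])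
      ultimately show ?thesis by (simp add: ent_def A_def[symmetric])
    qed
    have B2: "B\<^sup>2 \<le> G * \<sigma>"
    proof -
      have "B\<^sup>2 \<le> 2 * (A * \<sigma>) * ent y f"
        using transport_entropy[OF f, where w="w'" and y=y] unfolding ipw by (simp add: A_def B_def)
      also have "\<dots> \<le> 2 * (D * \<sigma>) * (2 * E)"
        using A \<sigma> *(1,2) ent_nonneg[OF f, of y] \<open>ent y f \<le> 2 * E\<close> by (intro mult_mono) auto
      finally show ?thesis by (simp add: G_def mult_ac)
    qed
    have abB: "\<bar>B\<bar> \<le> 1 + B\<^sup>2"
      using zero_le_power2[of "\<bar>B\<bar> - 1"] abs_ge_zero[of B] by (simp add: power2_diff)
    have "\<bar>P / N - A - B\<bar> \<le> (2 * D + 1 + G) * \<sigma>"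
    proof (cases "\<sigma> \<le> 1")
      case True
      have N3: "N - 1 \<le> \<sigma>" using N2 exp_minus_one_le(1)[OF \<sigma> True] by linarith
      have "G * \<sigma> \<le> G" using True G by (simp add: mult_left_le)
      then have "\<bar>B\<bar> \<le> 1 + G" using abB B2 by linarith
      then have AB: "\<bar>A + B\<bar> \<le> D + 1 + G" using A *(1) by linarith
      \<comment> \<open>The normalization is separated from the numerator: both error terms are now
        multiples of \<open>N - 1\<close>, which is at most \<open>\<sigma>\<close> here.\<close>
      have "P / N - A - B = ((P - A - B) - (A + B) * (N - 1)) / N"
        using N1 by (simp add: field_simps)
      then have "\<bar>P / N - A - B\<bar> = \<bar>(P - A - B) - (A + B) * (N - 1)\<bar> / N" using N1 by simp
      also have "\<dots> \<le> \<bar>(P - A - B) - (A + B) * (N - 1)\<bar>" using N1 by (simp add: divide_le_eq mult_le_cancel_left1)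
      also have "\<dots> \<le> \<bar>P - A - B\<bar> + \<bar>A + B\<bar> * (N - 1)"
        using abs_triangle_ineq4[of "P - A - B" "(A + B) * (N - 1)"] N1 by (simp add: abs_mult)
      also have "\<dots> \<le> D * (N - 1) + (D + 1 + G) * (N - 1)"
        using r AB N1 by (intro add_mono mult_right_mono) auto
      also have "\<dots> = (2 * D + 1 + G) * (N - 1)" by (simp add: algebra_simps)
      also have "\<dots> \<le> (2 * D + 1 + G) * \<sigma>" using N3 G *(1,2) by (intro mult_left_mono) auto
      finally show ?thesis .
    next
      \<comment> \<open>For \<open>\<sigma> > 1\<close> every bounded quantity is dominated by a
        multiple of \<open>\<sigma>\<close>, and \<open>B\<close> grows at most linearly in
        \<open>\<sigma>\<close>.\<close>
      case False
      have "0 \<le> P / N" "P / N \<le> D"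
        using integral_bounds(2,3)[OF fm *(3,4), of "padd d y w"] *(1) unfolding M' by auto
      then have "\<bar>P / N - A\<bar> \<le> D" using A *(1) by linarith
      then have "\<bar>P / N - A - B\<bar> \<le> D + 1 + G * \<sigma>" using abB B2 by linarith
      also have "\<dots> \<le> (2 * D + 1 + G) * \<sigma>"
      proof -
        have "D * 1 \<le> 2 * D * \<sigma>" using False *(1,2) by (intro mult_mono) auto
        then show ?thesis using False by (simp add: distrib_right)
      qed
      finally show ?thesis .
    qed
    moreover have "(2 * D + 1 + G) * \<sigma> = L * ip d w w" by (simp add: L_def \<sigma>_def)
    ultimately show ?thesis by (simp add: M' A_def B)
  qed
  then show ?thesis by blast
qed

lemma measurable_mu_integral [measurable]:
  fixes f :: "point \<Rightarrow> real"
  assumes [measurable]: "f \<in> borel_measurable (leb d)"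
  shows "(\<lambda>y. \<integral>x. f x \<partial>mu y) \<in> borel_measurable (leb d)"
proof -
  interpret product_sigma_finite "\<lambda>_::nat. lborel :: real measure" by standard
  interpret L: sigma_finite_measure "leb d" by (rule sigma_finite) auto
  have [measurable]: "(\<lambda>(y, x). exp (- U y x)) \<in> borel_measurable (leb d \<Otimes>\<^sub>M leb d)"
    unfolding regularized_def case_prod_beta by measurable
  have e: "(\<integral>x. f x \<partial>mu y) = (\<integral>x. exp (- U y x) * f x \<partial>leb d) / (\<integral>x. exp (- U y x) \<partial>leb d)" for y
    by (subst integral_mu) (auto simp: z_def)
  show ?thesis unfolding e by measurable
qed

end

lemma young_scaled:
  fixes p q r A :: real
  assumes "p\<^sup>2 \<le> q * r" "0 \<le> q" "0 \<le> r" "0 < A"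
  shows "p \<le> A * r + q / (4 * A)"
proof (rule power2_le_imp_le)
  have "0 \<le> (A * r - q / (4 * A))\<^sup>2" by simp
  moreover have "(A * r + q / (4 * A))\<^sup>2 = (A * r - q / (4 * A))\<^sup>2 + q * r"
    using assms(4) by (simp add: power2_eq_square field_simps)
  ultimately show "p\<^sup>2 \<le> (A * r + q / (4 * A))\<^sup>2" using assms(1) by linarith
  show "0 \<le> A * r + q / (4 * A)" using assms by simp
qed

section \<open>Logarithmic Sobolev inequality and propagation of the gradient bound\<close>

context potential
begin

lemma integrable_exp_ln:
  assumes f: "bounded_pos d f" and s: "0 < s" "s < 1"
  shows "integrable (mu y) (\<lambda>x. exp (ln (f x) / (1 - s)))"
proof -
  obtain \<delta> D where *: "0 < \<delta>" "\<delta> \<le> D" "\<And>x. x \<in> pts d \<Longrightarrow> \<delta> \<le> f x" "\<And>x. x \<in> pts d \<Longrightarrow> f x \<le> D"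
    and fm [measurable]: "f \<in> borel_measurable (leb d)" using bounded_posE[OF f] by metis
  show ?thesis
  proof (rule integrable_mu_bounded)
    fix x assume x: "x \<in> pts d"
    have "0 < f x" "f x \<le> D" using *(1) *(3)[OF x] *(4)[OF x] by auto
    then show "\<bar>exp (ln (f x) / (1 - s))\<bar> \<le> exp (ln D / (1 - s))"
      using s by (auto intro!: divide_right_mono)
  qed measurable
qed

text \<open>The derivative at \<open>s = 0\<close> of the norm with exponent
  \<open>1 / (1 - s)\<close> is the entropy. The linear lower bound holds for every admissible
  \<open>s\<close>, so no differentiation of the norm is needed.\<close>

lemma integral_powr_lower:
  assumes f: "bounded_pos d f" and s: "0 < s" "s < 1"
  shows "(\<integral>x. f x \<partial>mu y) + s * ent y f \<le> (\<integral>x. exp (ln (f x) / (1 - s)) \<partial>mu y) powr (1 - s)"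
proof -
  interpret prob_space "mu y" by (rule prob_space_mu)
  obtain \<delta> D where *: "0 < \<delta>" "\<delta> \<le> D" "\<And>x. x \<in> pts d \<Longrightarrow> \<delta> \<le> f x" "\<And>x. x \<in> pts d \<Longrightarrow> f x \<le> D"
    and fm [measurable]: "f \<in> borel_measurable (leb d)" using bounded_posE[OF f] by metis
  define A where "A = (\<integral>x. f x \<partial>mu y)"
  have A: "integrable (mu y) f" "\<delta> \<le> A" using integral_bounds[OF fm *(3,4)] by (auto simp: A_def)
  have Ap: "A > 0" using A * by simp
  define e where "e = (\<integral>x. f x * ln (f x) \<partial>mu y) / A"
  \<comment> \<open>Here \<open>c\<close> is the mean of \<open>s / (1 - s) * ln f\<close> under the
    probability with density \<open>f / A\<close>. The tangent of exp at \<open>c\<close> therefore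
    has a vanishing linear term after integration, which is Jensen's inequality.\<close>
  define c where "c = s / (1 - s) * e"
  define J where "J = (\<integral>x. exp (ln (f x) / (1 - s)) \<partial>mu y)"
  have "(\<integral>x. exp c * (f x + s / (1 - s) * (f x * ln (f x)) - c * f x) \<partial>mu y) \<le> J"
    unfolding J_def
  proof (rule integral_mono)
    show "integrable (mu y) (\<lambda>x. exp c * (f x + s / (1 - s) * (f x * ln (f x)) - c * f x))"
      using A integrable_f_ln[OF f] by simp
    show "integrable (mu y) (\<lambda>x. exp (ln (f x) / (1 - s)))" by (rule integrable_exp_ln[OF f s])
    fix x assume "x \<in> space (mu y)"
    then have fx: "f x > 0" using *(1) *(3)[of x] by auto
    have "1 + (s / (1 - s) * ln (f x) - c) \<le> exp (s / (1 - s) * ln (f x) - c)" by (rule exp_ge_add_one_self)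
    then have "exp c * (f x * (1 + (s / (1 - s) * ln (f x) - c))) \<le> exp c * (f x * exp (s / (1 - s) * ln (f x) - c))"
      using fx by (intro mult_left_mono) auto
    also have "\<dots> = f x * exp (s / (1 - s) * ln (f x))" by (simp add: exp_diff)
    also have "\<dots> = exp (ln (f x) + s / (1 - s) * ln (f x))" using fx by (simp add: exp_add)
    also have "ln (f x) + s / (1 - s) * ln (f x) = ln (f x) / (1 - s)" using s by (simp add: field_simps)
    finally show "exp c * (f x + s / (1 - s) * (f x * ln (f x)) - c * f x) \<le> exp (ln (f x) / (1 - s))"
      by (simp add: algebra_simps)
  qed
  also have "(\<integral>x. exp c * (f x + s / (1 - s) * (f x * ln (f x)) - c * f x) \<partial>mu y) =
    exp c * (A + s / (1 - s) * (e * A) - c * A)"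
    using A integrable_f_ln[OF f] Ap by (simp add: A_def[symmetric] e_def)
  also have "\<dots> = exp c * A" by (simp add: c_def)
  finally have J: "exp c * A \<le> J" .
  have "A + s * ent y f = A * (1 + s * (e - ln A))"
    using Ap by (simp add: ent_def A_def[symmetric] e_def algebra_simps)
  also have "\<dots> \<le> A * exp (s * (e - ln A))"
    using Ap by (intro mult_left_mono exp_ge_add_one_self) auto
  also have "\<dots> = exp (ln A + s * (e - ln A))" using Ap by (simp add: exp_add)
  also have "ln A + s * (e - ln A) = (1 - s) * (c + ln A)"
    using s by (simp add: c_def field_simps)
  also have "exp ((1 - s) * (c + ln A)) = (exp c * A) powr (1 - s)"
    using Ap by (simp add: powr_def ln_mult)
  also have "\<dots> \<le> J powr (1 - s)" using J s Ap by (intro powr_mono2) auto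
  finally show ?thesis by (simp add: A_def J_def)
qed

text \<open>Bobkov-Ledoux: the logarithmic Sobolev inequality is the limit \<open>s \<rightarrow> 0\<close> of the Prekopa-Leindler
  inequality with weights \<open>1 - s\<close> and \<open>s\<close> applied to \<open>f powr (1 / (1 - s))\<close> and \<open>1\<close>.\<close>

lemma log_sobolev:
  assumes good: "gradient_entropy_bound d c f F"
  shows "ent y f \<le> c / (2 * m) * (\<integral>x. F x - f x * ln (f x) \<partial>mu y)"
proof -
  interpret prob_space "mu y" by (rule prob_space_mu)
  have f: "bounded_pos d f" and Fm [measurable]: "F \<in> borel_measurable (leb d)" and c: "0 \<le> c"
    using good by (auto simp: gradient_entropy_bound_def)
  obtain K where K: "\<And>x. x \<in> pts d \<Longrightarrow> \<bar>F x\<bar> \<le> K" using good by (auto simp: gradient_entropy_bound_def)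
  obtain L g where g: "\<And>x w. x \<in> pts d \<Longrightarrow> w \<in> pts d \<Longrightarrow> \<bar>f (padd d x w) - f x - ip d w (g x)\<bar> \<le> L * ip d w w"
    "\<And>x. x \<in> pts d \<Longrightarrow> ip d (g x) (g x) \<le> c * f x * (F x - f x * ln (f x))"
    using good unfolding gradient_entropy_bound_def by metis
  obtain \<delta> D where *: "0 < \<delta>" "\<delta> \<le> D" "\<And>x. x \<in> pts d \<Longrightarrow> \<delta> \<le> f x" "\<And>x. x \<in> pts d \<Longrightarrow> f x \<le> D"
    and fm [measurable]: "f \<in> borel_measurable (leb d)" using bounded_posE[OF f] by metis
  have fpos: "0 < f x" if "x \<in> pts d" for x using *(1) *(3)[OF that] by simp
  \<comment> \<open>\<open>W\<close> stands in for \<open>|g|^2 / f\<close>, the integrand of the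
    Fisher information; it is bounded and measurable although \<open>g\<close> itself carries no
    measurability.\<close>
  define W where "W x = c * (F x - f x * ln (f x))" for x
  have [measurable]: "W \<in> borel_measurable (leb d)" unfolding W_def by measurable
  define K2 where "K2 = c * (K + D * (\<bar>ln \<delta>\<bar> + \<bar>ln D\<bar>))"
  have gW: "ip d (g x) (g x) \<le> f x * W x" if "x \<in> pts d" for x
    using g(2)[OF that] by (simp add: W_def mult_ac)
  have W0: "0 \<le> W x" if "x \<in> pts d" for x
    using order_trans[OF ip_nonneg gW[OF that]] fpos[OF that] by (simp add: zero_le_mult_iff)
  have W2: "W x \<le> K2" if "x \<in> pts d" for x
    unfolding W_def K2_def using K[OF that] mult_ln_bounds[OF *(1) *(3)[OF that] *(4)[OF that]] c
    by (intro mult_left_mono) linarith+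
  have K2: "0 \<le> K2" using W0[of "\<lambda>i\<in>{..<d}. 0"] W2[of "\<lambda>i\<in>{..<d}. 0"] by simp
  have iW: "integrable (mu y) W" using W0 W2 by (intro integrable_mu_bounded[where B=K2]) auto
  define L' where "L' = max L 0 / \<delta>"
  \<comment> \<open>The transport budget is \<open>m / 2 * s * (1 - s) * |u - v|^2\<close>. Paying
    the Taylor remainder \<open>L' * s^2 * |u - v|^2\<close> from it leaves a multiple for Young's
    inequality whose dual coefficient is \<open>a s\<close>; it tends to
    \<open>1 / (2 * m)\<close>.\<close>
  define a where "a s = 1 / (2 * (m * (1 - s) - 2 * L' * s))" for s
  \<comment> \<open>The expansion is taken at the intermediate point \<open>x\<close>, where
    \<open>\<eta>\<close> is evaluated, and \<open>u - x\<close> is \<open>s\<close> times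
    \<open>u - v\<close>. Concavity of ln then turns the relative increment of \<open>f\<close> into
    an increment of \<open>ln f\<close>.\<close>
  have key: "ln (f u) \<le> ln (f x) + s * a s * W x / f x + m / 2 * s * (1 - s) * (edist d u v)\<^sup>2"
    if u: "u \<in> pts d" and v: "v \<in> pts d" and s: "0 < s" "s < 1" "0 < m * (1 - s) - 2 * L' * s"
      and x: "x = (\<lambda>i\<in>{..<d}. (1 - s) * u i + s * v i)" for u v x s
  proof -
    have xp: "x \<in> pts d" by (simp add: x)
    have "0 < 2 * (m * (1 - s) - 2 * L' * s)" by (rule mult_pos_pos[OF zero_less_numeral s(3)])
    then have as: "a s > 0" unfolding a_def by (rule divide_pos_pos[OF zero_less_one])
    define w where "w = (\<lambda>i\<in>{..<d}. s * (u i - v i))"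
    define p where "p = (\<Sum>i<d. (u i - v i) * g x i)"
    define q where "q = (edist d u v)\<^sup>2"
    have pw: "padd d x w = u"
      using u by (auto simp: padd_def x w_def fun_eq_iff PiE_def extensional_def algebra_simps)
    have ipw: "ip d w (g x) = s * p" by (simp add: ip_def w_def p_def sum_distrib_left mult.assoc)
    have ww: "ip d w w = s\<^sup>2 * q"
      unfolding q_def edist_sq by (simp add: ip_def w_def sum_distrib_left power2_eq_square mult_ac)
    have q: "0 \<le> q" by (simp add: q_def)
    have "f u - f x \<le> s * p + L * (s\<^sup>2 * q)"
      using g(1)[OF xp, of w] unfolding pw ipw ww by (simp add: w_def)
    also have "\<dots> \<le> s * p + max L 0 * (s\<^sup>2 * q)" using q by (intro add_left_mono mult_right_mono) auto
    finally have "(f u - f x) / f x \<le> (s * p + max L 0 * (s\<^sup>2 * q)) / f x"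
      using fpos[OF xp] by (intro divide_right_mono) auto
    also have "\<dots> = s * (p / f x) + max L 0 * (s\<^sup>2 * q) / f x" by (simp add: add_divide_distrib)
    also have "max L 0 * (s\<^sup>2 * q) / f x \<le> max L 0 * (s\<^sup>2 * q) / \<delta>"
      using *(1) *(3)[OF xp] q by (intro divide_left_mono) auto
    also have "\<dots> = L' * s * s * q" by (simp add: L'_def power2_eq_square)
    also have "p / f x \<le> a s * (W x / f x) + q / (4 * a s)"
    proof (rule young_scaled)
      have "p\<^sup>2 \<le> q * ip d (g x) (g x)"
        using Cauchy_Schwarz_ineq_sum[of "\<lambda>i. u i - v i" "g x" "{..<d}"]
        unfolding p_def q_def edist_sq by (simp add: ip_def power2_eq_square)
      also have "\<dots> \<le> q * (f x * W x)" using q gW[OF xp] by (rule mult_left_mono[rotated])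
      finally have "p\<^sup>2 / (f x)\<^sup>2 \<le> q * (f x * W x) / (f x)\<^sup>2" by (rule divide_right_mono) simp
      then show "(p / f x)\<^sup>2 \<le> q * (W x / f x)" using fpos[OF xp] by (simp add: power_divide power2_eq_square)
    qed (use q W0[OF xp] fpos[OF xp] as in auto)
    finally have "(f u - f x) / f x \<le> s * (a s * (W x / f x) + q / (4 * a s)) + L' * s * s * q"
      using s by simp
    also have "q / (4 * a s) = q * (m * (1 - s) - 2 * L' * s) / 2" by (simp add: a_def)
    also have "s * (a s * (W x / f x) + q * (m * (1 - s) - 2 * L' * s) / 2) + L' * s * s * q =
      s * a s * W x / f x + m / 2 * s * (1 - s) * q"
      by (simp add: algebra_simps add_divide_distrib diff_divide_distrib)
    finally have "(f u - f x) / f x \<le> s * a s * W x / f x + m / 2 * s * (1 - s) * q" .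
    moreover have "ln (f u / f x) \<le> f u / f x - 1" using fpos[OF xp] fpos[OF u] by (intro ln_le_minus_one) simp
    ultimately show ?thesis using fpos[OF xp] fpos[OF u] by (simp add: ln_div diff_divide_distrib q_def)
  qed
  \<comment> \<open>Smallness of \<open>s\<close> makes the exponent at most 1, so that
    \<open>exp v \<le> 1 + v + v^2\<close> applies. The mean of \<open>f\<close> then cancels
    against the lower bound, and division by \<open>s\<close> leaves an error of order
    \<open>s\<close>.\<close>
  have main: "ent y f \<le> a s * (\<integral>x. W x \<partial>mu y) + s * (a s)\<^sup>2 * (K2\<^sup>2 / \<delta>)"
    if s: "0 < s" "s < 1" "0 < m * (1 - s) - 2 * L' * s" and small: "s * a s * K2 / \<delta> \<le> 1" for s
  proof -
    have "0 < 2 * (m * (1 - s) - 2 * L' * s)" by (rule mult_pos_pos[OF zero_less_numeral s(3)])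
    then have as: "a s > 0" unfolding a_def by (rule divide_pos_pos[OF zero_less_one])
    let ?\<eta> = "\<lambda>x. ln (f x) + s * a s * W x / f x"
    have v: "0 \<le> s * a s * W x / f x" "s * a s * W x / f x \<le> s * a s * K2 / \<delta>" if x: "x \<in> pts d" for x
    proof -
      show "0 \<le> s * a s * W x / f x" using s(1,2) as W0[OF x] fpos[OF x] by simp
      show "s * a s * W x / f x \<le> s * a s * K2 / \<delta>"
        using s(1,2) as W0[OF x] W2[OF x] *(1) *(3)[OF x] by (intro frac_le mult_left_mono) auto
    qed
    have expeta: "exp (?\<eta> x) \<le> f x + s * a s * W x + s\<^sup>2 * (a s)\<^sup>2 * (K2\<^sup>2 / \<delta>)" if x: "x \<in> pts d" for x
    proof -
      let ?v = "s * a s * W x / f x"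
      have "exp (?\<eta> x) = f x * exp ?v" using fpos[OF x] by (simp add: exp_add)
      also have "\<dots> \<le> f x * (1 + ?v + ?v\<^sup>2)"
        by (rule mult_left_mono[OF exp_minus_one_le(2)[OF v(1)[OF x] order_trans[OF v(2)[OF x] small]]
          less_imp_le[OF fpos[OF x]]])
      also have "\<dots> = f x + s * a s * W x + s\<^sup>2 * (a s)\<^sup>2 * ((W x)\<^sup>2 / f x)"
        using fpos[OF x] by (simp add: field_simps power2_eq_square)
      also have "\<dots> \<le> f x + s * a s * W x + s\<^sup>2 * (a s)\<^sup>2 * (K2\<^sup>2 / \<delta>)"
        using fpos[OF x] W0[OF x] W2[OF x] *(1) *(3)[OF x]
        by (intro add_left_mono mult_left_mono frac_le power_mono) auto
      finally show ?thesis .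
    qed
    note i1 = integrable_exp_ln[OF f s(1,2), of y]
    have i2: "integrable (mu y) (\<lambda>x. exp (?\<eta> x))"
    proof (rule integrable_mu_bounded)
      fix x assume x: "x \<in> pts d"
      have "exp (?\<eta> x) \<le> f x + s * a s * W x + s\<^sup>2 * (a s)\<^sup>2 * (K2\<^sup>2 / \<delta>)" by (rule expeta[OF x])
      also have "\<dots> \<le> D + s * a s * K2 + s\<^sup>2 * (a s)\<^sup>2 * (K2\<^sup>2 / \<delta>)"
        using s(1,2) as *(4)[OF x] W2[OF x] by (intro add_mono mult_left_mono) auto
      finally show "\<bar>exp (?\<eta> x)\<bar> \<le> D + s * a s * K2 + s\<^sup>2 * (a s)\<^sup>2 * (K2\<^sup>2 / \<delta>)" by simp
    qed measurable
    have "(\<integral>x. f x \<partial>mu y) + s * ent y f \<le> (\<integral>x. exp (ln (f x) / (1 - s)) \<partial>mu y) powr (1 - s)"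
      using s(1,2) by (intro integral_powr_lower[OF f]) auto
    also have "\<dots> = (\<integral>x. exp (ln (f x) / (1 - s)) \<partial>mu y) powr (1 - s) * (\<integral>x. exp (0::real) \<partial>mu y) powr s" by simp
    also have "\<dots> \<le> (\<integral>x. exp (?\<eta> x) \<partial>mu y)"
    proof (rule mu_prekopa_leindler[OF _ _ _ i1 _ i2])
      fix u v :: point assume uv: "u \<in> pts d" "v \<in> pts d"
      show "(1 - s) * (ln (f u) / (1 - s)) + s * 0 \<le>
        ?\<eta> (\<lambda>i\<in>{..<d}. (1 - s) * u i + s * v i) + m / 2 * s * (1 - s) * (edist d u v)\<^sup>2"
        using key[OF uv s refl] s(1,2) by simp
    qed (use s(1,2) in auto)
    also have "\<dots> \<le> (\<integral>x. f x + s * a s * W x + s\<^sup>2 * (a s)\<^sup>2 * (K2\<^sup>2 / \<delta>) \<partial>mu y)"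
      using i2 iW integral_bounds(1)[OF fm *(3,4)] expeta by (intro integral_mono) auto
    also have "\<dots> = (\<integral>x. f x \<partial>mu y) + s * a s * (\<integral>x. W x \<partial>mu y) + s\<^sup>2 * (a s)\<^sup>2 * (K2\<^sup>2 / \<delta>)"
      using iW integral_bounds(1)[OF fm *(3,4)] by simp
    finally have "s * ent y f \<le> s * (a s * (\<integral>x. W x \<partial>mu y) + s * (a s)\<^sup>2 * (K2\<^sup>2 / \<delta>))"
      by (simp add: power2_eq_square algebra_simps)
    then show ?thesis using s(1,2) by simp
  qed
  have den: "((\<lambda>s. m * (1 - s) - 2 * L' * s) \<longlongrightarrow> m * (1 - 0) - 2 * L' * 0) (at_right 0)"
    by (intro tendsto_intros)
  have a_lim: "(a \<longlongrightarrow> 1 / (2 * m)) (at_right 0)"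
    unfolding a_def[abs_def] using den m_pos by (intro tendsto_divide tendsto_mult tendsto_const) auto
  have "((\<lambda>s. s * a s * K2 / \<delta>) \<longlongrightarrow> 0 * (1 / (2 * m)) * K2 / \<delta>) (at_right 0)"
    using *(1) by (intro tendsto_intros a_lim) auto
  then have small: "\<forall>\<^sub>F s in at_right 0. s * a s * K2 / \<delta> < 1" by (rule order_tendstoD) simp
  have pos: "\<forall>\<^sub>F s in at_right 0. 0 < m * (1 - s) - 2 * L' * s" by (rule order_tendstoD[OF den]) (use m_pos in simp)
  have s1: "\<forall>\<^sub>F s in at_right (0::real). s < 1" by (rule order_tendstoD(2)[OF tendsto_ident_at]) simp
  have s0: "\<forall>\<^sub>F s in at_right (0::real). 0 < s" by (simp add: eventually_at_right_less)
  have "((\<lambda>s. a s * (\<integral>x. W x \<partial>mu y) + s * (a s)\<^sup>2 * (K2\<^sup>2 / \<delta>)) \<longlongrightarrow>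
    1 / (2 * m) * (\<integral>x. W x \<partial>mu y) + 0 * (1 / (2 * m))\<^sup>2 * (K2\<^sup>2 / \<delta>)) (at_right 0)"
    by (intro tendsto_intros a_lim)
  then have "ent y f \<le> 1 / (2 * m) * (\<integral>x. W x \<partial>mu y) + 0 * (1 / (2 * m))\<^sup>2 * (K2\<^sup>2 / \<delta>)"
  proof (rule tendsto_lowerbound)
    show "\<forall>\<^sub>F s in at_right 0. ent y f \<le> a s * (\<integral>x. W x \<partial>mu y) + s * (a s)\<^sup>2 * (K2\<^sup>2 / \<delta>)"
      using small pos s1 s0 by eventually_elim (rule main, auto)
  qed simp
  also have "(\<integral>x. W x \<partial>mu y) = c * (\<integral>x. F x - f x * ln (f x) \<partial>mu y)"
    unfolding W_def by simp
  finally show ?thesis by simp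
qed

lemma bounded_pos_mu:
  assumes "bounded_pos d f"
  shows "bounded_pos d (\<lambda>y. \<integral>x. f x \<partial>mu y)"
proof -
  obtain \<delta> D where *: "0 < \<delta>" "\<delta> \<le> D" "\<And>x. x \<in> pts d \<Longrightarrow> \<delta> \<le> f x" "\<And>x. x \<in> pts d \<Longrightarrow> f x \<le> D"
    and fm [measurable]: "f \<in> borel_measurable (leb d)" using bounded_posE[OF assms] by metis
  show ?thesis unfolding bounded_pos_def
    using integral_bounds(2,3)[OF fm *(3,4)] *(1)
      by (intro conjI measurable_mu_integral fm exI[of _ \<delta>] exI[of _ D] ballI) auto
qed

text \<open>By \<open>grad_bound\<close> and \<open>shift_expansion\<close>, all that remains to
  check for the averaged pair is that the entropy of \<open>f\<close> is controlled by the deficit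
  of \<open>F\<close>.\<close>

lemma gradient_entropy_boundI:
  assumes f: "bounded_pos d f" and Fm [measurable]: "F \<in> borel_measurable (leb d)" and K: "\<And>x. x \<in> pts d \<Longrightarrow> \<bar>F x\<bar> \<le> K"
    and c: "0 \<le> c"
    and le: "\<And>y. 2 / (h\<^sup>2 * m) * ent y f \<le> c * ((\<integral>x. F x \<partial>mu y) - (\<integral>x. f x \<partial>mu y) * ln (\<integral>x. f x \<partial>mu y))"
  shows "gradient_entropy_bound d c (\<lambda>y. \<integral>x. f x \<partial>mu y) (\<lambda>y. \<integral>x. F x \<partial>mu y)"
proof -
  obtain L where L: "\<And>y w. \<bar>(\<integral>x. f x \<partial>mu (padd d y w)) - (\<integral>x. f x \<partial>mu y) - ip d w (grad y f)\<bar> \<le> L * ip d w w"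
    using shift_expansion[OF f] by blast
  have "ip d (grad y f) (grad y f) \<le> c * (\<integral>x. f x \<partial>mu y) * ((\<integral>x. F x \<partial>mu y)
    - (\<integral>x. f x \<partial>mu y) * ln (\<integral>x. f x \<partial>mu y))" for y
  proof -
    obtain \<delta> D where *: "0 < \<delta>" "\<delta> \<le> D" "\<And>x. x \<in> pts d \<Longrightarrow> \<delta> \<le> f x" "\<And>x. x \<in> pts d \<Longrightarrow> f x \<le> D"
      and fm [measurable]: "f \<in> borel_measurable (leb d)" using bounded_posE[OF f] by metis
    have "0 \<le> (\<integral>x. f x \<partial>mu y)" using integral_bounds(2)[OF fm *(3,4), of y] *(1) by linarith
    then have "(\<integral>x. f x \<partial>mu y) * (2 / (h\<^sup>2 * m) * ent y f) \<le>
      (\<integral>x. f x \<partial>mu y) * (c * ((\<integral>x. F x \<partial>mu y) - (\<integral>x. f x \<partial>mu y) * ln (\<integral>x. f x \<partial>mu y)))"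
      by (intro mult_left_mono le)
    with grad_bound[OF f, of y] show ?thesis by (simp add: mult_ac)
  qed
  moreover have "\<bar>\<integral>x. F x \<partial>mu y\<bar> \<le> K" for y
  proof -
    have "- K \<le> F x" "F x \<le> K" if "x \<in> pts d" for x using K[OF that] by auto
    then show ?thesis using integral_bounds(2,3)[of F "-K" K y] by auto
  qed
  ultimately show ?thesis
    unfolding gradient_entropy_bound_def using bounded_pos_mu[OF f] c L
    by (intro conjI exI[of _ K] exI[of _ L] exI[of _ "\<lambda>y. grad y f"]) auto
qed

text \<open>With \<open>F = f ln f\<close> the deficit after averaging is the entropy itself, so the
  required comparison is an equality.\<close>

lemma gradient_entropy_bound_base:
  assumes f: "bounded_pos d f"
  shows "gradient_entropy_bound d (2 / (h\<^sup>2 * m)) (\<lambda>y. \<integral>x. f x \<partial>mu y) (\<lambda>y. \<integral>x. f x * ln (f x) \<partial>mu y)"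
proof -
  obtain \<delta> D where *: "0 < \<delta>" "\<delta> \<le> D" "\<And>x. x \<in> pts d \<Longrightarrow> \<delta> \<le> f x" "\<And>x. x \<in> pts d \<Longrightarrow> f x \<le> D"
    and fm [measurable]: "f \<in> borel_measurable (leb d)" using bounded_posE[OF f] by metis
  show ?thesis
    by (rule gradient_entropy_boundI[OF f, where K="D * (\<bar>ln \<delta>\<bar> + \<bar>ln D\<bar>)"])
      (use * m_pos mult_ln_bounds[OF *(1)] in \<open>auto simp: ent_def\<close>)
qed

text \<open>The Sobolev inequality trades the entropy for the drop from \<open>F\<close> to
  \<open>f ln f\<close>; since the entropy is nonnegative, the averaged drop is at most the deficit
  of the averaged pair. The constants multiply to \<open>1 / (h * m)^2\<close>.\<close>

lemma gradient_entropy_bound_step: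
  assumes g: "gradient_entropy_bound d c f F"
  shows "gradient_entropy_bound d (c / (h * m)\<^sup>2) (\<lambda>y. \<integral>x. f x \<partial>mu y) (\<lambda>y. \<integral>x. F x \<partial>mu y)"
proof -
  have f: "bounded_pos d f" and Fm [measurable]: "F \<in> borel_measurable (leb d)" and c: "0 \<le> c"
    using g by (auto simp: gradient_entropy_bound_def)
  obtain K where K: "\<And>x. x \<in> pts d \<Longrightarrow> \<bar>F x\<bar> \<le> K" using g by (auto simp: gradient_entropy_bound_def)
  have iF: "integrable (mu y) F" for y using K by (intro integrable_mu_bounded) auto
  show ?thesis
  proof (rule gradient_entropy_boundI[OF f Fm K])
    show "0 \<le> c / (h * m)\<^sup>2" using c by simp
    fix y
    have e: "(\<integral>x. F x - f x * ln (f x) \<partial>mu y) = (\<integral>x. F x \<partial>mu y) - (\<integral>x. f x \<partial>mu y) * ln (\<integral>x. f x \<partial>mu y) - ent y f"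
      using iF integrable_f_ln[OF f] by (simp add: ent_def)
    have "2 / (h\<^sup>2 * m) * ent y f \<le> 2 / (h\<^sup>2 * m) * (c / (2 * m) * (\<integral>x. F x - f x * ln (f x) \<partial>mu y))"
      using m_pos by (intro mult_left_mono log_sobolev[OF g]) auto
    also have "\<dots> = c / (h * m)\<^sup>2 * (\<integral>x. F x - f x * ln (f x) \<partial>mu y)"
      using m_pos h_pos by (simp add: power2_eq_square)
    also have "\<dots> \<le> c / (h * m)\<^sup>2 * ((\<integral>x. F x \<partial>mu y) - (\<integral>x. f x \<partial>mu y) * ln (\<integral>x. f x \<partial>mu y))"
      unfolding e using c ent_nonneg[OF f, of y] by (intro mult_left_mono) auto
    finally show "2 / (h\<^sup>2 * m) * ent y f \<le> c / (h * m)\<^sup>2 * ((\<integral>x. F x \<partial>mu y) - (\<integral>x. f x \<partial>mu y) * ln (\<integral>x. f x \<partial>mu y))" .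
  qed
qed

end

section \<open>The Harnack inequality\<close>

lemma exp_taylor_bound:
  fixes u :: real
  shows "\<bar>exp u - 1 - u\<bar> \<le> u\<^sup>2 * exp \<bar>u\<bar>"
proof -
  have le: "exp u - 1 \<le> u * exp u" for u :: real
  proof -
    have "exp u * (1 + - u) \<le> exp u * exp (- u)" by (intro mult_left_mono exp_ge_add_one_self) auto
    then show ?thesis by (simp add: exp_minus algebra_simps)
  qed
  have ge: "0 \<le> exp u - 1 - u" using exp_ge_add_one_self[of u] by linarith
  have "exp u - 1 - u \<le> u * (exp u - 1)" using le[of u] by (simp add: algebra_simps)
  also have "\<dots> \<le> u\<^sup>2 * exp \<bar>u\<bar>"
  proof (cases "u \<ge> 0")
    case True
    then have "u * (exp u - 1) \<le> u * (u * exp u)" by (intro mult_left_mono le)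
    then show ?thesis using True by (simp add: power2_eq_square)
  next
    case False
    have "- u * (1 - exp u) \<le> - u * (- u)" using False exp_ge_add_one_self[of u] by (intro mult_left_mono) linarith+
    also have "\<dots> \<le> u\<^sup>2 * exp \<bar>u\<bar>" by (simp add: power2_eq_square mult_le_cancel_left1)
    finally show ?thesis by (simp add: algebra_simps)
  qed
  finally show ?thesis using ge by simp
qed

lemma bounded_posI:
  assumes "f \<in> borel_measurable (leb d)" "0 < \<delta>" "\<And>x. x \<in> pts d \<Longrightarrow> \<delta> \<le> f x" "\<And>x. x \<in> pts d \<Longrightarrow> f x \<le> D"
  shows "bounded_pos d f"
  unfolding bounded_pos_def using assms by blast

lemma bounded_pos_powr:
  assumes f: "bounded_pos d f" and a: "0 < a"
  shows "bounded_pos d (\<lambda>x. f x powr a)"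
proof -
  obtain \<delta> D where *: "0 < \<delta>" "\<delta> \<le> D" "\<And>x. x \<in> pts d \<Longrightarrow> \<delta> \<le> f x" "\<And>x. x \<in> pts d \<Longrightarrow> f x \<le> D"
    and fm [measurable]: "f \<in> borel_measurable (leb d)" using bounded_posE[OF f] by metis
  show ?thesis
  proof (rule bounded_posI)
    fix x assume x: "x \<in> pts d"
    show "\<delta> powr a \<le> f x powr a" "f x powr a \<le> D powr a"
      using *(1) *(3)[OF x] *(4)[OF x] a by (auto intro!: powr_mono2)
  qed (use *(1) in auto)
qed

text \<open>Isolates what the Harnack inequality uses of a kernel: probability measures with a
  gradient bound for their averages, and no density.\<close>

locale reverse_log_sobolev =
  fixes d :: nat and c :: real and k :: "point \<Rightarrow> point measure"
  assumes k_prob: "\<And>x. x \<in> pts d \<Longrightarrow> prob_space (k x)"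
    and k_sets: "\<And>x. x \<in> pts d \<Longrightarrow> sets (k x) = sets (leb d)"
    and c_pos: "0 < c"
    and k_gradient_entropy_bound: "\<And>g. bounded_pos d g \<Longrightarrow>
      gradient_entropy_bound d c (\<lambda>x. \<integral>z. g z \<partial>k x) (\<lambda>x. \<integral>z. g z * ln (g z) \<partial>k x)"
begin

lemma k_space: "x \<in> pts d \<Longrightarrow> space (k x) = pts d"
  using sets_eq_imp_space_eq[OF k_sets] by (simp add: space_leb)

lemma k_integrable:
  fixes f :: "point \<Rightarrow> real"
  assumes x: "x \<in> pts d" and f: "f \<in> borel_measurable (leb d)" and b: "\<And>z. z \<in> pts d \<Longrightarrow> \<bar>f z\<bar> \<le> B"
  shows "integrable (k x) f"
proof -
  interpret prob_space "k x" by (rule k_prob[OF x])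
  have "f \<in> borel_measurable (k x)" using f by (simp add: measurable_cong_sets[OF k_sets[OF x] refl])
  then show ?thesis by (intro integrable_const_bound[of _ B] AE_I2) (use b k_space[OF x] in auto)
qed

lemma k_integral_le:
  fixes f :: "point \<Rightarrow> real"
  assumes x: "x \<in> pts d" and f: "f \<in> borel_measurable (leb d)" and b: "\<And>z. z \<in> pts d \<Longrightarrow> \<bar>f z\<bar> \<le> B"
  shows "\<bar>\<integral>z. f z \<partial>k x\<bar> \<le> B"
proof -
  interpret prob_space "k x" by (rule k_prob[OF x])
  have i: "integrable (k x) f" by (rule k_integrable[OF x f b])
  have "(\<integral>z. f z \<partial>k x) \<le> B" "- B \<le> (\<integral>z. f z \<partial>k x)"
    using b k_space[OF x] i by (auto intro!: integral_le_const integral_ge_const AE_I2 simp: abs_le_iff minus_le_iff)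
  then show ?thesis by simp
qed

lemma k_quadraticE:
  assumes "bounded_pos d u"
  obtains L g where "\<forall>x\<in>pts d. \<forall>w\<in>pts d.
      \<bar>(\<integral>z. u z \<partial>k (padd d x w)) - (\<integral>z. u z \<partial>k x) - ip d w (g x)\<bar> \<le> L * ip d w w"
    "\<forall>x\<in>pts d. ip d (g x) (g x) \<le>
      c * (\<integral>z. u z \<partial>k x) * ((\<integral>z. u z * ln (u z) \<partial>k x) - (\<integral>z. u z \<partial>k x) * ln (\<integral>z. u z \<partial>k x))"
proof -
  from k_gradient_entropy_bound[OF assms] have "\<exists>L g. \<forall>x\<in>pts d. (\<forall>w\<in>pts d. \<bar>(\<integral>z. u z \<partial>k (padd d x w))
    - (\<integral>z. u z \<partial>k x) - ip d w (g x)\<bar> \<le> L * ip d w w) \<and>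
    ip d (g x) (g x) \<le> c * (\<integral>z. u z \<partial>k x) * ((\<integral>z. u z * ln (u z) \<partial>k x) - (\<integral>z. u z \<partial>k x) * ln (\<integral>z. u z \<partial>k x))"
    unfolding gradient_entropy_bound_def by (elim conjE)
  then obtain L g where *: "\<forall>x\<in>pts d. (\<forall>w\<in>pts d. \<bar>(\<integral>z. u z \<partial>k (padd d x w)) - (\<integral>z. u z \<partial>k x) - ip d w (g x)\<bar> \<le>
    L * ip d w w) \<and>
    ip d (g x) (g x) \<le> c * (\<integral>z. u z \<partial>k x) * ((\<integral>z. u z * ln (u z) \<partial>k x) - (\<integral>z. u z \<partial>k x) * ln (\<integral>z. u z \<partial>k x))"
    by (elim exE)
  show thesis
    by (rule that[of g L]) (use * in simp_all)
qed

text \<open>The expansion is available only for positive functions, so a bounded \<open>f\<close> of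
  arbitrary sign is shifted above 1 first. It is applied to \<open>f powr a * ln f\<close>, which
  may change sign.\<close>

lemma k_line_continuous:
  fixes f :: "point \<Rightarrow> real"
  assumes x: "x \<in> pts d" and f [measurable]: "f \<in> borel_measurable (leb d)" and b: "\<And>z. z \<in> pts d \<Longrightarrow> \<bar>f z\<bar> \<le> B"
  shows "((\<lambda>t. \<integral>z. f z \<partial>k (padd d x (\<lambda>i\<in>{..<d}. t * e i))) \<longlongrightarrow> (\<integral>z. f z \<partial>k x)) (at 0)"
proof -
  have "0 < B + 1" using b[of "\<lambda>i\<in>{..<d}. 0"] by simp
  have bp: "bounded_pos d (\<lambda>z. f z + (B + 1))"
  proof (rule bounded_posI)
    fix z assume "z \<in> pts d"
    then show "1 \<le> f z + (B + 1)" "f z + (B + 1) \<le> 2 * B + 1" using b[of z] by linarith+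
  qed auto
  define u where "u z = f z + (B + 1)" for z
  obtain L g where "\<forall>x\<in>pts d. \<forall>w\<in>pts d.
      \<bar>(\<integral>z. u z \<partial>k (padd d x w)) - (\<integral>z. u z \<partial>k x) - ip d w (g x)\<bar> \<le> L * ip d w w"
    "\<forall>x\<in>pts d. ip d (g x) (g x) \<le>
      c * (\<integral>z. u z \<partial>k x) * ((\<integral>z. u z * ln (u z) \<partial>k x) - (\<integral>z. u z \<partial>k x) * ln (\<integral>z. u z \<partial>k x))"
    by (rule k_quadraticE[OF bp[folded u_def]], rule that)
  note g = this(1)[rule_format, unfolded u_def]
  have eq: "(\<integral>z. f z + (B + 1) \<partial>k u) = (\<integral>z. f z \<partial>k u) + (B + 1)" if u: "u \<in> pts d" for u
  proof -
    interpret prob_space "k u" by (rule k_prob[OF u])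
    show ?thesis using k_integrable[OF u f b] by (simp add: prob_space)
  qed
  let ?w = "\<lambda>t. \<lambda>i\<in>{..<d}. t * e i"
  have w: "ip d (?w t) v = t * ip d e v" "ip d (?w t) (?w t) = t\<^sup>2 * ip d e e" for t v
    by (simp_all add: ip_def sum_distrib_left power2_eq_square mult_ac)
  have bound: "\<bar>(\<integral>z. f z \<partial>k (padd d x (?w t))) - (\<integral>z. f z \<partial>k x)\<bar> \<le> \<bar>t * ip d e (g x)\<bar> + \<bar>L * (t\<^sup>2 * ip d e e)\<bar>" for t
    using g[OF x comb_pts, of "\<lambda>i. t * e i"] unfolding eq[OF x] eq[OF padd_pts] w(2) unfolding w(1) by linarith
  have "((\<lambda>t. \<bar>t * ip d e (g x)\<bar> + \<bar>L * (t\<^sup>2 * ip d e e)\<bar>) \<longlongrightarrow> \<bar>0 * ip d e (g x)\<bar> + \<bar>L * (0\<^sup>2 * ip d e e)\<bar>) (at 0)"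
    by (intro tendsto_intros)
  then have "((\<lambda>t. \<bar>t * ip d e (g x)\<bar> + \<bar>L * (t\<^sup>2 * ip d e e)\<bar>) \<longlongrightarrow> 0) (at 0)" by simp
  then have "((\<lambda>t. (\<integral>z. f z \<partial>k (padd d x (?w t))) - (\<integral>z. f z \<partial>k x)) \<longlongrightarrow> 0) (at 0)"
    by (rule Lim_null_comparison[rotated]) (use bound in \<open>auto intro!: always_eventually\<close>)
  then show ?thesis by (simp add: Lim_null[symmetric] LIM_zero_iff)
qed

text \<open>Exponent and base point move together. The increment is split into a change of exponent
  at the moved point and a change of base point at the old exponent.\<close>

lemma k_derivative:
  assumes f: "bounded_pos d f" and a: "0 < a" and x: "x \<in> pts d"
    and g: "\<And>x w. x \<in> pts d \<Longrightarrow> w \<in> pts d \<Longrightarrow>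
      \<bar>(\<integral>z. f z powr a \<partial>k (padd d x w)) - (\<integral>z. f z powr a \<partial>k x) - ip d w (g x)\<bar> \<le> L * ip d w w"
  shows "((\<lambda>t. \<integral>z. f z powr (a + t * b) \<partial>k (padd d x (\<lambda>i\<in>{..<d}. t * e i))) has_real_derivative
     b * (\<integral>z. f z powr a * ln (f z) \<partial>k x) + ip d e (g x)) (at 0)"
proof -
  obtain \<delta> D where *: "0 < \<delta>" "\<delta> \<le> D" "\<And>x. x \<in> pts d \<Longrightarrow> \<delta> \<le> f x" "\<And>x. x \<in> pts d \<Longrightarrow> f x \<le> D"
    and fm [measurable]: "f \<in> borel_measurable (leb d)" using bounded_posE[OF f] by metis
  let ?w = "\<lambda>t. \<lambda>i\<in>{..<d}. t * e i"
  let ?x = "\<lambda>t. padd d x (?w t)"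
  have w: "ip d (?w t) v = t * ip d e v" "ip d (?w t) (?w t) = t\<^sup>2 * ip d e e" for t v
    by (simp_all add: ip_def sum_distrib_left power2_eq_square mult_ac)
  have x0: "?x 0 = x" using x by (auto simp: padd_def fun_eq_iff PiE_def extensional_def)
  define l where "l = \<bar>ln \<delta>\<bar> + \<bar>ln D\<bar>"
  have fp: "0 < f z" and lf: "\<bar>ln (f z)\<bar> \<le> l" and pb: "f z powr a \<le> D powr a" if z: "z \<in> pts d" for z
  proof -
    show "0 < f z" using *(1) *(3)[OF z] by simp
    moreover have "ln \<delta> \<le> ln (f z)" "ln (f z) \<le> ln D" using *(1,2) *(3,4)[OF z] by auto
    then show "\<bar>ln (f z)\<bar> \<le> l" unfolding l_def by linarith
    show "f z powr a \<le> D powr a" using *(1) *(3,4)[OF z] a by (intro powr_mono2) auto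
  qed
  define H where "H z = f z powr a * ln (f z)" for z
  have Hm [measurable]: "H \<in> borel_measurable (leb d)" unfolding H_def by measurable
  have Hb: "\<bar>H z\<bar> \<le> D powr a * l" if z: "z \<in> pts d" for z
    unfolding H_def abs_mult using pb[OF z] lf[OF z] by (intro mult_mono) auto
  define M where "M = D powr a * (l\<^sup>2 * exp l)"
  have rem: "\<bar>f z powr (a + \<eta>) - f z powr a - \<eta> * H z\<bar> \<le> M * \<eta>\<^sup>2" if z: "z \<in> pts d" and \<eta>: "\<bar>\<eta>\<bar> \<le> 1" for z \<eta>
  proof -
    have "f z powr (a + \<eta>) = f z powr a * exp (\<eta> * ln (f z))"
      using fp[OF z] by (simp add: powr_def exp_add distrib_right)
    then have "f z powr (a + \<eta>) - f z powr a - \<eta> * H z = f z powr a * (exp (\<eta> * ln (f z)) - 1 - \<eta> * ln (f z))"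
      unfolding H_def by (simp add: algebra_simps)
    then have "\<bar>f z powr (a + \<eta>) - f z powr a - \<eta> * H z\<bar> = f z powr a * \<bar>exp (\<eta> * ln (f z)) - 1 - \<eta> * ln (f z)\<bar>"
      by (simp add: abs_mult)
    also have "\<dots> \<le> D powr a * (\<eta>\<^sup>2 * (l\<^sup>2 * exp l))"
    proof (intro mult_mono pb[OF z])
      have "\<bar>\<eta> * ln (f z)\<bar> \<le> 1 * l" unfolding abs_mult using \<eta> lf[OF z] by (intro mult_mono) auto
      moreover have "(\<eta> * ln (f z))\<^sup>2 \<le> \<eta>\<^sup>2 * l\<^sup>2"
        using power_mono[OF lf[OF z], of 2] by (simp add: power_mult_distrib mult_left_mono)
      ultimately have "(\<eta> * ln (f z))\<^sup>2 * exp \<bar>\<eta> * ln (f z)\<bar> \<le> (\<eta>\<^sup>2 * l\<^sup>2) * exp l"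
        by (intro mult_mono) auto
      with exp_taylor_bound[of "\<eta> * ln (f z)"] show "\<bar>exp (\<eta> * ln (f z)) - 1 - \<eta> * ln (f z)\<bar> \<le>
        \<eta>\<^sup>2 * (l\<^sup>2 * exp l)" by simp
    qed auto
    finally show ?thesis by (simp add: M_def mult_ac)
  qed
  have fa: "integrable (k u) (\<lambda>z. f z powr a)" if u: "u \<in> pts d" for u
    by (rule k_integrable[OF u, where B="D powr a"]) (use pb in auto)
  have fab: "integrable (k u) (\<lambda>z. f z powr (a + \<eta>))" if u: "u \<in> pts d" and \<eta>: "\<bar>\<eta>\<bar> \<le> 1" for u \<eta>
  proof (rule k_integrable[OF u, where B="D powr a + D powr a * l + M"])
    fix z assume z: "z \<in> pts d"
    have "\<bar>\<eta> * H z\<bar> \<le> 1 * (D powr a * l)" unfolding abs_mult using \<eta> Hb[OF z] by (intro mult_mono) auto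
    moreover have "M * \<eta>\<^sup>2 \<le> M * 1" using \<eta> by (intro mult_left_mono) (auto simp: M_def abs_square_le_1)
    ultimately show "\<bar>f z powr (a + \<eta>)\<bar> \<le> D powr a + D powr a * l + M"
      using rem[OF z \<eta>] pb[OF z] powr_ge_zero[of "f z" a] powr_ge_zero[of "f z" "a + \<eta>"] by linarith
  qed measurable
  have Hi: "integrable (k u) H" if u: "u \<in> pts d" for u
    by (rule k_integrable[OF u Hm Hb])
  \<comment> \<open>The exponent derivative is compared at the moved point, so the error is of order
    \<open>t\<close> uniformly; continuity along the segment then brings it back to
    \<open>x\<close>.\<close>
  have q: "((\<lambda>t. ((\<integral>z. f z powr (a + t * b) \<partial>k (?x t)) - (\<integral>z. f z powr a \<partial>k x)) / t
    - (b * (\<integral>z. H z \<partial>k (?x t)) + ip d e (g x))) \<longlongrightarrow> 0) (at 0)"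
  proof (rule Lim_null_comparison)
    show "((\<lambda>t. (M * b\<^sup>2 + \<bar>L * ip d e e\<bar>) * \<bar>t\<bar>) \<longlongrightarrow> 0) (at 0)"
      by (intro tendsto_eq_intros refl) auto
    have "((\<lambda>t. \<bar>t * b\<bar>) \<longlongrightarrow> \<bar>0 * b\<bar>) (at 0)" by (intro tendsto_intros)
    then have "\<forall>\<^sub>F t in at 0. \<bar>t * b\<bar> < 1" by (rule order_tendstoD) simp
    moreover have "\<forall>\<^sub>F t in at (0::real). t \<noteq> 0" by (simp add: eventually_at_filter)
    ultimately show "\<forall>\<^sub>F t in at 0. norm (((\<integral>z. f z powr (a + t * b) \<partial>k (?x t)) - (\<integral>z. f z powr a \<partial>k x)) / t
      - (b * (\<integral>z. H z \<partial>k (?x t)) + ip d e (g x)))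
       \<le> (M * b\<^sup>2 + \<bar>L * ip d e e\<bar>) * \<bar>t\<bar>"
    proof eventually_elim
      fix t assume t: "\<bar>t * b\<bar> < 1" "t \<noteq> 0"
      have xt: "?x t \<in> pts d" by simp
      let ?A = "\<integral>z. f z powr (a + t * b) \<partial>k (?x t)" and ?B = "\<integral>z. f z powr a \<partial>k (?x t)"
      have "?A - ?B - t * b * (\<integral>z. H z \<partial>k (?x t)) = (\<integral>z. f z powr (a + t * b) - f z powr a - t * b * H z \<partial>k (?x t))"
        using fa[OF xt] fab[OF xt, of "t * b"] Hi[OF xt] t by simp
      moreover have "\<bar>\<integral>z. f z powr (a + t * b) - f z powr a - t * b * H z \<partial>k (?x t)\<bar> \<le> M * (t * b)\<^sup>2"
        by (rule k_integral_le[OF xt]) (use rem t in auto)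
      ultimately have "\<bar>?A - ?B - t * b * (\<integral>z. H z \<partial>k (?x t))\<bar> \<le> M * (t * b)\<^sup>2" by simp
      moreover have "\<bar>?B - (\<integral>z. f z powr a \<partial>k x) - t * ip d e (g x)\<bar> \<le> \<bar>L * ip d e e\<bar> * t\<^sup>2"
      proof -
        have "L * (t\<^sup>2 * ip d e e) \<le> \<bar>L * ip d e e\<bar> * t\<^sup>2"
          by (metis abs_ge_self mult.assoc mult.commute mult_right_mono zero_le_power2)
        then show ?thesis using g[OF x comb_pts, of "\<lambda>i. t * e i"] unfolding w(2) unfolding w(1) by linarith
      qed
      ultimately have "\<bar>(?A - (\<integral>z. f z powr a \<partial>k x)) - t * (b * (\<integral>z. H z \<partial>k (?x t)) + ip d e (g x))\<bar> \<le>
        M * (t * b)\<^sup>2 + \<bar>L * ip d e e\<bar> * t\<^sup>2"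
        by (simp add: distrib_left mult.assoc)
      also have "\<dots> = (M * b\<^sup>2 + \<bar>L * ip d e e\<bar>) * \<bar>t\<bar> * \<bar>t\<bar>"
        by (simp add: power2_eq_square algebra_simps)
      finally have "\<bar>(?A - (\<integral>z. f z powr a \<partial>k x)) - t * (b * (\<integral>z. H z \<partial>k (?x t)) + ip d e (g x))\<bar> / \<bar>t\<bar> \<le>
        (M * b\<^sup>2 + \<bar>L * ip d e e\<bar>) * \<bar>t\<bar>"
        using t by (simp add: divide_le_eq)
      moreover have "\<bar>(?A - (\<integral>z. f z powr a \<partial>k x)) - t * (b * (\<integral>z. H z \<partial>k (?x t)) + ip d e (g x))\<bar> / \<bar>t\<bar>
         = \<bar>(?A - (\<integral>z. f z powr a \<partial>k x)) / t - (b * (\<integral>z. H z \<partial>k (?x t)) + ip d e (g x))\<bar>"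
        using t by (simp add: abs_divide[symmetric] diff_divide_distrib del: abs_divide)
      ultimately show "norm ((?A - (\<integral>z. f z powr a \<partial>k x)) / t - (b * (\<integral>z. H z \<partial>k (?x t)) + ip d e (g x))) \<le>
        (M * b\<^sup>2 + \<bar>L * ip d e e\<bar>) * \<bar>t\<bar>"
        by simp
    qed
  qed
  have "((\<lambda>t. b * (\<integral>z. H z \<partial>k (?x t)) + ip d e (g x)) \<longlongrightarrow> b * (\<integral>z. H z \<partial>k x) + ip d e (g x)) (at 0)"
    by (intro tendsto_intros k_line_continuous[OF x Hm Hb])
  from tendsto_add[OF q this]
  have "((\<lambda>t. ((\<integral>z. f z powr (a + t * b) \<partial>k (?x t)) - (\<integral>z. f z powr a \<partial>k x)) / t) \<longlongrightarrow>
    b * (\<integral>z. H z \<partial>k x) + ip d e (g x)) (at 0)"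
    by simp
  then show ?thesis unfolding has_field_derivative_iff using x0 by (simp add: H_def)
qed

lemma k_integral_pos:
  fixes f :: "point \<Rightarrow> real"
  assumes x: "x \<in> pts d" and f: "bounded_pos d f"
  shows "0 < (\<integral>z. f z \<partial>k x)"
proof -
  obtain \<delta> D where *: "0 < \<delta>" "\<delta> \<le> D" "\<And>x. x \<in> pts d \<Longrightarrow> \<delta> \<le> f x" "\<And>x. x \<in> pts d \<Longrightarrow> f x \<le> D"
    and fm [measurable]: "f \<in> borel_measurable (leb d)" using bounded_posE[OF f] by metis
  interpret prob_space "k x" by (rule k_prob[OF x])
  have "\<bar>f z\<bar> \<le> D" if "z \<in> pts d" for z using *(1) *(3,4)[OF that] by linarith
  then have "integrable (k x) f" by (rule k_integrable[OF x fm])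
  then have "\<delta> \<le> (\<integral>z. f z \<partial>k x)" using * k_space[OF x] by (intro integral_ge_const AE_I2) auto
  then show ?thesis using *(1) by simp
qed

text \<open>Along the segment from \<open>x\<close> to \<open>y\<close> the exponent \<open>a\<close> grows linearly from \<open>1\<close> to \<open>p\<close>: in the derivative of
  \<open>ln (\<integral>z. f z powr a \<partial>k x\<^sub>s) / a\<close> the entropy produced by the growth of \<open>a\<close> absorbs the gradient term.\<close>

lemma harnack:
  assumes f: "bounded_pos d f" and p: "1 < p" and x: "x \<in> pts d" and y: "y \<in> pts d"
  shows "(\<integral>z. f z \<partial>k x) powr p \<le> (\<integral>z. f z powr p \<partial>k y) * exp (p * c * (edist d x y)\<^sup>2 / (4 * (p - 1)))"
proof -
  define b where "b = p - 1"
  have b: "b > 0" using p by (simp add: b_def)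
  define e where "e i = y i - x i" for i
  define r where "r = ip d e e"
  define a where "a s = 1 + s * b" for s
  define X where "X s = padd d x (\<lambda>i\<in>{..<d}. s * e i)" for s
  define \<Phi> where "\<Phi> s = (\<integral>z. f z powr a s \<partial>k (X s))" for s
  \<comment> \<open>The linear term is the total cost of the motion: \<open>r\<close> is the squared
    length of the segment, and its coefficient is what Young's inequality leaves below.\<close>
  define \<psi> where "\<psi> s = ln (\<Phi> s) / a s + r * c / (4 * b) * s" for s
  have X: "X s \<in> pts d" for s by (simp add: X_def)
  have "\<psi> 0 \<le> \<psi> 1"
  proof (rule DERIV_nonneg_imp_nondecreasing[of 0 1 \<psi>])
    fix s :: real assume s: "0 \<le> s" "s \<le> 1"
    have as: "1 \<le> a s" using s b by (simp add: a_def)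
    have bp: "bounded_pos d (\<lambda>z. f z powr a s)" by (rule bounded_pos_powr[OF f]) (use as in simp)
    define u where "u z = f z powr a s" for z
    obtain L g where g: "\<forall>x\<in>pts d. \<forall>w\<in>pts d.
        \<bar>(\<integral>z. u z \<partial>k (padd d x w)) - (\<integral>z. u z \<partial>k x) - ip d w (g x)\<bar> \<le> L * ip d w w"
      "\<forall>x\<in>pts d. ip d (g x) (g x) \<le>
        c * (\<integral>z. u z \<partial>k x) * ((\<integral>z. u z * ln (u z) \<partial>k x) - (\<integral>z. u z \<partial>k x) * ln (\<integral>z. u z \<partial>k x))"
      by (rule k_quadraticE[OF bp[folded u_def]], rule that)
    define H where "H = (\<integral>z. f z powr a s * ln (f z) \<partial>k (X s))"
    define P where "P = ip d e (g (X s))"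
    have "((\<lambda>t. \<integral>z. f z powr (a s + t * b) \<partial>k (padd d (X s) (\<lambda>i\<in>{..<d}. t * e i))) has_real_derivative b * H
      + P) (at 0)"
      unfolding H_def P_def
      by (rule k_derivative[OF f _ X, of "a s" g L]) (use as g(1)[unfolded u_def] in auto)
    moreover have "(\<lambda>t. \<integral>z. f z powr (a s + t * b) \<partial>k (padd d (X s) (\<lambda>i\<in>{..<d}. t * e i))) = (\<lambda>t. \<Phi> (s + t))"
    proof
      fix t
      have "padd d (X s) (\<lambda>i\<in>{..<d}. t * e i) = X (s + t)"
        by (auto simp: X_def padd_def algebra_simps)
      moreover have "a s + t * b = a (s + t)" by (simp add: a_def algebra_simps)
      ultimately show "(\<integral>z. f z powr (a s + t * b) \<partial>k (padd d (X s) (\<lambda>i\<in>{..<d}. t * e i))) = \<Phi> (s + t)"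
        by (simp add: \<Phi>_def)
    qed
    ultimately have "((\<lambda>t. \<Phi> (s + t)) has_real_derivative b * H + P) (at 0)" by simp
    then have d\<Phi>: "(\<Phi> has_real_derivative b * H + P) (at s)"
      by (simp add: has_field_derivative_iff) (simp add: DERIV_def[symmetric] has_field_derivative_iff)
    have \<Phi>p: "\<Phi> s > 0" unfolding \<Phi>_def by (rule k_integral_pos[OF X bp])
    \<comment> \<open>The entropy of \<open>f powr a s\<close> under the kernel, divided by its
      mean.\<close>
    define E where "E = a s * H / \<Phi> s - ln (\<Phi> s)"
    have uln: "(\<integral>z. u z * ln (u z) \<partial>k (X s)) = a s * H"
    proof -
      have "(\<integral>z. u z * ln (u z) \<partial>k (X s)) = (\<integral>z. a s * (f z powr a s * ln (f z)) \<partial>k (X s))"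
      proof (rule Bochner_Integration.integral_cong[OF refl])
        fix z assume "z \<in> space (k (X s))"
        then have "z \<in> pts d" using k_space[OF X] by simp
        then have "f z > 0" using f unfolding bounded_pos_def by force
        then show "u z * ln (u z) = a s * (f z powr a s * ln (f z))" by (simp add: u_def ln_powr)
      qed
      then show ?thesis by (simp add: H_def)
    qed
    have u\<Phi>: "(\<integral>z. u z \<partial>k (X s)) = \<Phi> s" by (simp add: u_def \<Phi>_def)
    have "ip d (g (X s)) (g (X s)) \<le> c * \<Phi> s * (a s * H - \<Phi> s * ln (\<Phi> s))"
      using bspec[OF g(2) X[of s]] unfolding uln u\<Phi> .
    also have "a s * H - \<Phi> s * ln (\<Phi> s) = \<Phi> s * E" using \<Phi>p by (simp add: E_def right_diff_distrib)
    finally have gE: "ip d (g (X s)) (g (X s)) \<le> c * (\<Phi> s)\<^sup>2 * E" by (simp add: power2_eq_square mult_ac)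
    have E0: "0 \<le> E"
    proof -
      have "0 \<le> c * (\<Phi> s)\<^sup>2 * E" by (rule order_trans[OF ip_nonneg gE])
      moreover have "0 < c * (\<Phi> s)\<^sup>2" using c_pos \<Phi>p by simp
      ultimately show ?thesis by (simp add: zero_le_mult_iff)
    qed
    \<comment> \<open>Young's inequality with weight \<open>b\<close>, the speed of the exponent:
      its first term equals the entropy produced by the growing exponent and cancels in the
      derivative of \<open>\<psi>\<close>.\<close>
    have "- (P / (a s * \<Phi> s)) \<le> b * (E / (a s)\<^sup>2) + r * c / (4 * b)"
    proof (rule young_scaled)
      have "P\<^sup>2 \<le> r * ip d (g (X s)) (g (X s))" unfolding P_def r_def by (rule ip_cauchy_schwarz)
      also have "\<dots> \<le> r * (c * (\<Phi> s)\<^sup>2 * E)" by (intro mult_left_mono gE) (simp add: r_def ip_nonneg)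
      finally have "P\<^sup>2 / (a s * \<Phi> s)\<^sup>2 \<le> r * (c * (\<Phi> s)\<^sup>2 * E) / (a s * \<Phi> s)\<^sup>2" by (rule divide_right_mono) simp
      also have "\<dots> = r * c * (E / (a s)\<^sup>2)" using \<Phi>p by (simp add: power_mult_distrib)
      finally show "(- (P / (a s * \<Phi> s)))\<^sup>2 \<le> r * c * (E / (a s)\<^sup>2)" by (simp add: power_divide)
    qed (use c_pos b E0 in \<open>auto simp: r_def ip_nonneg\<close>)
    moreover have "((b * H + P) / \<Phi> s * a s - ln (\<Phi> s) * b) / (a s * a s) = b * (E / (a s)\<^sup>2) + P / (a s * \<Phi> s)"
      using as \<Phi>p by (simp add: E_def power2_eq_square field_simps)
    ultimately have nn: "0 \<le> ((b * H + P) / \<Phi> s * a s - ln (\<Phi> s) * b) / (a s * a s) + r * c / (4 * b)" by linarith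
    have da: "(a has_real_derivative b) (at s)" unfolding a_def by (auto intro!: derivative_eq_intros)
    have "(\<psi> has_real_derivative ((b * H + P) / \<Phi> s * a s - ln (\<Phi> s) * b) / (a s * a s) + r * c / (4 * b)) (at s)"
      unfolding \<psi>_def using as \<Phi>p b
      by (auto intro!: derivative_eq_intros d\<Phi> da simp: field_simps)
    with nn show "\<exists>y. (\<psi> has_real_derivative y) (at s) \<and> y \<ge> 0" by blast
  qed simp
  moreover have "X 0 = x" using x by (auto simp: X_def padd_def fun_eq_iff PiE_def extensional_def)
  moreover have "X 1 = y" using x y by (auto simp: X_def padd_def e_def fun_eq_iff PiE_def extensional_def)
  moreover have "(\<integral>z. f z powr 1 \<partial>k x) = (\<integral>z. f z \<partial>k x)"
  proof (rule Bochner_Integration.integral_cong[OF refl])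
    fix z assume "z \<in> space (k x)"
    then have "z \<in> pts d" using k_space[OF x] by simp
    then have "f z > 0" using f unfolding bounded_pos_def by force
    then show "f z powr 1 = f z" by simp
  qed
  ultimately have "ln (\<integral>z. f z \<partial>k x) \<le> ln (\<integral>z. f z powr p \<partial>k y) / p + r * c / (4 * b)"
    by (simp add: \<psi>_def \<Phi>_def a_def b_def)
  then have "p * ln (\<integral>z. f z \<partial>k x) \<le> p * (ln (\<integral>z. f z powr p \<partial>k y) / p + r * c / (4 * b))"
    using p by (intro mult_left_mono) auto
  also have "\<dots> = ln (\<integral>z. f z powr p \<partial>k y) + p * c * r / (4 * b)" using p by (simp add: distrib_left)
  finally have "exp (p * ln (\<integral>z. f z \<partial>k x)) \<le> exp (ln (\<integral>z. f z powr p \<partial>k y) + p * c * r / (4 * b))" by simp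
  moreover have "exp (p * ln (\<integral>z. f z \<partial>k x)) = (\<integral>z. f z \<partial>k x) powr p"
    using k_integral_pos[OF x f] by (simp add: powr_def)
  moreover have "exp (ln (\<integral>z. f z powr p \<partial>k y)) = (\<integral>z. f z powr p \<partial>k y)"
    using k_integral_pos[OF y bounded_pos_powr[OF f]] p by simp
  moreover have "r = (edist d x y)\<^sup>2" unfolding edist_sq
    by (simp add: r_def ip_def e_def power2_eq_square algebra_simps)
  ultimately show ?thesis by (simp add: exp_add b_def)
qed

end

section \<open>Renyi divergence along the proximal sampler\<close>

text \<open>Duality: the density raised to \<open>q - 1\<close> is the extremal test function, and
  \<open>(q - 1) * p = q\<close> turns the hypothesis into a bound of \<open>I powr p\<close> by
  \<open>I * exp B\<close> for the moment \<open>I\<close>. Truncating the density keeps the test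
  function bounded and \<open>I\<close> finite before dividing.\<close>

lemma renyi_le:
  fixes \<mu> \<nu> :: "'a measure"
  assumes \<mu>: "prob_space \<mu>" and \<nu>: "prob_space \<nu>" and sets_eq: "sets \<mu> = sets \<nu>"
    and q: "1 < q" and p: "p = q / (q - 1)" and B: "0 \<le> B"
    and le: "\<And>f \<delta> D. f \<in> borel_measurable \<nu> \<Longrightarrow> 0 < \<delta> \<Longrightarrow> (\<And>x. x \<in> space \<nu> \<Longrightarrow> \<delta> \<le> f x) \<Longrightarrow> (\<And>x. x \<in> space \<nu> \<Longrightarrow> f x \<le> D) \<Longrightarrow>
       (\<integral>x. f x \<partial>\<mu>) powr p \<le> (\<integral>x. f x powr p \<partial>\<nu>) * exp B"
  shows "renyi q \<mu> \<nu> \<le> ereal B"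
proof -
  interpret M: prob_space \<mu> by fact
  interpret N: prob_space \<nu> by fact
  have sp: "space \<mu> = space \<nu>" using sets_eq by (rule sets_eq_imp_space_eq)
  have p1: "1 < p" using q by (simp add: p)
  have pq: "(q - 1) * p = q" using q by (simp add: p)
  note [measurable_cong] = sets_eq
  \<comment> \<open>Adding a vanishing constant extends the hypothesis to bounded functions that may
    be zero, in particular to indicators and truncated densities.\<close>
  have le0: "(\<integral>x. f x \<partial>\<mu>) powr p \<le> (\<integral>x. f x powr p \<partial>\<nu>) * exp B"
    if fm [measurable]: "f \<in> borel_measurable \<nu>" and f: "\<And>x. x \<in> space \<nu> \<Longrightarrow> 0 \<le> f x" "\<And>x. x \<in> space \<nu> \<Longrightarrow> f x \<le> D" for f D
  proof -
    define t where "t n = 1 / (real n + 1)" for n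
    have t: "0 < t n" "t n \<le> 1" for n by (auto simp: t_def)
    have t0: "t \<longlonglongrightarrow> 0" unfolding t_def by real_asymp
    have i: "integrable \<mu> f" by (rule M.integrable_const_bound[of _ D]) (use f sp in auto)
    have le2: "(\<integral>x. f x \<partial>\<mu>) powr p \<le> (\<integral>x. (f x + t n) powr p \<partial>\<nu>) * exp B" for n
    proof -
      have "(\<integral>x. f x \<partial>\<mu>) \<le> (\<integral>x. f x + t n \<partial>\<mu>)" using i t[of n] by (intro integral_mono) auto
      moreover have "0 \<le> (\<integral>x. f x \<partial>\<mu>)" using f sp by (intro integral_nonneg_AE AE_I2) auto
      ultimately have "(\<integral>x. f x \<partial>\<mu>) powr p \<le> (\<integral>x. f x + t n \<partial>\<mu>) powr p" using p1 by (intro powr_mono2) auto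
      also have "\<dots> \<le> (\<integral>x. (f x + t n) powr p \<partial>\<nu>) * exp B"
        by (rule le[of _ "t n" "D + t n"]) (use t[of n] f in auto)
      finally show ?thesis .
    qed
    have "(\<lambda>n. (\<integral>x. (f x + t n) powr p \<partial>\<nu>) * exp B) \<longlonglongrightarrow> (\<integral>x. f x powr p \<partial>\<nu>) * exp B"
    proof (intro tendsto_mult tendsto_const integral_dominated_convergence[where w="\<lambda>_. (D + 1) powr p"])
      show "AE x in \<nu>. (\<lambda>n. (f x + t n) powr p) \<longlonglongrightarrow> f x powr p"
      proof (intro AE_I2)
        fix x assume x: "x \<in> space \<nu>"
        have "(\<lambda>n. f x + t n) \<longlonglongrightarrow> f x + 0" by (intro tendsto_intros t0)
        then have "(\<lambda>n. (f x + t n) powr p) \<longlonglongrightarrow> (f x + 0) powr p"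
          by (intro tendsto_powr') (use p1 f(1)[OF x] t in \<open>auto intro!: always_eventually add_nonneg_nonneg
            less_imp_le\<close>)
        then show "(\<lambda>n. (f x + t n) powr p) \<longlonglongrightarrow> f x powr p" by simp
      qed
      show "AE x in \<nu>. norm ((f x + t n) powr p) \<le> (D + 1) powr p" for n
      proof (intro AE_I2)
        fix x assume x: "x \<in> space \<nu>"
        then show "norm ((f x + t n) powr p) \<le> (D + 1) powr p"
          using p1 f[OF x] t[of n] by (auto intro!: powr_mono2)
      qed
    qed auto
    then show ?thesis by (rule LIMSEQ_le_const) (use le2 in blast)
  qed
  have ac: "absolutely_continuous \<nu> \<mu>"
    unfolding absolutely_continuous_def
  proof
    fix A assume A: "A \<in> null_sets \<nu>"
    then have [measurable]: "A \<in> sets \<nu>" by auto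
    \<comment> \<open>Indicators are fixed by positive powers, so the inequality applied to a null
      set gives absolute continuity.\<close>
    have "(\<lambda>x. indicator A x powr p) = (indicator A :: _ \<Rightarrow> real)" by (auto simp: indicator_def)
    then have "(\<integral>x. (indicator A x :: real) powr p \<partial>\<nu>) = 0" using measure_eq_0_null_sets[OF A]
      by (simp add: Int_absorb1 sets.sets_into_space)
    with le0[of "indicator A" 1] have "(\<integral>x. (indicator A x :: real) \<partial>\<mu>) powr p \<le> 0" by simp
    then have "measure \<mu> A = 0" using sp by (simp add: Int_absorb1 sets.sets_into_space)
    then show "A \<in> null_sets \<mu>" using sets_eq by (simp add: null_sets_def M.emeasure_eq_measure)
  qed
  define \<rho> where "\<rho> x = enn2real (RN_deriv \<nu> \<mu> x)" for x
  have [measurable]: "\<rho> \<in> borel_measurable \<nu>" unfolding \<rho>_def by measurable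
  have \<rho>0: "0 \<le> \<rho> x" for x by (simp add: \<rho>_def)
  define r where "r n x = min (\<rho> x) (real n)" for n x
  have rm [measurable]: "r n \<in> borel_measurable \<nu>" for n unfolding r_def by measurable
  have r: "0 \<le> r n x" "r n x \<le> real n" "r n x \<le> \<rho> x" for n x using \<rho>0 by (auto simp: r_def)
  have bound: "(\<integral>x. r n x powr q \<partial>\<nu>) \<le> exp (B * (q - 1))" for n
  proof -
    \<comment> \<open>The moment of the truncated density. It is at most the integral of
      \<open>r n powr (q - 1)\<close> under \<open>\<mu>\<close>, because one factor may be restored
      to the full density.\<close>
    define I where "I = (\<integral>x. r n x powr q \<partial>\<nu>)"
    have iI: "integrable \<nu> (\<lambda>x. r n x powr q)"
      by (rule N.integrable_const_bound[of _ "real n powr q"]) (use r q in \<open>auto intro!: powr_mono2\<close>)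
    have if': "integrable \<mu> (\<lambda>x. r n x powr (q - 1))"
      by (rule M.integrable_const_bound[of _ "real n powr (q - 1)"]) (use r q in \<open>auto intro!: powr_mono2\<close>)
    have i\<rho>: "integrable \<nu> (\<lambda>x. \<rho> x * r n x powr (q - 1))"
      using if' N.RN_deriv_integrable[OF M.sigma_finite_measure_axioms ac sets_eq, of "\<lambda>x. r n x powr (q - 1)"]
      by (simp add: \<rho>_def)
    have "I \<le> (\<integral>x. \<rho> x * r n x powr (q - 1) \<partial>\<nu>)"
      unfolding I_def
    proof (rule integral_mono[OF iI i\<rho>])
      fix x
      have "r n x powr q = r n x * r n x powr (q - 1)"
        using r(1)[of n x] q by (cases "r n x = 0") (auto simp: powr_diff)
      also have "\<dots> \<le> \<rho> x * r n x powr (q - 1)" using r by (intro mult_right_mono) auto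
      finally show "r n x powr q \<le> \<rho> x * r n x powr (q - 1)" .
    qed
    also have "\<dots> = (\<integral>x. r n x powr (q - 1) \<partial>\<mu>)"
      using N.RN_deriv_integral[OF M.sigma_finite_measure_axioms ac sets_eq, of "\<lambda>x. r n x powr (q - 1)"]
        by (simp add: \<rho>_def)
    finally have le1: "I \<le> (\<integral>x. r n x powr (q - 1) \<partial>\<mu>)" .
    have I0: "0 \<le> I" unfolding I_def by (intro integral_nonneg_AE AE_I2) simp
    have "I powr p \<le> (\<integral>x. r n x powr (q - 1) \<partial>\<mu>) powr p" using I0 le1 p1 by (intro powr_mono2) auto
    also have "\<dots> \<le> (\<integral>x. (r n x powr (q - 1)) powr p \<partial>\<nu>) * exp B"
      by (rule le0[of _ "real n powr (q - 1)"]) (use r q in \<open>auto intro!: powr_mono2\<close>)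
    also have "\<dots> = I * exp B" using pq by (simp add: powr_powr I_def)
    finally have Ip: "I powr p \<le> I * exp B" .
    have "I \<le> exp (B * (q - 1))"
    proof (cases "I = 0")
      case False
      then have Ipos: "I > 0" using I0 by simp
      have "p * ln I \<le> ln I + B"
        using Ip Ipos by (metis exp_gt_zero ln_exp ln_le_cancel_iff ln_mult_pos ln_powr mult_pos_pos
          powr_gt_zero less_irrefl)
      then have "(p - 1) * ln I \<le> B" by (simp add: left_diff_distrib)
      then have "(q - 1) * ((p - 1) * ln I) \<le> (q - 1) * B" using q by (intro mult_left_mono) auto
      moreover have "(q - 1) * (p - 1) = 1" using pq by (simp add: algebra_simps)
      ultimately have "ln I \<le> B * (q - 1)" by (simp add: mult.assoc[symmetric] mult.commute[of B])
      then have "exp (ln I) \<le> exp (B * (q - 1))" by simp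
      then show ?thesis using Ipos by simp
    qed simp
    then show ?thesis by (simp add: I_def)
  qed
  have lim: "(\<lambda>n. \<integral>\<^sup>+x. ennreal (r n x powr q) \<partial>\<nu>) \<longlonglongrightarrow> (\<integral>\<^sup>+x. ennreal (\<rho> x powr q) \<partial>\<nu>)"
  proof (rule nn_integral_LIMSEQ)
    show "incseq (\<lambda>n x. ennreal (r n x powr q))"
      using q \<rho>0 by (auto simp: incseq_def le_fun_def r_def intro!: ennreal_leI powr_mono2)
    fix x
    obtain k where k: "\<rho> x \<le> real k" using real_arch_simple by blast
    have "\<forall>\<^sub>F n in sequentially. ennreal (r n x powr q) = ennreal (\<rho> x powr q)"
      using eventually_ge_at_top[of k] by eventually_elim (use k in \<open>auto simp: r_def min_def\<close>)
    then show "(\<lambda>n. ennreal (r n x powr q)) \<longlonglongrightarrow> ennreal (\<rho> x powr q)" by (rule tendsto_eventually)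
  qed measurable
  have nn: "(\<integral>\<^sup>+x. ennreal (\<rho> x powr q) \<partial>\<nu>) \<le> ennreal (exp (B * (q - 1)))"
  proof (rule LIMSEQ_le_const2[OF lim], intro exI[of _ 0] allI impI)
    fix n
    have "(\<integral>\<^sup>+x. ennreal (r n x powr q) \<partial>\<nu>) = ennreal (\<integral>x. r n x powr q \<partial>\<nu>)"
      by (intro nn_integral_eq_integral N.integrable_const_bound[of _ "real n powr q"]) (use r q in \<open>auto
        intro!: powr_mono2\<close>)
    then show "(\<integral>\<^sup>+x. ennreal (r n x powr q) \<partial>\<nu>) \<le> ennreal (exp (B * (q - 1)))" using bound[of n]
      by (simp add: ennreal_leI)
  qed
  have int: "integrable \<nu> (\<lambda>x. \<rho> x powr q)"
    using nn by (intro integrableI_nonneg) (auto simp: le_less_trans)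
  define I where "I = (\<integral>x. \<rho> x powr q \<partial>\<nu>)"
  have I: "I \<le> exp (B * (q - 1))"
    using nn int by (simp add: nn_integral_eq_integral I_def)
  have I0: "0 \<le> I" unfolding I_def by (intro integral_nonneg_AE AE_I2) simp
  \<comment> \<open>In the degenerate case \<open>I = 0\<close> the default values of
    \<open>powr\<close> and \<open>ln\<close> at 0 make the left side vanish.\<close>
  have "q / (q - 1) * ln (I powr (1 / q)) \<le> B"
  proof (cases "I = 0")
    case False
    then have Ip: "I > 0" using I0 by simp
    then have "ln I \<le> B * (q - 1)" using I by (metis ln_exp ln_le_cancel_iff exp_gt_zero)
    then have "1 / (q - 1) * ln I \<le> 1 / (q - 1) * (B * (q - 1))" using q by (intro mult_left_mono) auto
    moreover have "q / (q - 1) * ln (I powr (1 / q)) = 1 / (q - 1) * ln I" using q Ip by (simp add: ln_powr)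
    ultimately show ?thesis using q by simp
  qed (use B in simp)
  then show ?thesis
    unfolding renyi_def using sets_eq ac int by (simp add: \<rho>_def[symmetric] I_def)
qed

section \<open>Markov kernels acting on bounded functions\<close>

definition bounded_meas :: "nat \<Rightarrow> (point \<Rightarrow> real) \<Rightarrow> bool" where
  "bounded_meas d f \<longleftrightarrow> f \<in> borel_measurable (leb d) \<and> (\<exists>B. \<forall>x\<in>pts d. \<bar>f x\<bar> \<le> B)"

lemma ennreal_mult_divide_cancel: "0 < a \<Longrightarrow> ennreal a * (I / ennreal a) = I"
  unfolding ennreal_times_divide by (subst mult.commute, rule mult_divide_eq_ennreal) auto

lemma bounded_pos_meas: "bounded_pos d f \<Longrightarrow> bounded_meas d f"
proof -
  assume f: "bounded_pos d f"
  obtain \<delta> D where *: "0 < \<delta>" "\<delta> \<le> D" "\<And>x. x \<in> pts d \<Longrightarrow> \<delta> \<le> f x" "\<And>x. x \<in> pts d \<Longrightarrow> f x \<le> D"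
    and fm: "f \<in> borel_measurable (leb d)" using bounded_posE[OF f] by metis
  have "\<bar>f x\<bar> \<le> D" if "x \<in> pts d" for x using *(1) *(3,4)[OF that] by linarith
  then show ?thesis using fm unfolding bounded_meas_def by blast
qed

lemma prob_algebraD:
  assumes "M \<in> space (prob_algebra N)"
  shows "prob_space M" "sets M = sets N" "space M = space N"
  using assms sets_eq_imp_space_eq[of M N] by (auto simp: space_prob_algebra)

lemma kernelD:
  assumes "K \<in> leb d \<rightarrow>\<^sub>M prob_algebra (leb d)" "x \<in> pts d"
  shows "K x \<in> space (prob_algebra (leb d))"
  using measurable_space[OF assms(1)] assms(2) by (simp add: space_leb)

lemma integrable_bounded_meas:
  assumes M: "M \<in> space (prob_algebra (leb d))" and f: "bounded_meas d f"
  shows "integrable M f"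
proof -
  interpret prob_space M using prob_algebraD(1)[OF M] .
  obtain B where "\<And>x. x \<in> pts d \<Longrightarrow> \<bar>f x\<bar> \<le> B" "f \<in> borel_measurable (leb d)"
    using f unfolding bounded_meas_def by blast
  then show ?thesis using prob_algebraD(2,3)[OF M]
    by (intro integrable_const_bound[of _ B] AE_I2) (auto simp: space_leb measurable_cong_sets[of M "leb d"])
qed

lemma bounded_meas_kernel:
  assumes K: "K \<in> leb d \<rightarrow>\<^sub>M prob_algebra (leb d)" and f: "bounded_meas d f"
  shows "bounded_meas d (\<lambda>x. \<integral>z. f z \<partial>K x)"
proof -
  obtain B where B: "\<And>x. x \<in> pts d \<Longrightarrow> \<bar>f x\<bar> \<le> B" and fm: "f \<in> borel_measurable (leb d)"
    using f unfolding bounded_meas_def by blast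
  have "\<bar>\<integral>z. f z \<partial>K x\<bar> \<le> B" if x: "x \<in> pts d" for x
  proof -
    note Kx = kernelD[OF K x]
    interpret prob_space "K x" using prob_algebraD(1)[OF Kx] .
    have "f z \<le> B" "- B \<le> f z" if "z \<in> space (K x)" for z
      using B[of z] that prob_algebraD(3)[OF Kx] by (auto simp: space_leb)
    then have "(\<integral>z. f z \<partial>K x) \<le> B" "- B \<le> (\<integral>z. f z \<partial>K x)"
      using integrable_bounded_meas[OF Kx f] by (auto intro!: integral_le_const integral_ge_const AE_I2)
    then show ?thesis by simp
  qed
  moreover have "(\<lambda>x. \<integral>z. f z \<partial>K x) \<in> borel_measurable (leb d)"
    using measurable_compose[OF measurable_prob_algebraD[OF K] integral_measurable_subprob_algebra[OF fm]] .
  ultimately show ?thesis unfolding bounded_meas_def by blast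
qed

lemma integral_bind_kernel:
  assumes M: "M \<in> space (prob_algebra (leb d))" and K: "K \<in> leb d \<rightarrow>\<^sub>M prob_algebra (leb d)" and f: "bounded_meas d f"
  shows "(\<integral>x. f x \<partial>(M \<bind> K)) = (\<integral>x. \<integral>z. f z \<partial>K x \<partial>M)"
proof -
  obtain B where B: "\<And>x. x \<in> pts d \<Longrightarrow> \<bar>f x\<bar> \<le> B" and fm: "f \<in> borel_measurable (leb d)"
    using f unfolding bounded_meas_def by blast
  interpret prob_space M using prob_algebraD(1)[OF M] .
  have K': "K \<in> M \<rightarrow>\<^sub>M subprob_algebra (leb d)"
    using measurable_prob_algebraD[OF K] by (simp add: measurable_cong_sets[OF prob_algebraD(2)[OF M] refl])
  show ?thesis
  proof (rule integral_bind[OF fm _ K'])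
    show "\<bar>f x\<bar> \<le> B" if "x \<in> space (leb d)" for x using B that by (simp add: space_leb)
    show "finite_measure M" by unfold_locales
    show "AE x in M. emeasure (K x) (space (K x)) \<le> ennreal 1"
    proof (intro AE_I2)
      fix x assume "x \<in> space M"
      then have Kx: "K x \<in> space (prob_algebra (leb d))"
        using K prob_algebraD(3)[OF M] by (intro kernelD) (auto simp: space_leb)
      show "emeasure (K x) (space (K x)) \<le> ennreal 1"
        using prob_space.emeasure_space_1[OF prob_algebraD(1)[OF Kx]] by simp
    qed
  qed
qed

lemma bind_prob_algebra:
  assumes "M \<in> space (prob_algebra (leb d))" "K \<in> leb d \<rightarrow>\<^sub>M prob_algebra (leb d)"
  shows "M \<bind> K \<in> space (prob_algebra (leb d))"
  using measurable_space[OF measurable_bind_prob_space[OF measurable_const[OF assms(1)] assms(2)], of undefined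
    "count_space UNIV"] by simp

context potential
begin

lemma mu_prob_algebra: "mu y \<in> space (prob_algebra (leb d))"
  by (simp add: space_prob_algebra prob_space_mu)

lemma U_pair_measurable [measurable]: "(\<lambda>(y, x). U y x) \<in> borel_measurable (leb d \<Otimes>\<^sub>M leb d)"
  unfolding regularized_def case_prod_beta by measurable

lemma mu_kernel [measurable]: "(\<lambda>y. mu y) \<in> leb d \<rightarrow>\<^sub>M prob_algebra (leb d)"
proof (rule measurable_prob_algebraI)
  interpret product_sigma_finite "\<lambda>_::nat. lborel :: real measure" by standard
  interpret L: sigma_finite_measure "leb d" by (rule sigma_finite) auto
  show "prob_space (mu y)" for y by (rule prob_space_mu)
  show "(\<lambda>y. mu y) \<in> leb d \<rightarrow>\<^sub>M subprob_algebra (leb d)"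
  proof (rule measurable_subprob_algebra)
    show "subprob_space (mu y)" for y by (rule prob_space_imp_subprob_space[OF prob_space_mu])
    show "sets (mu y) = sets (leb d)" for y by simp
    fix A assume [measurable]: "A \<in> sets (leb d)"
    have "emeasure (mu y) A = (\<integral>\<^sup>+x. ennreal (exp (- U y x)) * indicator A x \<partial>leb d) / (\<integral>\<^sup>+x. ennreal (exp (- U
      y x)) \<partial>leb d)" for y
      using nn_integral_mu[of "indicator A" y] by (simp add: nn_integral_exp_U)
    then show "(\<lambda>y. emeasure (mu y) A) \<in> borel_measurable (leb d)" by simp
  qed
qed

end

section \<open>The alternating kernel of the sampler\<close>

locale proximal_sampler = potential +
  assumes integrable_target: "integrable (leb d) (\<lambda>x. exp (- V x))"

text \<open>The forward step is the restricted Gaussian kernel of the zero potential; its modulus is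
  \<open>1 / h\<close>, so its Sobolev step has factor 1.\<close>

sublocale proximal_sampler \<subseteq> gauss: potential d "\<lambda>_. 0" 0 h
  by unfold_locales (auto simp: strongly_convex_def h_pos)

context proximal_sampler
begin

lemma gauss_mu: "gauss.mu y = gaussian d y h"
  by (rule gaussian_eq_gibbs[OF h_pos, symmetric])

text \<open>The recursion adds steps at the front, where the dependence on the starting point is
  differentiated. The kernel ends with a Gaussian step: followed by one draw from \<open>mu\<close>
  it amounts to \<open>n + 1\<close> iterations of the sampler.\<close>

primrec kern :: "nat \<Rightarrow> point \<Rightarrow> point measure" where
  "kern 0 = (\<lambda>x. gauss.mu x)"
| "kern (Suc n) = (\<lambda>x. gauss.mu x \<bind> (\<lambda>y. mu y \<bind> kern n))"

lemma kern_kernel [measurable]: "kern n \<in> leb d \<rightarrow>\<^sub>M prob_algebra (leb d)"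
proof (induction n)
  case 0
  show ?case using gauss.mu_kernel by simp
next
  case (Suc n)
  show ?case unfolding kern.simps
    by (intro measurable_bind_prob_space[OF gauss.mu_kernel] measurable_bind_prob_space[OF mu_kernel] Suc)
qed

lemma integral_kern_Suc:
  assumes f: "bounded_meas d f"
  shows "(\<integral>z. f z \<partial>kern (Suc n) x) = (\<integral>y. \<integral>u. \<integral>z. f z \<partial>kern n u \<partial>mu y \<partial>gauss.mu x)"
proof -
  have "(\<integral>z. f z \<partial>kern (Suc n) x) = (\<integral>y. \<integral>z. f z \<partial>(mu y \<bind> kern n) \<partial>gauss.mu x)"
    unfolding kern.simps
    by (rule integral_bind_kernel[OF gauss.mu_prob_algebra measurable_bind_prob_space[OF mu_kernel kern_kernel] f])
  also have "(\<lambda>y. \<integral>z. f z \<partial>(mu y \<bind> kern n)) = (\<lambda>y. \<integral>u. \<integral>z. f z \<partial>kern n u \<partial>mu y)"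
    by (intro ext integral_bind_kernel[OF mu_prob_algebra kern_kernel f])
  finally show ?thesis .
qed

definition contraction where "contraction = 1 / (1 + \<alpha> * h)\<^sup>2"

text \<open>Two applications of the propagation step per iteration, one for \<open>mu\<close> and
  one for the Gaussian; since \<open>h * gauss.m = 1\<close> only the former contracts.\<close>

lemma kern_gradient_entropy_bound:
  assumes g: "bounded_pos d g"
  shows "gradient_entropy_bound d (2 / h * contraction ^ n) (\<lambda>x. \<integral>z. g z \<partial>kern n x) (\<lambda>x. \<integral>z. g z * ln (g z) \<partial>kern n x)"
proof (induction n)
  case 0
  have "2 / (h\<^sup>2 * gauss.m) = 2 / h" using h_pos by (simp add: gauss.m_def power2_eq_square)
  then show ?case using gauss.gradient_entropy_bound_base[OF g] by simp
next
  case (Suc n)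
  have gm: "bounded_meas d g" by (rule bounded_pos_meas[OF g])
  have gl: "bounded_meas d (\<lambda>z. g z * ln (g z))"
  proof -
    obtain \<delta> D where *: "0 < \<delta>" "\<delta> \<le> D" "\<And>x. x \<in> pts d \<Longrightarrow> \<delta> \<le> g x" "\<And>x. x \<in> pts d \<Longrightarrow> g x \<le> D"
      and gm [measurable]: "g \<in> borel_measurable (leb d)" using bounded_posE[OF g] by metis
    have "(\<lambda>z. g z * ln (g z)) \<in> borel_measurable (leb d)" by measurable
    moreover have "\<forall>x\<in>pts d. \<bar>g x * ln (g x)\<bar> \<le> D * (\<bar>ln \<delta>\<bar> + \<bar>ln D\<bar>)"
      using mult_ln_bounds[OF *(1) *(3) *(4)] by blast
    ultimately show ?thesis unfolding bounded_meas_def by blast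
  qed
  have 1: "2 / h * contraction ^ Suc n = 2 / h * contraction ^ n / (h * m)\<^sup>2 / (h * gauss.m)\<^sup>2"
  proof -
    have "h * m = 1 + \<alpha> * h" "h * gauss.m = 1" using h_pos by (auto simp: m_def gauss.m_def field_simps)
    then show ?thesis by (simp add: contraction_def)
  qed
  show ?case unfolding 1 integral_kern_Suc[OF gm] integral_kern_Suc[OF gl]
    by (rule gauss.gradient_entropy_bound_step[OF gradient_entropy_bound_step[OF Suc]])
qed

lemma kern_reverse_log_sobolev: "reverse_log_sobolev d (2 / h * contraction ^ n) (kern n)"
proof (rule reverse_log_sobolev.intro)
  have "1 + \<alpha> * h > 0" using \<alpha>_nonneg h_pos by (simp add: add_pos_nonneg)
  then show "0 < 2 / h * contraction ^ n" using h_pos by (simp add: contraction_def)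
  show "prob_space (kern n x)" "sets (kern n x) = sets (leb d)" if x: "x \<in> pts d" for x
    using prob_algebraD[OF kernelD[OF kern_kernel x]] by auto
qed (rule kern_gradient_entropy_bound)

text \<open>The kernel grows at the front while the law of the sampler grows at the end; this lemma
  reconciles the two orders of composition.\<close>

lemma kern_commute:
  assumes f: "bounded_meas d f"
  shows "(\<integral>u. \<integral>y. \<integral>z. f z \<partial>gauss.mu y \<partial>mu u \<partial>kern n x) = (\<integral>z. f z \<partial>kern (Suc n) x)"
proof (induction n arbitrary: x)
  case 0
  show ?case unfolding integral_kern_Suc[OF f] kern.simps(1) ..
next
  case (Suc n)
  have "bounded_meas d (\<lambda>u. \<integral>y. \<integral>z. f z \<partial>gauss.mu y \<partial>mu u)"
    by (intro bounded_meas_kernel[OF mu_kernel] bounded_meas_kernel[OF gauss.mu_kernel] f)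
  then have "(\<integral>u. \<integral>y. \<integral>z. f z \<partial>gauss.mu y \<partial>mu u \<partial>kern (Suc n) x) =
    (\<integral>y'. \<integral>u'. \<integral>u. \<integral>y. \<integral>z. f z \<partial>gauss.mu y \<partial>mu u \<partial>kern n u' \<partial>mu y' \<partial>gauss.mu x)"
    by (rule integral_kern_Suc)
  also have "\<dots> = (\<integral>z. f z \<partial>kern (Suc (Suc n)) x)" unfolding Suc integral_kern_Suc[OF f, of "Suc n"] ..
  finally show ?case .
qed

lemma proximal_law_eq: "proximal_law d V h M (Suc k) = (proximal_law d V h M k \<bind> (\<lambda>x. gauss.mu x)) \<bind> (\<lambda>y. mu y)"
  by (simp add: gauss_mu)

lemma proximal_law_prob_algebra:
  assumes M: "M \<in> space (prob_algebra (leb d))"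
  shows "proximal_law d V h M k \<in> space (prob_algebra (leb d))"
proof (induction k)
  case (Suc k)
  then show ?case unfolding proximal_law_eq
    by (intro bind_prob_algebra gauss.mu_kernel mu_kernel)
qed (simp add: M)

lemma integral_proximal_law:
  assumes M: "M \<in> space (prob_algebra (leb d))" and f: "bounded_meas d f"
  shows "(\<integral>x. f x \<partial>proximal_law d V h M (Suc n)) = (\<integral>x. \<integral>y. \<integral>z. f z \<partial>mu y \<partial>kern n x \<partial>M)"
proof -
  have step: "(\<integral>x. f x \<partial>proximal_law d V h M (Suc k)) = (\<integral>x. \<integral>y. \<integral>z. f z \<partial>mu y \<partial>gauss.mu x \<partial>proximal_law d V h M k)"
    if f: "bounded_meas d f" for f k
  proof -
    note P = proximal_law_prob_algebra[OF M, of k]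
    show ?thesis unfolding proximal_law_eq
      using integral_bind_kernel[OF bind_prob_algebra[OF P gauss.mu_kernel] mu_kernel f]
        integral_bind_kernel[OF P gauss.mu_kernel bounded_meas_kernel[OF mu_kernel f]] by simp
  qed
  show ?thesis using f
  proof (induction n arbitrary: f)
    case 0
    show ?case using step[OF 0, of 0] by simp
  next
    case (Suc n)
    have bR: "bounded_meas d (\<lambda>y. \<integral>z. f z \<partial>mu y)" by (rule bounded_meas_kernel[OF mu_kernel Suc.prems])
    have "(\<integral>x. f x \<partial>proximal_law d V h M (Suc (Suc n))) =
      (\<integral>x. \<integral>y. \<integral>z. f z \<partial>mu y \<partial>gauss.mu x \<partial>proximal_law d V h M (Suc n))"
      by (rule step[OF Suc.prems])
    also have "\<dots> = (\<integral>x. \<integral>y. \<integral>z. \<integral>y'. \<integral>z'. f z' \<partial>mu y' \<partial>gauss.mu z \<partial>mu y \<partial>kern n x \<partial>M)"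
      by (rule Suc.IH[OF bounded_meas_kernel[OF gauss.mu_kernel bR]])
    also have "\<dots> = (\<integral>x. \<integral>y. \<integral>z. f z \<partial>mu y \<partial>kern (Suc n) x \<partial>M)"
      unfolding kern_commute[OF bR] ..
    finally show ?case .
  qed
qed

section \<open>The target measure and its invariance\<close>

definition zt where "zt = (\<integral>x. exp (- V x) \<partial>leb d)"
abbreviation "target \<equiv> gibbs d V"

lemma nn_integral_target: "(\<integral>\<^sup>+x. ennreal (exp (- V x)) \<partial>leb d) = ennreal zt"
  unfolding zt_def by (intro nn_integral_eq_integral integrable_target) auto

lemma zt_pos: "zt > 0"
proof (rule ccontr)
  assume "\<not> zt > 0"
  then have "(\<integral>\<^sup>+x. ennreal (exp (- V x)) \<partial>leb d) = 0" by (simp add: nn_integral_target ennreal_neg)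
  then have "AE x in leb d. ennreal (exp (- V x)) = 0"
    by (subst (asm) nn_integral_0_iff_AE) auto
  then have "AE x in leb d. False" by simp
  then show False using leb_not_null by (auto simp: AE_iff_measurable[OF _ refl])
qed

lemma nn_integral_gibbs:
  assumes [measurable]: "f \<in> borel_measurable (leb d)"
  shows "(\<integral>\<^sup>+x. f x \<partial>target) = (\<integral>\<^sup>+x. ennreal (exp (- V x)) * f x \<partial>leb d) / ennreal zt"
proof -
  have "(\<integral>\<^sup>+x. f x \<partial>target) = (\<integral>\<^sup>+x. ennreal (exp (- V x)) / ennreal zt * f x \<partial>leb d)"
    unfolding gibbs_def nn_integral_target by (intro nn_integral_density) measurable
  also have "\<dots> = (\<integral>\<^sup>+x. ennreal (exp (- V x)) * f x / ennreal zt \<partial>leb d)"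
    by (intro nn_integral_cong) (simp add: ennreal_times_divide mult.commute)
  also have "\<dots> = (\<integral>\<^sup>+x. ennreal (exp (- V x)) * f x \<partial>leb d) / ennreal zt"
    by (intro nn_integral_divide) measurable
  finally show ?thesis .
qed

lemma target_prob_algebra: "target \<in> space (prob_algebra (leb d))"
proof -
  have "emeasure target (space target) = (\<integral>\<^sup>+x. 1 \<partial>target)" by simp
  also have "\<dots> = 1" using zt_pos by (subst nn_integral_gibbs) (auto simp: nn_integral_target divide_ennreal)
  finally show ?thesis by (auto simp: space_prob_algebra gibbs_def intro!: prob_spaceI)
qed

text \<open>Both half steps sample conditionals of the joint density proportional to
  \<open>exp (- V x - |x - y|^2 / (2 * h))\<close>, whose first marginal is the target. In integrals
  this is Tonelli's theorem used twice.\<close>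

lemma target_invariant: "(target \<bind> (\<lambda>x. gauss.mu x)) \<bind> (\<lambda>y. mu y) = target"
proof (rule measure_eqI)
  interpret product_sigma_finite "\<lambda>_::nat. lborel :: real measure" by standard
  interpret L: sigma_finite_measure "leb d" by (rule sigma_finite) auto
  interpret LL: pair_sigma_finite "leb d" "leb d" by unfold_locales
  note G = bind_prob_algebra[OF target_prob_algebra gauss.mu_kernel]
  show s: "sets ((target \<bind> (\<lambda>x. gauss.mu x)) \<bind> (\<lambda>y. mu y)) = sets target"
    using prob_algebraD(2)[OF bind_prob_algebra[OF G mu_kernel]] by (simp add: gibbs_def)
  fix A assume "A \<in> sets ((target \<bind> (\<lambda>x. gauss.mu x)) \<bind> (\<lambda>y. mu y))"
  then have A [measurable]: "A \<in> sets (leb d)" using s by (simp add: gibbs_def)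
  define c where "c = gauss.z undefined"
  \<comment> \<open>The Gaussian mass does not depend on the centre, so it leaves the integrals as
    one constant.\<close>
  have cz: "gauss.z y = c" for y
  proof -
    have "ennreal (gauss.z y) = ennreal ((2 * pi * h) powr (real d / 2))" for y
      using nn_integral_gauss_leb[OF h_pos, of d y] unfolding gauss.nn_integral_exp_U[symmetric]
        by (simp add: regularized_def)
    then show ?thesis unfolding c_def by (metis ennreal_eq_0_iff ennreal_inj gauss.z_pos less_imp_le)
  qed
  have cp: "c > 0" unfolding c_def by (rule gauss.z_pos)
  define k where "k x y = ennreal (exp (- (edist d x y)\<^sup>2 / (2 * h)))" for x y
  have [measurable]: "(\<lambda>(x, y). k x y) \<in> borel_measurable (leb d \<Otimes>\<^sub>M leb d)" unfolding k_def by measurable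
  have k_int: "(\<integral>\<^sup>+y. k x y \<partial>leb d) = ennreal c" for x
    using gauss.nn_integral_exp_U[of x] by (simp add: cz k_def regularized_def edist_commute)
  have Ue: "ennreal (exp (- U y x)) = ennreal (exp (- V x)) * k x y" for x y
    by (simp add: k_def regularized_def exp_add[symmetric] ennreal_mult[symmetric])
  have kU: "ennreal (exp (- gauss.U x y)) = k x y" for x y
    by (simp add: k_def regularized_def edist_commute)
  let ?r = "\<lambda>y. emeasure (mu y) A"
  have r: "?r y = (\<integral>\<^sup>+x. ennreal (exp (- V x)) * k x y * indicator A x \<partial>leb d) / ennreal (z y)" for y
    using nn_integral_mu[of "indicator A" y] by (simp add: Ue)
  have rm [measurable]: "?r \<in> borel_measurable (leb d)"
    using measurable_compose[OF measurable_prob_algebraD[OF mu_kernel] measurable_emeasure_subprob_algebra[OF A]] .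
  have zy: "ennreal (z y) = (\<integral>\<^sup>+x. ennreal (exp (- V x)) * k x y \<partial>leb d)" for y
    unfolding nn_integral_exp_U[symmetric] Ue ..
  have "emeasure ((target \<bind> (\<lambda>x. gauss.mu x)) \<bind> (\<lambda>y. mu y)) A = (\<integral>\<^sup>+y. ?r y \<partial>(target \<bind> (\<lambda>x. gauss.mu x)))"
    by (rule emeasure_bind_prob_algebra[OF G mu_kernel A])
  also have "\<dots> = (\<integral>\<^sup>+x. \<integral>\<^sup>+y. ?r y \<partial>gauss.mu x \<partial>target)"
    by (rule nn_integral_bind[OF rm])
      (use measurable_prob_algebraD[OF gauss.mu_kernel] in \<open>simp add: measurable_cong_sets[OF
        prob_algebraD(2)[OF target_prob_algebra] refl]\<close>)
  also have "\<dots> = (\<integral>\<^sup>+x. (\<integral>\<^sup>+y. k x y * ?r y \<partial>leb d) / ennreal c \<partial>target)"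
    unfolding gauss.nn_integral_mu[OF rm] kU cz ..
  also have "\<dots> = (\<integral>\<^sup>+x. ennreal (exp (- V x)) * ((\<integral>\<^sup>+y. k x y * ?r y \<partial>leb d) / ennreal c) \<partial>leb d) / ennreal zt"
    by (rule nn_integral_gibbs) measurable
  also have "(\<integral>\<^sup>+x. ennreal (exp (- V x)) * ((\<integral>\<^sup>+y. k x y * ?r y \<partial>leb d) / ennreal c) \<partial>leb d)
     = (\<integral>\<^sup>+x. (\<integral>\<^sup>+y. ennreal (exp (- V x)) * k x y * ?r y \<partial>leb d) \<partial>leb d) / ennreal c"
    by (subst nn_integral_divide[symmetric])
      (auto simp: ennreal_times_divide nn_integral_cmult[symmetric] mult.assoc intro!: nn_integral_cong)
  also have "(\<integral>\<^sup>+x. (\<integral>\<^sup>+y. ennreal (exp (- V x)) * k x y * ?r y \<partial>leb d) \<partial>leb d)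
     = (\<integral>\<^sup>+y. (\<integral>\<^sup>+x. ennreal (exp (- V x)) * k x y * ?r y \<partial>leb d) \<partial>leb d)"
    by (subst LL.Fubini') measurable
  also have "\<dots> = (\<integral>\<^sup>+y. ennreal (z y) * ?r y \<partial>leb d)"
    unfolding zy by (intro nn_integral_cong nn_integral_multc) measurable
  also have "\<dots> = (\<integral>\<^sup>+y. (\<integral>\<^sup>+x. ennreal (exp (- V x)) * k x y * indicator A x \<partial>leb d) \<partial>leb d)"
  proof (rule nn_integral_cong)
    fix y
    show "ennreal (z y) * ?r y = (\<integral>\<^sup>+x. ennreal (exp (- V x)) * k x y * indicator A x \<partial>leb d)"
      unfolding r by (rule ennreal_mult_divide_cancel[OF z_pos])
  qed
  also have "\<dots> = (\<integral>\<^sup>+x. (\<integral>\<^sup>+y. ennreal (exp (- V x)) * k x y * indicator A x \<partial>leb d) \<partial>leb d)"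
    by (subst LL.Fubini') measurable
  also have "\<dots> = (\<integral>\<^sup>+x. (ennreal (exp (- V x)) * indicator A x) * ennreal c \<partial>leb d)"
  proof (rule nn_integral_cong)
    fix x assume [measurable]: "x \<in> space (leb d)"
    have "(\<integral>\<^sup>+y. ennreal (exp (- V x)) * k x y * indicator A x \<partial>leb d) =
      (\<integral>\<^sup>+y. (ennreal (exp (- V x)) * indicator A x) * k x y \<partial>leb d)"
      by (intro nn_integral_cong) (simp add: mult_ac)
    also have "\<dots> = (ennreal (exp (- V x)) * indicator A x) * ennreal c"
      unfolding k_int[symmetric, of x] by (intro nn_integral_cmult) measurable
    finally show "(\<integral>\<^sup>+y. ennreal (exp (- V x)) * k x y * indicator A x \<partial>leb d) =
      (ennreal (exp (- V x)) * indicator A x) * ennreal c" .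
  qed
  also have "\<dots> = (\<integral>\<^sup>+x. ennreal (exp (- V x)) * indicator A x \<partial>leb d) * ennreal c"
    by (intro nn_integral_multc) measurable
  also have "\<dots> / ennreal c = (\<integral>\<^sup>+x. ennreal (exp (- V x)) * indicator A x \<partial>leb d)"
    using cp by (simp add: mult_divide_eq_ennreal)
  also have "\<dots> / ennreal zt = emeasure target A"
    using nn_integral_gibbs[of "indicator A"] by (simp add: gibbs_def)
  finally show "emeasure ((target \<bind> (\<lambda>x. gauss.mu x)) \<bind> (\<lambda>y. mu y)) A = emeasure target A" .
qed

lemma proximal_law_target: "proximal_law d V h target k = target"
proof (induction k)
  case (Suc k)
  show ?case unfolding proximal_law_eq Suc by (rule target_invariant)
qed simp

text \<open>Jensen's inequality for the power \<open>p\<close>, from the weighted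
  arithmetic-geometric mean of \<open>A powr p\<close> and \<open>f x powr p\<close> with weights
  \<open>1 - 1 / p\<close> and \<open>1 / p\<close>.\<close>

lemma integral_powr_ge:
  assumes f: "bounded_pos d f" and p: "1 < p"
  shows "(\<integral>x. f x \<partial>mu y) powr p \<le> (\<integral>x. f x powr p \<partial>mu y)"
proof -
  interpret prob_space "mu y" by (rule prob_space_mu)
  define A where "A = (\<integral>x. f x \<partial>mu y)"
  obtain \<delta> D where *: "0 < \<delta>" "\<delta> \<le> D" "\<And>x. x \<in> pts d \<Longrightarrow> \<delta> \<le> f x" "\<And>x. x \<in> pts d \<Longrightarrow> f x \<le> D"
    and fm [measurable]: "f \<in> borel_measurable (leb d)" using bounded_posE[OF f] by metis
  have A: "A > 0" using integral_bounds(2)[OF fm *(3,4), of y] *(1) by (simp add: A_def)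
  have i: "integrable (mu y) f" by (rule integral_bounds(1)[OF fm *(3,4)])
  have ip: "integrable (mu y) (\<lambda>x. f x powr p)"
    using integrable_bounded_meas[OF mu_prob_algebra bounded_pos_meas[OF bounded_pos_powr[OF f]]] p by simp
  have "(\<integral>x. A powr (p - 1) * f x \<partial>mu y) \<le> (\<integral>x. (1 - 1 / p) * A powr p + 1 / p * f x powr p \<partial>mu y)"
  proof (rule integral_mono)
    fix x assume "x \<in> space (mu y)"
    then have fx: "f x > 0" using *(1) *(3)[of x] by auto
    have "(A powr p) powr (1 - 1 / p) * (f x powr p) powr (1 / p) \<le> (1 - 1 / p) * A powr p + 1 / p * f x powr p"
      using A fx p by (intro young_weighted) auto
    moreover have "p * (1 - 1 / p) = p - 1" using p by (simp add: right_diff_distrib)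
    ultimately show "A powr (p - 1) * f x \<le> (1 - 1 / p) * A powr p + 1 / p * f x powr p"
      using A fx p by (simp add: powr_powr)
  qed (use i ip in auto)
  also have "\<dots> = (1 - 1 / p) * A powr p + 1 / p * (\<integral>x. f x powr p \<partial>mu y)" using ip by simp
  also have "(\<integral>x. A powr (p - 1) * f x \<partial>mu y) = A powr (p - 1) * A" by (simp add: A_def)
  also have "A powr (p - 1) * A = A powr p" using A by (simp add: powr_diff)
  finally have "1 / p * A powr p \<le> 1 / p * (\<integral>x. f x powr p \<partial>mu y)" by (simp add: left_diff_distrib)
  then show ?thesis using p by (simp add: A_def divide_le_cancel)
qed

text \<open>In the Harnack inequality from \<open>x0\<close> to \<open>y\<close>, the exponential is
  moved to the left and \<open>y\<close> is averaged over the target. By invariance the right side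
  becomes the target integral of \<open>f powr p\<close>; on the left, Jensen replaces the averaged
  Gaussian weight by \<open>exp\<close> of its mean exponent.\<close>

theorem renyi_proximal_law:
  assumes x0: "x0 \<in> pts d" and q: "1 < q" and M2: "integrable target (\<lambda>x. (edist d x0 x)\<^sup>2)"
  shows "renyi q (proximal_law d V h (return (leb d) x0) (Suc n)) target
    \<le> ereal (q * contraction ^ n / (2 * h) * (\<integral>x. (edist d x0 x)\<^sup>2 \<partial>target))"
proof -
  define p where "p = q / (q - 1)"
  have p: "1 < p" using q by (simp add: p_def)
  define M where "M = (\<integral>x. (edist d x0 x)\<^sup>2 \<partial>target)"
  define \<beta> where "\<beta> = q * contraction ^ n / (2 * h)"
  interpret K: reverse_log_sobolev d "2 / h * contraction ^ n" "kern n" by (rule kern_reverse_log_sobolev)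
  interpret T: prob_space target using prob_algebraD(1)[OF target_prob_algebra] .
  have ct: "0 \<le> contraction" by (simp add: contraction_def)
  have \<beta>: "0 \<le> \<beta>" using q h_pos ct by (simp add: \<beta>_def)
  have x0': "x0 \<in> space (leb d)" unfolding space_leb by (rule x0)
  have r: "return (leb d) x0 \<in> space (prob_algebra (leb d))"
    using prob_space_return[OF x0'] by (simp add: space_prob_algebra)
  note L = proximal_law_prob_algebra[OF r, of "Suc n"]
  have tsets: "sets target = sets (leb d)" by (simp add: gibbs_def)
  have tsp: "space target = pts d" using sets_eq_imp_space_eq[OF tsets] by (simp add: space_leb)
  \<comment> \<open>The conjugate exponent satisfies \<open>p / (p - 1) = q\<close>, which is how
    \<open>q\<close> enters linearly.\<close>
  have p4: "p * (2 / h * contraction ^ n) * t / (4 * (p - 1)) = \<beta> * t" for t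
  proof -
    have "p / (p - 1) = q" using q by (simp add: p_def field_simps)
    moreover have "p * (2 / h * contraction ^ n) * t / (4 * (p - 1)) = p / (p - 1) * contraction ^ n / (2 * h) * t"
      using p h_pos by (simp add: field_simps)
    ultimately show ?thesis by (simp add: \<beta>_def)
  qed
  have "renyi q (proximal_law d V h (return (leb d) x0) (Suc n)) target \<le> ereal (\<beta> * M)"
  proof (rule renyi_le[OF _ _ _ q p_def])
    show "prob_space (proximal_law d V h (return (leb d) x0) (Suc n))" by (rule prob_algebraD(1)[OF L])
    show "prob_space target" by unfold_locales
    show "sets (proximal_law d V h (return (leb d) x0) (Suc n)) = sets target" unfolding tsets
      by (rule prob_algebraD(2)[OF L])
    have "0 \<le> M" unfolding M_def by (intro integral_nonneg_AE AE_I2) simp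
    then show "0 \<le> \<beta> * M" using \<beta> by simp
    fix f :: "point \<Rightarrow> real" and \<delta> D assume fm: "f \<in> borel_measurable target" and fb: "0 < \<delta>" "\<And>x. x \<in>
      space target \<Longrightarrow> \<delta> \<le> f x" "\<And>x. x \<in> space target \<Longrightarrow> f x \<le> D"
    have fm' [measurable]: "f \<in> borel_measurable (leb d)" using fm by (simp add: measurable_cong_sets[OF tsets refl])
    have f: "bounded_pos d f" by (rule bounded_posI[OF fm' fb(1)]) (use fb tsp in auto)
    have fp: "bounded_pos d (\<lambda>x. f x powr p)" by (rule bounded_pos_powr[OF f]) (use p in simp)
    \<comment> \<open>The final draw from \<open>mu\<close> is made part of the test function, since
      the Harnack inequality concerns \<open>kern n\<close>, which stops one half step earlier;
      Jensen pushes the power \<open>p\<close> through that draw.\<close>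
    define u where "u y = (\<integral>z. f z \<partial>mu y)" for y
    have u: "bounded_pos d u" unfolding u_def by (rule bounded_pos_mu[OF f])
    define S where "S y = (\<integral>x. \<integral>z. f z powr p \<partial>mu x \<partial>kern n y)" for y
    define \<Phi> where "\<Phi> = (\<integral>y. u y \<partial>kern n x0)"
    have S: "bounded_meas d S" unfolding S_def
      by (intro bounded_meas_kernel[OF kern_kernel] bounded_meas_kernel[OF mu_kernel] bounded_pos_meas[OF fp])
    have Seq: "(\<integral>y. S y \<partial>target) = (\<integral>x. f x powr p \<partial>target)"
      unfolding S_def using integral_proximal_law[OF target_prob_algebra bounded_pos_meas[OF fp], of n]
      unfolding proximal_law_target ..
    have e: "(\<integral>x. f x \<partial>proximal_law d V h (return (leb d) x0) (Suc n)) = \<Phi>"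
    proof -
      have "bounded_meas d (\<lambda>x. \<integral>y. \<integral>z. f z \<partial>mu y \<partial>kern n x)"
        by (intro bounded_meas_kernel[OF kern_kernel] bounded_meas_kernel[OF mu_kernel] bounded_pos_meas[OF f])
      then have "(\<lambda>x. \<integral>y. \<integral>z. f z \<partial>mu y \<partial>kern n x) \<in> borel_measurable (leb d)" by (simp add: bounded_meas_def)
      then show ?thesis
        using integral_proximal_law[OF r bounded_pos_meas[OF f], of n] x0
        by (simp add: integral_return space_leb \<Phi>_def u_def)
    qed
    have \<Phi>S: "\<Phi> powr p * exp (- (\<beta> * (edist d x0 y)\<^sup>2)) \<le> S y" if y: "y \<in> pts d" for y
    proof -
      have "\<Phi> powr p \<le> (\<integral>z. u z powr p \<partial>kern n y) * exp (\<beta> * (edist d x0 y)\<^sup>2)"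
        using K.harnack[OF u p x0 y] unfolding p4 \<Phi>_def .
      also have "\<dots> \<le> S y * exp (\<beta> * (edist d x0 y)\<^sup>2)"
      proof (intro mult_right_mono)
        note ky = kernelD[OF kern_kernel y, of n]
        show "(\<integral>z. u z powr p \<partial>kern n y) \<le> S y" unfolding S_def
        proof (rule integral_mono)
          show "integrable (kern n y) (\<lambda>z. u z powr p)"
            using bounded_pos_powr[OF u] p by (intro integrable_bounded_meas[OF ky] bounded_pos_meas) auto
          show "integrable (kern n y) (\<lambda>x. \<integral>z. f z powr p \<partial>mu x)"
            by (intro integrable_bounded_meas[OF ky] bounded_meas_kernel[OF mu_kernel] bounded_pos_meas[OF fp])
          show "u z powr p \<le> (\<integral>z. f z powr p \<partial>mu z)" for z unfolding u_def by (rule integral_powr_ge[OF f p])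
        qed
      qed simp
      finally have "\<Phi> powr p * exp (- (\<beta> * (edist d x0 y)\<^sup>2)) \<le>
        S y * exp (\<beta> * (edist d x0 y)\<^sup>2) * exp (- (\<beta> * (edist d x0 y)\<^sup>2))"
        by (rule mult_right_mono) simp
      then show ?thesis by (simp add: mult.assoc exp_add[symmetric])
    qed
    \<comment> \<open>The tangent of exp at the mean exponent \<open>- (\<beta> * M)\<close>. It is
      affine in the squared distance, so integrating it uses only the second moment.\<close>
    have \<Phi>T: "\<Phi> powr p * (exp (- (\<beta> * M)) * (1 + \<beta> * M - \<beta> * (edist d x0 y)\<^sup>2)) \<le> S y" if y: "y \<in> pts d" for y
    proof -
      have "exp (- (\<beta> * M)) * (1 + (\<beta> * M - \<beta> * (edist d x0 y)\<^sup>2)) \<le>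
        exp (- (\<beta> * M)) * exp (\<beta> * M - \<beta> * (edist d x0 y)\<^sup>2)"
        by (intro mult_left_mono exp_ge_add_one_self) simp
      also have "\<dots> = exp (- (\<beta> * (edist d x0 y)\<^sup>2))" by (simp add: exp_add[symmetric])
      finally have "\<Phi> powr p * (exp (- (\<beta> * M)) * (1 + \<beta> * M - \<beta> * (edist d x0 y)\<^sup>2)) \<le>
        \<Phi> powr p * exp (- (\<beta> * (edist d x0 y)\<^sup>2))"
        by (intro mult_left_mono) (auto simp: algebra_simps)
      with \<Phi>S[OF y] show ?thesis by linarith
    qed
    have "(\<integral>y. \<Phi> powr p * (exp (- (\<beta> * M)) * (1 + \<beta> * M - \<beta> * (edist d x0 y)\<^sup>2)) \<partial>target) \<le> (\<integral>y. S y \<partial>target)"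
      using M2 integrable_bounded_meas[OF target_prob_algebra S] \<Phi>T tsp by (intro integral_mono) auto
    also have "(\<integral>y. \<Phi> powr p * (exp (- (\<beta> * M)) * (1 + \<beta> * M - \<beta> * (edist d x0 y)\<^sup>2)) \<partial>target) =
      \<Phi> powr p * exp (- (\<beta> * M))"
      using M2 T.prob_space by (simp add: M_def)
    finally have "\<Phi> powr p * exp (- (\<beta> * M)) * exp (\<beta> * M) \<le> (\<integral>x. f x powr p \<partial>target) * exp (\<beta> * M)"
      unfolding Seq by (rule mult_right_mono) simp
    then show "(\<integral>x. f x \<partial>proximal_law d V h (return (leb d) x0) (Suc n)) powr p \<le>
      (\<integral>x. f x powr p \<partial>target) * exp (\<beta> * M)"
      unfolding e by (simp add: mult.assoc exp_add[symmetric])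
  qed
  then show ?thesis by (simp add: \<beta>_def M_def)
qed

end

section \<open>Strongly convex and smooth potentials\<close>

definition edist_cont :: "nat \<Rightarrow> (point \<Rightarrow> real) \<Rightarrow> bool" where
  "edist_cont d F \<longleftrightarrow> (\<forall>x\<in>pts d. \<forall>e>0. \<exists>\<delta>>0. \<forall>z\<in>pts d. edist d z x < \<delta> \<longrightarrow> \<bar>F z - F x\<bar> < e)"

lemma edist_triangle: "edist d x z \<le> edist d x y + edist d y z"
proof -
  have "edist d x z = L2_set (\<lambda>i. (x i - y i) + (y i - z i)) {..<d}" by (simp add: edist_def)
  also have "\<dots> \<le> edist d x y + edist d y z" unfolding edist_def by (rule L2_set_triangle_ineq)
  finally show ?thesis .
qed

lemma abs_coord_le_edist: "i < d \<Longrightarrow> \<bar>x i - y i\<bar> \<le> edist d x y"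
proof (rule power2_le_imp_le)
  assume "i < d"
  then show "\<bar>x i - y i\<bar>\<^sup>2 \<le> (edist d x y)\<^sup>2"
    unfolding edist_sq by (auto intro: member_le_sum[of i "{..<d}" "\<lambda>i. (x i - y i)\<^sup>2"])
qed simp

text \<open>Restricting to the first \<open>d\<close> coordinates turns Euclidean continuity on
  \<open>pts d\<close> into continuity for the product topology of the whole function type, which
  opens the way to Borel measurability and to Tychonoff's theorem.\<close>

lemma edist_cont_continuous:
  assumes "edist_cont d F"
  shows "continuous_on UNIV (\<lambda>f. F (\<lambda>i\<in>{..<d}. f i))"
proof -
  have "((\<lambda>f. F (\<lambda>i\<in>{..<d}. f i)) \<longlongrightarrow> F (\<lambda>i\<in>{..<d}. x i)) (at x)" for x :: point
  proof (rule tendstoI)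
    fix e :: real assume e: "e > 0"
    let ?r = "\<lambda>f :: point. \<lambda>i\<in>{..<d}. f i"
    have er: "edist d (?r f) (?r x) = edist d f x" for f by (simp add: edist_def L2_set_def)
    obtain \<delta> where \<delta>: "\<delta> > 0" "\<And>z. z \<in> pts d \<Longrightarrow> edist d z (?r x) < \<delta> \<Longrightarrow> \<bar>F z - F (?r x)\<bar> < e"
      using assms[unfolded edist_cont_def, rule_format, OF comb_pts e] by blast
    have "continuous_on UNIV (\<lambda>f. edist d f x)"
      unfolding edist_def L2_set_def by (intro continuous_intros continuous_on_product_coordinates)
    then have "((\<lambda>f. edist d f x) \<longlongrightarrow> edist d x x) (at x)"
      by (auto simp: continuous_on_def)
    moreover have "edist d x x = 0" by (simp add: edist_def L2_set_def)
    ultimately have "\<forall>\<^sub>F f in at x. edist d f x < \<delta>" using \<delta>(1) by (auto intro: order_tendstoD)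
    then show "\<forall>\<^sub>F f in at x. dist (F (?r f)) (F (?r x)) < e"
      by eventually_elim (use \<delta>(2)[OF comb_pts] in \<open>simp add: dist_real_def er\<close>)
  qed
  then show ?thesis by (simp add: continuous_on_def)
qed

lemma edist_cont_measurable:
  assumes "edist_cont d F"
  shows "F \<in> borel_measurable (leb d)"
proof -
  have "(\<lambda>x. x) \<in> leb d \<rightarrow>\<^sub>M borel"
  proof (rule measurable_coordinatewise_then_product)
    fix i :: nat
    show "(\<lambda>x. x i) \<in> borel_measurable (leb d)"
    proof (cases "i < d")
      case False
      then have "(\<lambda>x. x i) \<in> borel_measurable (leb d) \<longleftrightarrow> (\<lambda>_. undefined :: real) \<in> borel_measurable (leb d)"
        by (intro measurable_cong) (auto simp: space_leb PiE_def extensional_def)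
      then show ?thesis by simp
    qed simp
  qed
  from measurable_compose[OF this borel_measurable_continuous_onI[OF edist_cont_continuous[OF assms]]]
  have "(\<lambda>x. F (\<lambda>i\<in>{..<d}. x i)) \<in> borel_measurable (leb d)" by simp
  moreover have "(\<lambda>x. F (\<lambda>i\<in>{..<d}. x i)) \<in> borel_measurable (leb d) \<longleftrightarrow> F \<in> borel_measurable (leb d)"
    by (intro measurable_cong) (auto simp: space_leb PiE_def extensional_restrict)
  ultimately show ?thesis by simp
qed

text \<open>Outside a large ball the values are no smaller than at \<open>x\<close>, so a minimum
  over a compact cube containing that ball is a global one.\<close>

lemma exists_minimizer:
  assumes F: "edist_cont d F" and x: "x \<in> pts d" and R: "\<And>z. z \<in> pts d \<Longrightarrow> R < edist d z x \<Longrightarrow> F x \<le> F z"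
  shows "\<exists>y\<in>pts d. \<forall>z\<in>pts d. F y \<le> F z"
proof -
  define R' where "R' = max R 0"
  \<comment> \<open>Coordinates beyond \<open>d\<close> are pinned to \<open>undefined\<close>, the
    value they have on \<open>pts d\<close>; the full product is then compact and consists of
    admissible points.\<close>
  define S where "S i = (if i < d then {x i - R'..x i + R'} else {undefined})" for i
  have "compactin (product_topology (\<lambda>_::nat. euclideanreal) UNIV) (PiE UNIV S)"
    unfolding compactin_PiE by (auto simp: S_def)
  then have cpt: "compact (PiE UNIV S)" by (simp add: euclidean_product_topology)
  have xS: "x \<in> PiE UNIV S" using x by (auto simp: S_def R'_def PiE_def extensional_def)
  have SP: "PiE UNIV S \<subseteq> pts d" by (auto simp: S_def PiE_def extensional_def Pi_def)
  have cont: "continuous_on (PiE UNIV S) F"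
  proof -
    have "continuous_on (PiE UNIV S) (\<lambda>f. F (\<lambda>i\<in>{..<d}. f i))"
      using continuous_on_subset[OF edist_cont_continuous[OF F]] by auto
    then show ?thesis
    proof (rule continuous_on_eq)
      fix f assume "f \<in> PiE UNIV S"
      then have "f \<in> pts d" using SP by auto
      then show "F (\<lambda>i\<in>{..<d}. f i) = F f" by (auto simp: PiE_def extensional_restrict)
    qed
  qed
  have "PiE UNIV S \<noteq> {}" using xS by blast
  from continuous_attains_inf[OF cpt this cont]
  obtain y where y: "y \<in> PiE UNIV S" "\<And>z. z \<in> PiE UNIV S \<Longrightarrow> F y \<le> F z" by blast
  have "F y \<le> F z" if z: "z \<in> pts d" for z
  proof (cases "z \<in> PiE UNIV S")
    case False
    then obtain i where zi: "z i \<notin> S i" by (auto simp: PiE_def)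
    have "i < d"
    proof (rule ccontr)
      assume "\<not> i < d"
      then show False using zi z PiE_arb[OF z, of i] by (simp add: S_def)
    qed
    moreover from this have "\<bar>z i - x i\<bar> > R'" using zi by (simp add: S_def abs_if not_le split: if_splits) linarith
    ultimately have i: "i < d" "\<bar>z i - x i\<bar> > R'" by auto
    then have "R < edist d z x" using abs_coord_le_edist[of i d z x] by (simp add: R'_def)
    then show ?thesis using R[OF z] y(2)[OF xS] by linarith
  qed (use y in auto)
  then show ?thesis using y(1) SP by blast
qed

definition line :: "nat \<Rightarrow> point \<Rightarrow> point \<Rightarrow> real \<Rightarrow> point" where
  "line d x z t = (\<lambda>i\<in>{..<d}. x i + t * (z i - x i))"

lemma line_pts [simp]: "line d x z t \<in> pts d"
  by (simp add: line_def)

lemma line_eq_comb: "line d x z t = (\<lambda>i\<in>{..<d}. (1 - t) * x i + t * z i)"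
  by (auto simp: line_def algebra_simps)

lemma line_0: "x \<in> pts d \<Longrightarrow> line d x z 0 = x"
  by (auto simp: line_def PiE_def extensional_def fun_eq_iff)

lemma line_1: "z \<in> pts d \<Longrightarrow> line d x z 1 = z"
  by (auto simp: line_def PiE_def extensional_def fun_eq_iff)

lemma edist_line: "edist d (line d x z s) (line d x z t) = \<bar>s - t\<bar> * edist d x z"
proof -
  have "(edist d (line d x z s) (line d x z t))\<^sup>2 = (\<bar>s - t\<bar> * edist d x z)\<^sup>2"
    unfolding edist_sq power_mult_distrib sum_distrib_left
    by (intro sum.cong refl) (simp add: line_def power2_eq_square algebra_simps)
  then show ?thesis by (simp add: power2_eq_iff_nonneg)
qed

text \<open>Quadratic growth at a minimizer: compare with the point at parameter \<open>t\<close> on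
  the segment to \<open>z\<close>, divide by \<open>t\<close> and let \<open>t\<close> tend to 0. No
  gradient is involved.\<close>

lemma strongly_convex_minimizer:
  assumes F: "strongly_convex d m F" and x: "x \<in> pts d" and min: "\<And>z. z \<in> pts d \<Longrightarrow> F x \<le> F z" and z: "z \<in> pts d"
  shows "F x + m / 2 * (edist d z x)\<^sup>2 \<le> F z"
proof -
  have le: "m / 2 * (1 - t) * (edist d z x)\<^sup>2 \<le> F z - F x" if t: "0 < t" "t \<le> 1" for t
  proof -
    have "F (\<lambda>i\<in>{..<d}. (1 - t) * x i + t * z i) \<le> (1 - t) * F x + t * F z - m / 2 * t * (1 - t) * (edist d x z)\<^sup>2"
      using F x z t unfolding strongly_convex_def by auto
    moreover have "F x \<le> F (\<lambda>i\<in>{..<d}. (1 - t) * x i + t * z i)" by (rule min) simp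
    ultimately have "t * (m / 2 * (1 - t) * (edist d z x)\<^sup>2) \<le> t * (F z - F x)"
      by (simp add: edist_commute[of d z x] algebra_simps)
    then show ?thesis using t by simp
  qed
  have "((\<lambda>t. m / 2 * (1 - t) * (edist d z x)\<^sup>2) \<longlongrightarrow> m / 2 * (1 - 0) * (edist d z x)\<^sup>2) (at_right 0)"
    by (intro tendsto_intros)
  then have "m / 2 * (1 - 0) * (edist d z x)\<^sup>2 \<le> F z - F x"
  proof (rule tendsto_upperbound)
    have "\<forall>\<^sub>F t in at_right (0::real). t < 1" by (rule order_tendstoD(2)[OF tendsto_ident_at]) simp
    moreover have "\<forall>\<^sub>F t in at_right (0::real). 0 < t" by (simp add: eventually_at_right_less)
    ultimately show "\<forall>\<^sub>F t in at_right 0. m / 2 * (1 - t) * (edist d z x)\<^sup>2 \<le> F z - F x"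
      by eventually_elim (rule le, auto)
  qed simp
  then show ?thesis by simp
qed

locale smooth_convex =
  fixes d :: nat and \<alpha> \<beta> :: real and V :: "point \<Rightarrow> real"
  assumes \<alpha>_pos: "0 < \<alpha>" and \<beta>_pos: "0 < \<beta>"
    and str: "strongly_convex d \<alpha> V" and sm: "smooth d \<beta> V"
begin

definition G where "G = (SOME g. (\<forall>x\<in>pts d. has_gradient d V (g x) x) \<and>
          (\<forall>x\<in>pts d. \<forall>y\<in>pts d. edist d (g x) (g y) \<le> \<beta> * edist d x y))"

lemma G: "x \<in> pts d \<Longrightarrow> has_gradient d V (G x) x"
  "x \<in> pts d \<Longrightarrow> y \<in> pts d \<Longrightarrow> edist d (G x) (G y) \<le> \<beta> * edist d x y"
proof -
  have "(\<forall>x\<in>pts d. has_gradient d V (G x) x) \<and> (\<forall>x\<in>pts d. \<forall>y\<in>pts d. edist d (G x) (G y) \<le> \<beta> * edist d x y)"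
    using someI_ex[OF sm[unfolded smooth_def]] unfolding G_def .
  then show "x \<in> pts d \<Longrightarrow> has_gradient d V (G x) x"
    "x \<in> pts d \<Longrightarrow> y \<in> pts d \<Longrightarrow> edist d (G x) (G y) \<le> \<beta> * edist d x y" by auto
qed

lemma sum_le_edist: "\<bar>\<Sum>i<d. u i * (z i - x i)\<bar> \<le> sqrt (ip d u u) * edist d z x"
proof (rule power2_le_imp_le)
  have "\<bar>\<Sum>i<d. u i * (z i - x i)\<bar>\<^sup>2 \<le> (\<Sum>i<d. (u i)\<^sup>2) * (\<Sum>i<d. (z i - x i)\<^sup>2)"
    by (simp add: Cauchy_Schwarz_ineq_sum)
  also have "\<dots> = (sqrt (ip d u u) * edist d z x)\<^sup>2"
    unfolding power_mult_distrib edist_sq by (simp add: ip_nonneg) (simp add: ip_def power2_eq_square)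
  finally show "\<bar>\<Sum>i<d. u i * (z i - x i)\<bar>\<^sup>2 \<le> (sqrt (ip d u u) * edist d z x)\<^sup>2" .
qed (simp add: ip_nonneg)

lemma V_cont: "edist_cont d V"
  unfolding edist_cont_def
proof (intro ballI allI impI)
  fix x e assume x: "x \<in> pts d" and e: "0 < (e::real)"
  obtain \<delta> where \<delta>: "\<delta> > 0" "\<And>z. z \<in> pts d \<Longrightarrow> edist d z x < \<delta> \<Longrightarrow> \<bar>V z - V x - (\<Sum>i<d. G x i * (z i - x i))\<bar> \<le>
    1 * edist d z x"
    using G(1)[OF x, unfolded has_gradient_def, rule_format, OF zero_less_one] by blast
  define K where "K = 1 + sqrt (ip d (G x) (G x))"
  have K: "K > 0" by (simp add: K_def ip_nonneg add_pos_nonneg)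
  show "\<exists>\<delta>>0. \<forall>z\<in>pts d. edist d z x < \<delta> \<longrightarrow> \<bar>V z - V x\<bar> < e"
  proof (intro exI[of _ "min \<delta> (e / K)"] conjI ballI impI)
    show "0 < min \<delta> (e / K)" using \<delta> e K by simp
    fix z assume z: "z \<in> pts d" "edist d z x < min \<delta> (e / K)"
    have "\<bar>V z - V x\<bar> \<le> edist d z x + sqrt (ip d (G x) (G x)) * edist d z x"
      using \<delta>(2)[OF z(1)] z(2) sum_le_edist[of "G x" z x] by simp
    also have "\<dots> = K * edist d z x" by (simp add: K_def distrib_right)
    also have "\<dots> < K * (e / K)" using z(2) K by (intro mult_strict_left_mono) auto
    finally show "\<bar>V z - V x\<bar> < e" using K by simp
  qed
qed

lemma V_meas [measurable]: "V \<in> borel_measurable (leb d)"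
  by (rule edist_cont_measurable[OF V_cont])

lemma V_line_derivative:
  assumes "x \<in> pts d" "z \<in> pts d"
  shows "((\<lambda>t. V (line d x z t)) has_real_derivative (\<Sum>i<d. G (line d x z t) i * (z i - x i))) (at t)"
  unfolding has_field_derivative_iff
proof (rule tendstoI)
  define p where "p = (\<Sum>i<d. G (line d x z t) i * (z i - x i))"
  define r where "r = edist d x z"
  have r: "r \<ge> 0" by (simp add: r_def)
  fix e :: real assume e: "e > 0"
  have er: "0 < e / (2 * (r + 1))" using e r by simp
  obtain \<delta> where \<delta>: "\<delta> > 0" "\<And>u. u \<in> pts d \<Longrightarrow> edist d u (line d x z t) < \<delta> \<Longrightarrow>
      \<bar>V u - V (line d x z t) - (\<Sum>i<d. G (line d x z t) i * (u i - line d x z t i))\<bar> \<le>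
        e / (2 * (r + 1)) * edist d u (line d x z t)"
    using G(1)[OF line_pts[of d x z t], unfolded has_gradient_def, rule_format, OF er] by blast
  have "((\<lambda>s. \<bar>s\<bar> * r) \<longlongrightarrow> \<bar>0\<bar> * r) (at 0)" by (intro tendsto_intros)
  then have "\<forall>\<^sub>F s in at 0. \<bar>s\<bar> * r < \<delta>" by (rule order_tendstoD) (use \<delta> in simp)
  moreover have "\<forall>\<^sub>F s in at (0::real). s \<noteq> 0" by (simp add: eventually_at_filter)
  ultimately have "\<forall>\<^sub>F s in at 0. \<bar>(V (line d x z (t + s)) - V (line d x z t)) / s - p\<bar> < e"
  proof eventually_elim
    fix s assume s: "\<bar>s\<bar> * r < \<delta>" "s \<noteq> 0"
    have ed: "edist d (line d x z (t + s)) (line d x z t) = \<bar>s\<bar> * r" by (simp add: edist_line r_def)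
    have "(\<Sum>i<d. G (line d x z t) i * (line d x z (t + s) i - line d x z t i)) = s * p"
      unfolding p_def sum_distrib_left by (intro sum.cong refl) (simp add: line_def algebra_simps)
    then have "\<bar>V (line d x z (t + s)) - V (line d x z t) - s * p\<bar> \<le> e / (2 * (r + 1)) * (\<bar>s\<bar> * r)"
      using \<delta>(2)[of "line d x z (t + s)"] s(1) by (simp add: ed)
    also have "\<dots> = \<bar>s\<bar> * (e / 2 * (r / (r + 1)))" by simp
    also have "\<dots> < \<bar>s\<bar> * e"
    proof (rule mult_strict_left_mono)
      have "e / 2 * (r / (r + 1)) \<le> e / 2 * 1" using e r by (intro mult_left_mono) auto
      then show "e / 2 * (r / (r + 1)) < e" using e by linarith
    qed (use s in simp)
    finally have "\<bar>V (line d x z (t + s)) - V (line d x z t) - s * p\<bar> / \<bar>s\<bar> < e" using s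
      by (simp add: divide_less_eq mult.commute)
    moreover have "\<bar>V (line d x z (t + s)) - V (line d x z t) - s * p\<bar> / \<bar>s\<bar> =
      \<bar>(V (line d x z (t + s)) - V (line d x z t)) / s - p\<bar>"
      using s by (simp add: abs_divide[symmetric] diff_divide_distrib del: abs_divide)
    ultimately show "\<bar>(V (line d x z (t + s)) - V (line d x z t)) / s - p\<bar> < e" by simp
  qed
  then show "\<forall>\<^sub>F s in at t. dist ((V (line d x z s) - V (line d x z t)) / (s
    - t)) (\<Sum>i<d. G (line d x z t) i * (z i - x i)) < e"
    unfolding at_to_0[of t] eventually_filtermap by (simp add: p_def dist_real_def add.commute)
qed

text \<open>Along the segment, the potential minus its linear part and the quadratic bound has
  nonpositive derivative because the gradient is Lipschitz.\<close>

lemma descent: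
  assumes x: "x \<in> pts d" and z: "z \<in> pts d"
  shows "V z \<le> V x + (\<Sum>i<d. G x i * (z i - x i)) + \<beta> / 2 * (edist d z x)\<^sup>2"
proof -
  define p where "p t = (\<Sum>i<d. G (line d x z t) i * (z i - x i))" for t
  define r where "r = edist d x z"
  define \<psi> where "\<psi> t = V (line d x z t) - t * p 0 - \<beta> / 2 * t\<^sup>2 * r\<^sup>2" for t
  have "\<psi> 1 \<le> \<psi> 0"
  proof (rule DERIV_nonpos_imp_nonincreasing[of 0 1 \<psi>])
    fix t :: real assume t: "0 \<le> t" "t \<le> 1"
    have "(\<psi> has_real_derivative p t - p 0 - \<beta> * t * r\<^sup>2) (at t)"
      unfolding \<psi>_def p_def by (auto intro!: derivative_eq_intros V_line_derivative[OF x z])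
    moreover have "p t - p 0 - \<beta> * t * r\<^sup>2 \<le> 0"
    proof -
      have "p t - p 0 = (\<Sum>i<d. (G (line d x z t) i - G (line d x z 0) i) * (z i - x i))"
        by (simp add: p_def sum_subtractf left_diff_distrib)
      also have "\<dots> \<le> sqrt (ip d (\<lambda>i. G (line d x z t) i - G (line d x z 0) i) (\<lambda>i. G (line d x z t) i
        - G (line d x z 0) i)) * edist d z x"
        by (rule order_trans[OF abs_ge_self sum_le_edist])
      also have "\<dots> = edist d (G (line d x z t)) (G (line d x z 0)) * r"
        unfolding r_def edist_commute[of d z x] by (simp add: edist_def L2_set_def ip_def power2_eq_square)
      also have "\<dots> \<le> \<beta> * edist d (line d x z t) (line d x z 0) * r"
        by (intro mult_right_mono G(2)) (auto simp: r_def)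
      also have "\<dots> = \<beta> * t * r\<^sup>2" using t by (simp add: edist_line r_def power2_eq_square)
      finally show ?thesis by simp
    qed
    ultimately show "\<exists>y. (\<psi> has_real_derivative y) (at t) \<and> y \<le> 0" by blast
  qed simp
  then show ?thesis
    by (simp add: \<psi>_def p_def line_0[OF x] line_1[OF z] r_def edist_commute[of d z x])
qed

lemma V_lower:
  assumes x: "x \<in> pts d" and z: "z \<in> pts d"
  shows "V x + (\<Sum>i<d. G x i * (z i - x i)) + \<alpha> / 2 * (edist d z x)\<^sup>2 \<le> V z"
proof -
  have le: "(V (line d x z t) - V x) / t + \<alpha> / 2 * (1 - t) * (edist d z x)\<^sup>2 \<le> V z - V x" if t: "0 < t" "t \<le> 1" for t
  proof -
    have "V (line d x z t) \<le> (1 - t) * V x + t * V z - \<alpha> / 2 * t * (1 - t) * (edist d x z)\<^sup>2"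
      using str x z t unfolding strongly_convex_def line_eq_comb by auto
    then have "V (line d x z t) - V x \<le> t * (V z - V x - \<alpha> / 2 * (1 - t) * (edist d z x)\<^sup>2)"
      by (simp add: edist_commute[of d z x] algebra_simps)
    then have "(V (line d x z t) - V x) / t \<le> V z - V x - \<alpha> / 2 * (1 - t) * (edist d z x)\<^sup>2"
      using t by (simp add: divide_le_eq mult.commute)
    then show ?thesis by simp
  qed
  have "((\<lambda>t. (V (line d x z t) - V (line d x z 0)) / (t - 0)) \<longlongrightarrow> (\<Sum>i<d. G (line d x z 0) i * (z i - x i))) (at 0)"
    using V_line_derivative[OF x z, of 0] by (simp add: has_field_derivative_iff)
  then have "((\<lambda>t. (V (line d x z t) - V x) / t) \<longlongrightarrow> (\<Sum>i<d. G x i * (z i - x i))) (at_right 0)"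
    unfolding line_0[OF x] by (auto intro: tendsto_within_subset)
  then have "((\<lambda>t. (V (line d x z t) - V x) / t + \<alpha> / 2 * (1 - t) * (edist d z x)\<^sup>2) \<longlongrightarrow>
    (\<Sum>i<d. G x i * (z i - x i)) + \<alpha> / 2 * (1 - 0) * (edist d z x)\<^sup>2) (at_right 0)"
    by (intro tendsto_intros)
  then have "(\<Sum>i<d. G x i * (z i - x i)) + \<alpha> / 2 * (1 - 0) * (edist d z x)\<^sup>2 \<le> V z - V x"
  proof (rule tendsto_upperbound)
    have "\<forall>\<^sub>F t in at_right (0::real). t < 1" by (rule order_tendstoD(2)[OF tendsto_ident_at]) simp
    moreover have "\<forall>\<^sub>F t in at_right (0::real). 0 < t" by (simp add: eventually_at_right_less)
    ultimately show "\<forall>\<^sub>F t in at_right 0. (V (line d x z t) - V x) / t + \<alpha> / 2 * (1 - t) * (edist d z x)\<^sup>2 \<le> V z - V x"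
      by eventually_elim (rule le, auto)
  qed simp
  then show ?thesis by simp
qed

end

text \<open>Instead of proving that the gradient vanishes at a minimizer, the linear term is shown
  to be nonpositive in every direction: were it positive towards \<open>z\<close>, a small step away
  from \<open>z\<close> would go below the minimum.\<close>

lemma min_upper:
  fixes u :: point
  assumes x: "x \<in> pts d" and min: "\<And>z. z \<in> pts d \<Longrightarrow> F x \<le> F z" and K: "0 \<le> K"
    and up: "\<And>z. z \<in> pts d \<Longrightarrow> F z \<le> F x + (\<Sum>i<d. u i * (z i - x i)) + K / 2 * (edist d z x)\<^sup>2"
    and z: "z \<in> pts d"
  shows "F z \<le> F x + K / 2 * (edist d z x)\<^sup>2"
proof -
  define P where "P = (\<Sum>i<d. u i * (z i - x i))"
  define r where "r = (edist d z x)\<^sup>2"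
  have r: "0 \<le> r" by (simp add: r_def)
  have "P \<le> 0"
  proof (rule ccontr)
    assume "\<not> P \<le> 0"
    then have P: "P > 0" by simp
    \<comment> \<open>Small enough that the quadratic cost of the step is at most half of its linear
      gain; the \<open>+ 1\<close> keeps the quotient defined when \<open>K * r = 0\<close>.\<close>
    define t where "t = P / (K * r + 1)"
    have Kr: "K * r + 1 > 0" using K r by (simp add: add_nonneg_pos)
    have t: "t > 0" using P Kr by (simp add: t_def)
    have "F x \<le> F (line d x z (- t))" by (rule min) simp
    also have "\<dots> \<le> F x + (\<Sum>i<d. u i * (line d x z (- t) i - x i)) + K / 2 * (edist d (line d x z (- t)) x)\<^sup>2"
      by (rule up) simp
    also have "(\<Sum>i<d. u i * (line d x z (- t) i - x i)) = - t * P"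
      unfolding P_def sum_distrib_left by (intro sum.cong refl) (simp add: line_def)
    also have "edist d (line d x z (- t)) x = t * edist d z x"
      using edist_line[of d x z "- t" 0] t by (simp add: line_0[OF x] edist_commute[of d z x])
    finally have "t * P \<le> t * (t * (K * r) / 2)" by (simp add: power_mult_distrib r_def power2_eq_square mult_ac)
    then have "P \<le> t * (K * r) / 2" using t by simp
    also have "t * (K * r) \<le> t * (K * r + 1)" using t by simp
    also have "t * (K * r + 1) = P" using Kr by (simp add: t_def)
    finally show False using P by simp
  qed
  then show ?thesis using up[OF z] by (simp add: P_def)
qed

lemma edist_cont_regularized:
  assumes F: "edist_cont d F"
  shows "edist_cont d (regularized d F h y)"
  unfolding edist_cont_def
proof (intro ballI allI impI)
  fix x e assume x: "x \<in> pts d" and e: "0 < (e::real)"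
  obtain \<delta> where \<delta>: "\<delta> > 0" "\<And>z. z \<in> pts d \<Longrightarrow> edist d z x < \<delta> \<Longrightarrow> \<bar>F z - F x\<bar> < e / 2"
    using F[unfolded edist_cont_def, rule_format, OF x, of "e / 2"] e by auto
  define K where "K = (2 * edist d x y + 1) * (\<bar>1 / (2 * h)\<bar> + 1)"
  have K: "K > 0" unfolding K_def by (intro mult_pos_pos add_nonneg_pos) auto
  show "\<exists>\<delta>>0. \<forall>z\<in>pts d. edist d z x < \<delta> \<longrightarrow> \<bar>regularized d F h y z - regularized d F h y x\<bar> < e"
  proof (intro exI[of _ "min \<delta> (min 1 (e / (2 * K)))"] conjI ballI impI)
    show "0 < min \<delta> (min 1 (e / (2 * K)))" using \<delta> e K by simp
    fix z assume z: "z \<in> pts d" "edist d z x < min \<delta> (min 1 (e / (2 * K)))"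
    define s where "s = edist d z x"
    have s: "0 \<le> s" "s < \<delta>" "s < 1" "s < e / (2 * K)" using z by (auto simp: s_def)
    have ab: "\<bar>edist d z y - edist d x y\<bar> \<le> s"
      using edist_triangle[of d z y x] edist_triangle[of d x y z] edist_commute[of d x z] by (simp add: s_def)
    have "\<bar>(edist d z y)\<^sup>2 - (edist d x y)\<^sup>2\<bar> = \<bar>edist d z y - edist d x y\<bar> * (edist d z y + edist d x y)"
      by (simp add: power2_eq_square square_diff_square_factored abs_mult mult.commute)
    also have "\<dots> \<le> s * (2 * edist d x y + 1)" using ab s by (intro mult_mono) auto
    finally have sq: "\<bar>(edist d z y)\<^sup>2 - (edist d x y)\<^sup>2\<bar> \<le> s * (2 * edist d x y + 1)" .
    have "\<bar>(edist d z y)\<^sup>2 / (2 * h) - (edist d x y)\<^sup>2 / (2 * h)\<bar> = \<bar>(edist d z y)\<^sup>2 - (edist d x y)\<^sup>2\<bar> * \<bar>1 / (2 * h)\<bar>"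
      by (simp add: diff_divide_distrib[symmetric] abs_divide)
    also have "\<dots> \<le> s * (2 * edist d x y + 1) * (\<bar>1 / (2 * h)\<bar> + 1)"
      using sq s by (intro mult_mono) (auto simp: add_nonneg_nonneg)
    also have "\<dots> = s * K" by (simp add: K_def)
    also have "\<dots> < e / (2 * K) * K" using s K by (intro mult_strict_right_mono) auto
    finally have "\<bar>(edist d z y)\<^sup>2 / (2 * h) - (edist d x y)\<^sup>2 / (2 * h)\<bar> < e / 2" using K by simp
    moreover have "\<bar>F z - F x\<bar> < e / 2" using \<delta>(2)[OF z(1)] s by (simp add: s_def)
    ultimately show "\<bar>regularized d F h y z - regularized d F h y x\<bar> < e"
      unfolding regularized_def by linarith
  qed
qed

lemma arg_min_on_minimizer:
  fixes F :: "'a \<Rightarrow> real"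
  assumes "\<exists>x\<in>S. \<forall>z\<in>S. F x \<le> F z"
  shows "arg_min_on F S \<in> S" "z \<in> S \<Longrightarrow> F (arg_min_on F S) \<le> F z"
proof -
  have "is_arg_min F (\<lambda>x. x \<in> S) (arg_min_on F S)"
    unfolding arg_min_on_def arg_min_def by (rule someI_ex) (use assms in \<open>auto simp: is_arg_min_linorder\<close>)
  then show "arg_min_on F S \<in> S" "z \<in> S \<Longrightarrow> F (arg_min_on F S) \<le> F z"
    by (auto simp: is_arg_min_linorder)
qed

text \<open>The size \<open>s\<close> is chosen so that
  \<open>(|x| / \<alpha>)^2 / (1 + 2 * \<alpha> * s)\<close> is at most \<open>1 / \<alpha>\<close>.
  The added 1 keeps the step positive even when \<open>x\<close> is the origin.\<close>

definition start_step :: "nat \<Rightarrow> real \<Rightarrow> point \<Rightarrow> real" where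
  "start_step d \<alpha> x = (edist d x (\<lambda>i\<in>{..<d}. 0))\<^sup>2 / (2 * \<alpha>\<^sup>2) + 1"

section \<open>Minimizer, proximal map and warm start\<close>

context smooth_convex
begin

definition xmin where "xmin = arg_min_on V (pts d)"

lemma xmin: "xmin \<in> pts d" "z \<in> pts d \<Longrightarrow> V xmin \<le> V z"
proof -
  let ?o = "\<lambda>i\<in>{..<d}. 0 :: real"
  define g where "g = sqrt (ip d (G ?o) (G ?o))"
  have o: "?o \<in> pts d" by simp
  have "\<exists>x\<in>pts d. \<forall>z\<in>pts d. V x \<le> V z"
  proof (rule exists_minimizer[OF V_cont o])
    fix z assume z: "z \<in> pts d" and r: "2 * g / \<alpha> < edist d z ?o"
    have "V ?o + (\<Sum>i<d. G ?o i * (z i - ?o i)) + \<alpha> / 2 * (edist d z ?o)\<^sup>2 \<le> V z" by (rule V_lower[OF o z])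
    moreover have "- (g * edist d z ?o) \<le> (\<Sum>i<d. G ?o i * (z i - ?o i))"
      using sum_le_edist[of "G ?o" z ?o] unfolding g_def by linarith
    moreover have "g * edist d z ?o \<le> \<alpha> / 2 * (edist d z ?o)\<^sup>2"
    proof -
      have "g \<le> \<alpha> / 2 * edist d z ?o" using r \<alpha>_pos by (simp add: field_simps)
      then have "g * edist d z ?o \<le> \<alpha> / 2 * edist d z ?o * edist d z ?o" by (rule mult_right_mono) simp
      then show ?thesis by (simp add: power2_eq_square)
    qed
    ultimately show "V ?o \<le> V z" by linarith
  qed
  from arg_min_on_minimizer[OF this] show "xmin \<in> pts d" "z \<in> pts d \<Longrightarrow> V xmin \<le> V z"
    unfolding xmin_def by auto
qed

lemma V_ge: "z \<in> pts d \<Longrightarrow> V xmin + \<alpha> / 2 * (edist d z xmin)\<^sup>2 \<le> V z"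
  by (rule strongly_convex_minimizer[OF str xmin])

lemma V_le: "z \<in> pts d \<Longrightarrow> V z \<le> V xmin + \<beta> / 2 * (edist d z xmin)\<^sup>2"
  by (rule min_upper[OF xmin(1) xmin(2) _ descent[OF xmin(1)]]) (use \<beta>_pos in auto)

lemma potential: "0 < h \<Longrightarrow> potential d V \<alpha> h"
  by unfold_locales (use str \<alpha>_pos xmin(2) in auto)

abbreviation "prox \<equiv> prox_oracle d V"

lemma prox_min:
  assumes h: "0 < h" and y: "y \<in> pts d"
  shows "prox h y \<in> pts d" "z \<in> pts d \<Longrightarrow> regularized d V h y (prox h y) \<le> regularized d V h y z"
proof -
  have "\<exists>x\<in>pts d. \<forall>z\<in>pts d. regularized d V h y x \<le> regularized d V h y z"
  proof (rule exists_minimizer[OF edist_cont_regularized[OF V_cont] y])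
    \<comment> \<open>Beyond this radius the quadratic term exceeds the largest possible decrease of
      the potential from \<open>y\<close>.\<close>
    fix z assume z: "z \<in> pts d" and r: "sqrt (2 * h * (V y - V xmin)) < edist d z y"
    have "sqrt (2 * h * (V y - V xmin)) \<le> edist d z y" using r by simp
    then have "2 * h * (V y - V xmin) \<le> (edist d z y)\<^sup>2" by (simp add: sqrt_le_D)
    then have "V y - V xmin \<le> (edist d z y)\<^sup>2 / (2 * h)" using h by (simp add: field_simps)
    moreover have "edist d y y = 0" by (simp add: edist_def L2_set_def)
    ultimately show "regularized d V h y y \<le> regularized d V h y z"
      using xmin(2)[OF z] unfolding regularized_def by simp
  qed
  from arg_min_on_minimizer[OF this] show "prox h y \<in> pts d" "z \<in> pts d \<Longrightarrow> regularized d V h y (prox h y) \<le>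
    regularized d V h y z"
    unfolding prox_oracle_def using h by auto
qed

lemma prox_lower:
  assumes h: "0 < h" and y: "y \<in> pts d" and z: "z \<in> pts d"
  shows "regularized d V h y (prox h y) + (\<alpha> + 1 / h) / 2 * (edist d z (prox h y))\<^sup>2 \<le> regularized d V h y z"
proof -
  interpret potential d V \<alpha> h by (rule potential[OF h])
  have "strongly_convex d (\<alpha> + 1 / h) (regularized d V h y)"
    unfolding strongly_convex_def using U_convex[unfolded m_def] by auto
  from strongly_convex_minimizer[OF this prox_min(1)[OF h y] prox_min(2)[OF h y] z] show ?thesis .
qed

text \<open>The vector \<open>u\<close> is the gradient of the regularized potential at the proximal
  point; \<open>min_upper\<close> removes it without computing it. The bound is what keeps the
  acceptance probability from being small.\<close>

lemma prox_upper:
  assumes h: "0 < h" and y: "y \<in> pts d" and z: "z \<in> pts d"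
  shows "regularized d V h y z \<le> regularized d V h y (prox h y) + (\<beta> + 1 / h) / 2 * (edist d z (prox h y))\<^sup>2"
proof (rule min_upper[where F="regularized d V h y" and x="prox h y" and K="\<beta> + 1 / h"
      and u="\<lambda>i. G (prox h y) i + (prox h y i - y i) / h"])
  let ?x = "prox h y"
  show "z \<in> pts d" "?x \<in> pts d" by (rule z, rule prox_min(1)[OF h y])
  show "\<And>z. z \<in> pts d \<Longrightarrow> regularized d V h y ?x \<le> regularized d V h y z" by (rule prox_min(2)[OF h y])
  show "0 \<le> \<beta> + 1 / h" using h \<beta>_pos by simp
  fix z assume z: "z \<in> pts d"
  have "(edist d z y)\<^sup>2 = (edist d ?x y)\<^sup>2 + 2 * (\<Sum>i<d. (?x i - y i) * (z i - ?x i)) + (edist d z ?x)\<^sup>2"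
    unfolding edist_sq sum_distrib_left sum.distrib[symmetric]
      by (intro sum.cong refl) (simp add: power2_eq_square algebra_simps)
  then have "(edist d z y)\<^sup>2 / (2 * h) = (edist d ?x y)\<^sup>2 / (2 * h) + (\<Sum>i<d. (?x i - y i) * (z i - ?x i)) / h
    + 1 / h / 2 * (edist d z ?x)\<^sup>2"
    using h by (simp add: add_divide_distrib)
  moreover have "V z \<le> V ?x + (\<Sum>i<d. G ?x i * (z i - ?x i)) + \<beta> / 2 * (edist d z ?x)\<^sup>2"
    by (rule descent[OF prox_min(1)[OF h y] z])
  moreover have "(\<Sum>i<d. (G ?x i + (?x i - y i) / h) * (z i - ?x i)) =
    (\<Sum>i<d. G ?x i * (z i - ?x i)) + (\<Sum>i<d. (?x i - y i) * (z i - ?x i)) / h"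
    by (simp add: sum_divide_distrib sum.distrib[symmetric] distrib_right)
  moreover have "(\<beta> + 1 / h) / 2 * (edist d z ?x)\<^sup>2 = \<beta> / 2 * (edist d z ?x)\<^sup>2 + 1 / h / 2 * (edist d z ?x)\<^sup>2"
    by (simp add: add_divide_distrib distrib_right)
  ultimately show "regularized d V h y z \<le> regularized d V h y ?x + (\<Sum>i<d. (G ?x i + (?x i - y i) / h) * (z i
    - ?x i)) + (\<beta> + 1 / h) / 2 * (edist d z ?x)\<^sup>2"
    unfolding regularized_def by linarith
qed

text \<open>Quadratic growth of the regularized potential at the proximal point, tested at
  \<open>xmin\<close>, is added to quadratic growth of \<open>V\<close> at \<open>xmin\<close>,
  tested at the proximal point. The potential values cancel.\<close>

lemma prox_contracts:
  assumes h: "0 < h" and y: "y \<in> pts d"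
  shows "(1 + 2 * \<alpha> * h) * (edist d (prox h y) xmin)\<^sup>2 + (edist d (prox h y) y)\<^sup>2 \<le> (edist d xmin y)\<^sup>2"
proof -
  let ?x = "prox h y"
  have "V ?x + (edist d ?x y)\<^sup>2 / (2 * h) + (\<alpha> + 1 / h) / 2 * (edist d ?x xmin)\<^sup>2 \<le>
    V xmin + (edist d xmin y)\<^sup>2 / (2 * h)"
    using prox_lower[OF h y xmin(1)] by (simp add: regularized_def edist_commute)
  moreover have "V xmin + \<alpha> / 2 * (edist d ?x xmin)\<^sup>2 \<le> V ?x" by (rule V_ge[OF prox_min(1)[OF h y]])
  ultimately have "(edist d ?x y)\<^sup>2 / (2 * h) + (\<alpha> + 1 / h) / 2 * (edist d ?x xmin)\<^sup>2
    + \<alpha> / 2 * (edist d ?x xmin)\<^sup>2 \<le> (edist d xmin y)\<^sup>2 / (2 * h)"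
    by linarith
  then have "2 * h * ((edist d ?x y)\<^sup>2 / (2 * h) + (\<alpha> + 1 / h) / 2 * (edist d ?x xmin)\<^sup>2
    + \<alpha> / 2 * (edist d ?x xmin)\<^sup>2) \<le> 2 * h * ((edist d xmin y)\<^sup>2 / (2 * h))"
    using h by (intro mult_left_mono) auto
  moreover have "2 * h * ((edist d ?x y)\<^sup>2 / (2 * h) + (\<alpha> + 1 / h) / 2 * (edist d ?x xmin)\<^sup>2
    + \<alpha> / 2 * (edist d ?x xmin)\<^sup>2)
     = (1 + 2 * \<alpha> * h) * (edist d ?x xmin)\<^sup>2 + (edist d ?x y)\<^sup>2"
    using h by (simp add: field_simps)
  ultimately show ?thesis using h by simp
qed

text \<open>Adding the two growth inequalities at the proximal points cancels \<open>V\<close> and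
  leaves an inner product. The purpose is continuity, hence measurability, of the proximal
  map.\<close>

lemma prox_nonexpansive:
  assumes h: "0 < h" and y: "y \<in> pts d" "y' \<in> pts d"
  shows "edist d (prox h y) (prox h y') \<le> edist d y y'"
proof -
  let ?x = "prox h y" and ?x' = "prox h y'"
  define r where "r = (edist d ?x ?x')\<^sup>2"
  have "regularized d V h y ?x + (\<alpha> + 1 / h) / 2 * r \<le> regularized d V h y ?x'"
    using prox_lower[OF h y(1) prox_min(1)[OF h y(2)]] by (simp add: r_def edist_commute)
  moreover have "regularized d V h y' ?x' + (\<alpha> + 1 / h) / 2 * r \<le> regularized d V h y' ?x"
    using prox_lower[OF h y(2) prox_min(1)[OF h y(1)]] by (simp add: r_def edist_commute)
  ultimately have "(\<alpha> + 1 / h) * r \<le> (edist d ?x' y)\<^sup>2 / (2 * h) + (edist d ?x y')\<^sup>2 / (2 * h)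
    - (edist d ?x y)\<^sup>2 / (2 * h) - (edist d ?x' y')\<^sup>2 / (2 * h)"
    unfolding regularized_def by linarith
  also have "\<dots> = ((edist d ?x' y)\<^sup>2 + (edist d ?x y')\<^sup>2 - (edist d ?x y)\<^sup>2 - (edist d ?x' y')\<^sup>2) / (2 * h)"
    by (simp add: add_divide_distrib diff_divide_distrib)
  also have "(edist d ?x' y)\<^sup>2 + (edist d ?x y')\<^sup>2 - (edist d ?x y)\<^sup>2 - (edist d ?x' y')\<^sup>2 =
    2 * (\<Sum>i<d. (?x i - ?x' i) * (y i - y' i))"
    unfolding edist_sq sum_distrib_left sum.distrib[symmetric] sum_subtractf[symmetric]
    by (intro sum.cong refl) (simp add: power2_eq_square algebra_simps)
  also have "2 * (\<Sum>i<d. (?x i - ?x' i) * (y i - y' i)) \<le> 2 * (edist d ?x ?x' * edist d y y')"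
  proof -
    have "(\<Sum>i<d. (?x i - ?x' i) * (y i - y' i)) \<le> sqrt (ip d (\<lambda>i. ?x i - ?x' i) (\<lambda>i. ?x i - ?x' i)) * edist d y y'"
      by (rule order_trans[OF abs_ge_self sum_le_edist])
    then show ?thesis by (simp add: edist_def[of d ?x] L2_set_def ip_def power2_eq_square)
  qed
  finally have "(\<alpha> + 1 / h) * r \<le> edist d ?x ?x' * edist d y y' / h" using h by (simp add: divide_right_mono)
  moreover have "1 / h * r \<le> (\<alpha> + 1 / h) * r" using \<alpha>_pos by (intro mult_right_mono) (auto simp: r_def)
  ultimately have "1 / h * r \<le> edist d ?x ?x' * edist d y y' / h" by linarith
  then have "edist d ?x ?x' * edist d ?x ?x' \<le> edist d ?x ?x' * edist d y y'"
    using h by (simp add: r_def power2_eq_square divide_le_cancel)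
  then show ?thesis
    using edist_nonneg[of d ?x ?x'] edist_nonneg[of d y y']
      by (cases "edist d ?x ?x' = 0") (auto simp: mult_le_cancel_left)
qed

lemma prox_measurable:
  assumes h: "0 < h"
  shows "prox h \<in> leb d \<rightarrow>\<^sub>M leb d"
proof (rule measurable_PiM_single')
  show "prox h \<in> space (leb d) \<rightarrow> ({..<d} \<rightarrow>\<^sub>E space lborel)"
    using prox_min(1)[OF h] by (auto simp: space_leb)
  fix i assume i: "i \<in> {..<d}"
  have "edist_cont d (\<lambda>y. prox h y i)"
    unfolding edist_cont_def
  proof (intro ballI allI impI)
    fix y e assume y: "y \<in> pts d" and e: "0 < (e::real)"
    show "\<exists>\<delta>>0. \<forall>z\<in>pts d. edist d z y < \<delta> \<longrightarrow> \<bar>prox h z i - prox h y i\<bar> < e"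
    proof (intro exI[of _ e] conjI ballI impI e)
      fix z assume z: "z \<in> pts d" "edist d z y < e"
      have "\<bar>prox h z i - prox h y i\<bar> \<le> edist d (prox h z) (prox h y)" using i by (intro abs_coord_le_edist) auto
      also have "\<dots> \<le> edist d z y" by (rule prox_nonexpansive[OF h z(1) y])
      finally show "\<bar>prox h z i - prox h y i\<bar> < e" using z by simp
    qed
  qed
  then show "(\<lambda>y. prox h y i) \<in> leb d \<rightarrow>\<^sub>M lborel" using edist_cont_measurable by simp
qed

lemma start_point:
  defines "x1 \<equiv> prox 1 (\<lambda>i\<in>{..<d}. 0)"
  shows "x1 \<in> pts d" "0 < start_step d \<alpha> x1" "(edist d (prox (start_step d \<alpha> x1) x1) xmin)\<^sup>2 \<le> 1 / \<alpha>"
proof -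
  let ?o = "\<lambda>i\<in>{..<d}. 0 :: real"
  define g where "g = edist d x1 ?o"
  define D where "D = edist d x1 xmin"
  show x1: "x1 \<in> pts d" unfolding x1_def by (rule prox_min) auto
  show h: "0 < start_step d \<alpha> x1" using \<alpha>_pos by (auto simp: start_step_def intro!: add_nonneg_pos)
  \<comment> \<open>Combined with the triangle inequality this bounds the unknown distance to
    \<open>xmin\<close> by the observable length \<open>g\<close>: the square of
    \<open>D + g\<close> cancels both pure squares and leaves
    \<open>\<alpha> * D^2 \<le> g * D\<close>.\<close>
  have "(1 + 2 * \<alpha> * 1) * D\<^sup>2 + g\<^sup>2 \<le> (edist d xmin ?o)\<^sup>2"
    unfolding D_def g_def x1_def by (rule prox_contracts) auto
  also have "\<dots> \<le> (D + g)\<^sup>2"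
    using edist_triangle[of d xmin ?o x1] by (intro power_mono) (auto simp: D_def g_def edist_commute)
  finally have "\<alpha> * D * D \<le> g * D" by (simp add: power2_eq_square algebra_simps)
  then have "\<alpha> * D \<le> g"
    using edist_nonneg[of d x1 xmin, folded D_def] edist_nonneg[of d x1 ?o, folded g_def]
    by (cases "D = 0") (auto intro: mult_right_le_imp_le[of _ D])
  then have D: "D \<le> g / \<alpha>" using \<alpha>_pos by (simp add: field_simps)
  define R where "R = (edist d (prox (start_step d \<alpha> x1) x1) xmin)\<^sup>2"
  have "(1 + 2 * \<alpha> * start_step d \<alpha> x1) * R \<le> (edist d xmin x1)\<^sup>2"
    using prox_contracts[OF h x1] zero_le_power2[of "edist d (prox (start_step d \<alpha> x1) x1) x1"] unfolding R_def
      by linarith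
  also have "\<dots> \<le> (g / \<alpha>)\<^sup>2" using D by (intro power_mono) (auto simp: D_def edist_commute)
  also have "\<dots> \<le> (1 + 2 * \<alpha> * start_step d \<alpha> x1) * (1 / \<alpha>)"
    using \<alpha>_pos by (simp add: start_step_def g_def power2_eq_square field_simps)
  finally have "(1 + 2 * \<alpha> * start_step d \<alpha> x1) * R \<le> (1 + 2 * \<alpha> * start_step d \<alpha> x1) * (1 / \<alpha>)" .
  moreover have "0 < 1 + 2 * \<alpha> * start_step d \<alpha> x1" using h \<alpha>_pos by (simp add: add_pos_pos)
  ultimately show "(edist d (prox (start_step d \<alpha> x1) x1) xmin)\<^sup>2 \<le> 1 / \<alpha>"
    unfolding R_def[symmetric] by (simp only: mult_le_cancel_left_pos)
qed

lemma \<alpha>_le_\<beta>: "1 \<le> d \<Longrightarrow> \<alpha> \<le> \<beta>"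
proof -
  assume d: "1 \<le> d"
  define z where "z = (\<lambda>i\<in>{..<d}. xmin i + 1)"
  have z: "z \<in> pts d" by (simp add: z_def)
  have "(edist d z xmin)\<^sup>2 = real d" unfolding edist_sq by (simp add: z_def)
  then have "\<alpha> * real d \<le> \<beta> * real d" using V_ge[OF z] V_le[OF z] by simp
  then show ?thesis by (rule mult_right_le_imp_le) (use d in simp)
qed

section \<open>Gaussian comparison and the second moment of the target\<close>

lemma exp_V_le: "x \<in> pts d \<Longrightarrow> exp (- V x) \<le> exp (- V xmin) * exp (- (edist d x xmin)\<^sup>2 / (2 * (1 / \<alpha>)))"
  using V_ge[of x] by (simp add: exp_add[symmetric] algebra_simps)

lemma integrable_gauss: "0 < v \<Longrightarrow> integrable (leb d) (\<lambda>x. exp (- (edist d x c)\<^sup>2 / (2 * v)))"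
proof (rule integrableI_nonneg)
  assume "0 < v"
  from nn_integral_gauss_leb[OF this, of d c]
  show "(\<integral>\<^sup>+x. ennreal (exp (- (edist d x c)\<^sup>2 / (2 * v))) \<partial>leb d) < \<infinity>" by (metis ennreal_less_top infinity_ennreal_def)
qed auto

lemma integral_gauss: "0 < v \<Longrightarrow> (\<integral>x. exp (- (edist d x c)\<^sup>2 / (2 * v)) \<partial>leb d) = (2 * pi * v) powr (real d / 2)"
proof -
  assume v: "0 < v"
  have "ennreal (\<integral>x. exp (- (edist d x c)\<^sup>2 / (2 * v)) \<partial>leb d) =
    (\<integral>\<^sup>+x. ennreal (exp (- (edist d x c)\<^sup>2 / (2 * v))) \<partial>leb d)"
    by (rule nn_integral_eq_integral[symmetric, OF integrable_gauss[OF v]]) auto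
  also have "\<dots> = ennreal ((2 * pi * v) powr (real d / 2))" by (rule nn_integral_gauss_leb[OF v])
  finally show ?thesis by (subst (asm) ennreal_inj) (auto intro!: integral_nonneg_AE AE_I2)
qed

lemma integrable_exp_V: "integrable (leb d) (\<lambda>x. exp (- V x))"
proof (rule Bochner_Integration.integrable_bound)
  show "integrable (leb d) (\<lambda>x. exp (- V xmin) * exp (- (edist d x xmin)\<^sup>2 / (2 * (1 / \<alpha>))))"
    using integrable_gauss[of "1 / \<alpha>" xmin] \<alpha>_pos by simp
  show "AE x in leb d. norm (exp (- V x)) \<le> norm (exp (- V xmin) * exp (- (edist d x xmin)\<^sup>2 / (2 * (1 / \<alpha>))))"
    using exp_V_le by (intro AE_I2) (auto simp: space_leb)
qed measurable

lemma proximal_sampler: "0 < h \<Longrightarrow> proximal_sampler d V \<alpha> h"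
  by (intro proximal_sampler.intro potential proximal_sampler_axioms.intro integrable_exp_V)

text \<open>An exponential moment is bounded by comparing \<open>V\<close> with quadratics of
  curvature \<alpha> in the numerator and \<beta> in the denominator, giving
  \<open>(2 * \<beta> / \<alpha>) powr (d / 2)\<close>; its logarithm bounds the second moment.
  Estimating that logarithm linearly loses a factor that the iteration count sees only inside a
  logarithm.\<close>

lemma second_moment_minimizer:
  assumes d: "1 \<le> d"
  shows "integrable (gibbs d V) (\<lambda>x. (edist d x xmin)\<^sup>2)"
    and "(\<integral>x. (edist d x xmin)\<^sup>2 \<partial>gibbs d V) \<le> 4 * real d * (\<beta> / \<alpha>) / \<alpha>"
proof -
  interpret P: proximal_sampler d V \<alpha> 1 by (rule proximal_sampler) simp
  interpret T: prob_space "gibbs d V" using prob_algebraD(1)[OF P.target_prob_algebra] .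
  define D where "D = real d / 2"
  have tgt: "gibbs d V = density (leb d) (\<lambda>x. ennreal (exp (- V x) / P.zt))"
    unfolding gibbs_def P.nn_integral_target using P.zt_pos by (simp add: divide_ennreal)
  \<comment> \<open>The exponent is half of the guaranteed Gaussian decay, so an integrable Gaussian
    of variance \<open>2 / \<alpha>\<close> remains.\<close>
  define E where "E x = exp (\<alpha> / 4 * (edist d x xmin)\<^sup>2)" for x
  have [measurable]: "E \<in> borel_measurable (leb d)" unfolding E_def by measurable
  have VE: "exp (- V x) * E x \<le> exp (- V xmin) * exp (- (edist d x xmin)\<^sup>2 / (2 * (2 / \<alpha>)))" if "x \<in> pts d" for x
    using V_ge[OF that] unfolding E_def exp_add[symmetric] by (simp add: algebra_simps)
  have iG: "integrable (leb d) (\<lambda>x. exp (- V xmin) * exp (- (edist d x xmin)\<^sup>2 / (2 * (2 / \<alpha>))))"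
    using integrable_gauss[of "2 / \<alpha>" xmin] \<alpha>_pos by simp
  have iVE: "integrable (leb d) (\<lambda>x. exp (- V x) * E x)"
  proof (rule Bochner_Integration.integrable_bound[OF iG])
    show "AE x in leb d. norm (exp (- V x) * E x) \<le> norm (exp (- V xmin) * exp (- (edist d x xmin)\<^sup>2 / (2 * (2 / \<alpha>))))"
      using VE by (intro AE_I2) (auto simp: space_leb E_def)
  qed measurable
  have iE: "integrable (gibbs d V) E"
  proof -
    have "integrable (gibbs d V) E \<longleftrightarrow> integrable (leb d) (\<lambda>x. (exp (- V x) / P.zt) * E x)"
      unfolding tgt using P.zt_pos by (subst integrable_density) (auto simp: less_imp_le)
    then show ?thesis using iVE by simp
  qed
  have "(\<integral>x. E x \<partial>gibbs d V) = (\<integral>x. (exp (- V x) / P.zt) * E x \<partial>leb d)"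
    unfolding tgt using P.zt_pos by (subst integral_density) (auto simp: less_imp_le)
  also have "\<dots> = (\<integral>x. exp (- V x) * E x \<partial>leb d) / P.zt" by simp
  also have "\<dots> \<le> exp (- V xmin) * (2 * pi * (2 / \<alpha>)) powr D / (exp (- V xmin) * (2 * pi * (1 / \<beta>)) powr D)"
  proof (rule frac_le)
    have "(\<integral>x. exp (- V x) * E x \<partial>leb d) \<le> (\<integral>x. exp (- V xmin) * exp (- (edist d x xmin)\<^sup>2 / (2 * (2 / \<alpha>))) \<partial>leb d)"
      using VE by (intro integral_mono iVE iG) (auto simp: space_leb)
    also have "\<dots> = exp (- V xmin) * (2 * pi * (2 / \<alpha>)) powr D"
      using integral_gauss[of "2 / \<alpha>" xmin] \<alpha>_pos by (simp add: D_def)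
    finally show "(\<integral>x. exp (- V x) * E x \<partial>leb d) \<le> exp (- V xmin) * (2 * pi * (2 / \<alpha>)) powr D" .
    have "exp (- V xmin) * (2 * pi * (1 / \<beta>)) powr D =
      (\<integral>x. exp (- V xmin) * exp (- (edist d x xmin)\<^sup>2 / (2 * (1 / \<beta>))) \<partial>leb d)"
      using integral_gauss[of "1 / \<beta>" xmin] \<beta>_pos by (simp add: D_def)
    also have "\<dots> \<le> P.zt" unfolding P.zt_def
    proof (rule integral_mono[OF _ integrable_exp_V])
      show "integrable (leb d) (\<lambda>x. exp (- V xmin) * exp (- (edist d x xmin)\<^sup>2 / (2 * (1 / \<beta>))))"
        using integrable_gauss[of "1 / \<beta>" xmin] \<beta>_pos by simp
      fix x assume "x \<in> space (leb d)"
      then show "exp (- V xmin) * exp (- (edist d x xmin)\<^sup>2 / (2 * (1 / \<beta>))) \<le> exp (- V x)"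
        using V_le[of x] by (simp add: exp_add[symmetric] space_leb algebra_simps)
    qed
    finally show "exp (- V xmin) * (2 * pi * (1 / \<beta>)) powr D \<le> P.zt" .
  qed (use \<beta>_pos \<alpha>_pos in auto)
  also have "\<dots> = (2 * (\<beta> / \<alpha>)) powr D"
    using \<alpha>_pos \<beta>_pos by (simp add: powr_divide[symmetric])
  also have "\<dots> = exp (D * ln (2 * (\<beta> / \<alpha>)))" using \<alpha>_pos \<beta>_pos by (simp add: powr_def)
  finally have EE: "(\<integral>x. E x \<partial>gibbs d V) \<le> exp (D * ln (2 * (\<beta> / \<alpha>)))" .
  define c where "c = D * ln (2 * (\<beta> / \<alpha>))"
  have rE: "(edist d x xmin)\<^sup>2 \<le> 4 / \<alpha> * E x" for x
  proof -
    have "\<alpha> / 4 * (edist d x xmin)\<^sup>2 \<le> E x" unfolding E_def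
      using exp_ge_add_one_self[of "\<alpha> / 4 * (edist d x xmin)\<^sup>2"] by linarith
    then show ?thesis using \<alpha>_pos by (simp add: field_simps)
  qed
  show i: "integrable (gibbs d V) (\<lambda>x. (edist d x xmin)\<^sup>2)"
  proof (rule Bochner_Integration.integrable_bound)
    show "integrable (gibbs d V) (\<lambda>x. 4 / \<alpha> * E x)" using iE by simp
    show "(\<lambda>x. (edist d x xmin)\<^sup>2) \<in> borel_measurable (gibbs d V)" by (simp add: gibbs_def)
    show "AE x in gibbs d V. norm ((edist d x xmin)\<^sup>2) \<le> norm (4 / \<alpha> * E x)"
    proof (intro AE_I2)
      fix x
      have "0 \<le> 4 / \<alpha> * E x" using \<alpha>_pos by (simp add: E_def)
      then show "norm ((edist d x xmin)\<^sup>2) \<le> norm (4 / \<alpha> * E x)" using rE[of x]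
        by (simp only: real_norm_def abs_of_nonneg zero_le_power2)
    qed
  qed
  \<comment> \<open>The tangent of exp at \<open>c\<close> again plays the role of Jensen's
    inequality.\<close>
  have "(\<integral>x. \<alpha> / 4 * (edist d x xmin)\<^sup>2 + (1 - c) \<partial>gibbs d V) \<le> (\<integral>x. exp (- c) * E x \<partial>gibbs d V)"
  proof (rule integral_mono)
    show "integrable (gibbs d V) (\<lambda>x. \<alpha> / 4 * (edist d x xmin)\<^sup>2 + (1 - c))" using i by simp
    show "integrable (gibbs d V) (\<lambda>x. exp (- c) * E x)" using iE by simp
    fix x
    show "\<alpha> / 4 * (edist d x xmin)\<^sup>2 + (1 - c) \<le> exp (- c) * E x"
      unfolding E_def exp_add[symmetric] using exp_ge_add_one_self[of "- c + \<alpha> / 4 * (edist d x xmin)\<^sup>2"] by linarith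
  qed
  also have "\<dots> \<le> exp (- c) * exp c" using EE by (simp add: c_def)
  also have "(\<integral>x. \<alpha> / 4 * (edist d x xmin)\<^sup>2 + (1 - c) \<partial>gibbs d V) =
    \<alpha> / 4 * (\<integral>x. (edist d x xmin)\<^sup>2 \<partial>gibbs d V) + (1 - c)"
    using i T.prob_space by simp
  finally have "\<alpha> / 4 * (\<integral>x. (edist d x xmin)\<^sup>2 \<partial>gibbs d V) \<le> c" by (simp add: exp_add[symmetric])
  also have "c \<le> D * (2 * (\<beta> / \<alpha>))"
    unfolding c_def using \<alpha>_pos \<beta>_pos ln_le_minus_one[of "2 * (\<beta> / \<alpha>)"] by (intro mult_left_mono) (auto simp: D_def)
  finally show "(\<integral>x. (edist d x xmin)\<^sup>2 \<partial>gibbs d V) \<le> 4 * real d * (\<beta> / \<alpha>) / \<alpha>"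
    using \<alpha>_pos by (simp add: D_def field_simps)
qed

lemma second_moment:
  assumes d: "1 \<le> d" and x0: "(edist d x0 xmin)\<^sup>2 \<le> 1 / \<alpha>"
  shows "integrable (gibbs d V) (\<lambda>x. (edist d x0 x)\<^sup>2)"
    and "(\<integral>x. (edist d x0 x)\<^sup>2 \<partial>gibbs d V) \<le> 10 * real d * (\<beta> / \<alpha>) / \<alpha>"
proof -
  interpret P: proximal_sampler d V \<alpha> 1 by (rule proximal_sampler) simp
  interpret T: prob_space "gibbs d V" using prob_algebraD(1)[OF P.target_prob_algebra] .
  note i = second_moment_minimizer[OF d]
  have le: "(edist d x0 x)\<^sup>2 \<le> 2 * (1 / \<alpha>) + 2 * (edist d x xmin)\<^sup>2" for x
  proof -
    have "(edist d x0 x)\<^sup>2 \<le> (edist d x0 xmin + edist d x xmin)\<^sup>2"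
      using edist_triangle[of d x0 x xmin] by (intro power_mono) (auto simp: edist_commute)
    also have "\<dots> \<le> 2 * (edist d x0 xmin)\<^sup>2 + 2 * (edist d x xmin)\<^sup>2"
      using zero_le_power2[of "edist d x0 xmin - edist d x xmin"] by (simp add: power2_sum power2_diff)
    finally show ?thesis using x0 by linarith
  qed
  have iR: "integrable (gibbs d V) (\<lambda>x. 2 * (1 / \<alpha>) + 2 * (edist d x xmin)\<^sup>2)" using i(1) by simp
  show i0: "integrable (gibbs d V) (\<lambda>x. (edist d x0 x)\<^sup>2)"
  proof (rule Bochner_Integration.integrable_bound[OF iR])
    show "(\<lambda>x. (edist d x0 x)\<^sup>2) \<in> borel_measurable (gibbs d V)"
      unfolding edist_commute[of d x0] by (simp add: gibbs_def)
    show "AE x in gibbs d V. norm ((edist d x0 x)\<^sup>2) \<le> norm (2 * (1 / \<alpha>) + 2 * (edist d x xmin)\<^sup>2)"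
      using le by (intro AE_I2) (simp add: order_trans[OF _ abs_ge_self])
  qed
  have "(\<integral>x. (edist d x0 x)\<^sup>2 \<partial>gibbs d V) \<le> (\<integral>x. 2 * (1 / \<alpha>) + 2 * (edist d x xmin)\<^sup>2 \<partial>gibbs d V)"
    using le by (intro integral_mono i0 iR)
  also have "\<dots> = 2 * (1 / \<alpha>) + 2 * (\<integral>x. (edist d x xmin)\<^sup>2 \<partial>gibbs d V)" using i(1) T.prob_space by simp
  also have "\<dots> \<le> 2 * (1 / \<alpha>) + 2 * (4 * real d * (\<beta> / \<alpha>) / \<alpha>)" using i(2) by simp
  also have "\<dots> = (2 + 8 * (real d * (\<beta> / \<alpha>))) / \<alpha>" by (simp add: add_divide_distrib)
  also have "\<dots> \<le> 10 * (real d * (\<beta> / \<alpha>)) / \<alpha>"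
  proof (rule divide_right_mono)
    \<comment> \<open>Since \<open>d * (\<beta> / \<alpha>)\<close> is at least 1, the offset 2 from
      the starting point merges into the main term, giving the constant 10.\<close>
    have "1 * 1 \<le> real d * (\<beta> / \<alpha>)" using d \<alpha>_le_\<beta>[OF d] \<alpha>_pos by (intro mult_mono) auto
    moreover define k where "k = real d * (\<beta> / \<alpha>)"
    ultimately have "1 \<le> k" by simp
    then show "2 + 8 * (real d * (\<beta> / \<alpha>)) \<le> 10 * (real d * (\<beta> / \<alpha>))" unfolding k_def[symmetric] by linarith
  qed (use \<alpha>_pos in simp)
  finally show "(\<integral>x. (edist d x0 x)\<^sup>2 \<partial>gibbs d V) \<le> 10 * real d * (\<beta> / \<alpha>) / \<alpha>" by (simp add: mult.assoc)
qed

end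

section \<open>Rejection sampling\<close>

locale rejection_rounds = N: prob_space N for N :: "'a measure" +
  fixes a :: "'a \<Rightarrow> real"
  assumes a_measurable [measurable]: "a \<in> borel_measurable N"
    and a_range: "\<And>z. z \<in> space N \<Longrightarrow> 0 \<le> a z \<and> a z \<le> 1"
begin

definition unif where "unif = uniform_measure lborel {0..1::real}"
abbreviation "W \<equiv> N \<Otimes>\<^sub>M unif"
definition acc where "acc = (\<lambda>(z, u). u \<le> a z)"
definition rate where "rate = (\<integral>z. a z \<partial>N)"

lemma prob_unif: "prob_space unif"
  unfolding unif_def by (intro prob_space_uniform_measure) auto

lemma sets_unif [measurable_cong]: "sets unif = sets borel"
  by (simp add: unif_def)

lemma prob_W: "prob_space W"
  by (intro prob_space_pair N.prob_space_axioms prob_unif)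

lemma acc_measurable [measurable]: "Measurable.pred W acc"
  unfolding acc_def by measurable

lemma emeasure_unif: "0 \<le> t \<Longrightarrow> t \<le> 1 \<Longrightarrow> emeasure unif {..t} = ennreal t"
proof -
  assume t: "0 \<le> t" "t \<le> 1"
  then have "{0..1} \<inter> {..t} = {0..t}" by auto
  then show ?thesis using t unfolding unif_def
    by (subst emeasure_uniform_measure) (auto simp: divide_ennreal[of t 1, simplified])
qed

lemma nn_integral_accept:
  assumes [measurable]: "g \<in> borel_measurable N"
  shows "(\<integral>\<^sup>+w. (if acc w then g (fst w) else 0) \<partial>W) = (\<integral>\<^sup>+z. ennreal (a z) * g z \<partial>N)"
proof -
  interpret U: prob_space unif by (rule prob_unif)
  have "(\<integral>\<^sup>+w. (if acc w then g (fst w) else 0) \<partial>W) = (\<integral>\<^sup>+z. \<integral>\<^sup>+u. (if acc (z, u) then g z else 0) \<partial>unif \<partial>N)"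
    by (subst U.nn_integral_fst[symmetric]) (auto cong: if_cong)
  also have "\<dots> = (\<integral>\<^sup>+z. ennreal (a z) * g z \<partial>N)"
  proof (rule nn_integral_cong)
    fix z assume z: "z \<in> space N"
    have "(\<integral>\<^sup>+u. (if acc (z, u) then g z else 0) \<partial>unif) = (\<integral>\<^sup>+u. g z * indicator {..a z} u \<partial>unif)"
      by (intro nn_integral_cong) (auto simp: acc_def indicator_def)
    also have "\<dots> = g z * emeasure unif {..a z}" by (intro nn_integral_cmult_indicator) (simp add: sets_unif)
    also have "\<dots> = ennreal (a z) * g z" using a_range[OF z] by (simp add: emeasure_unif mult.commute)
    finally show "(\<integral>\<^sup>+u. (if acc (z, u) then g z else 0) \<partial>unif) = ennreal (a z) * g z" .
  qed
  finally show ?thesis .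
qed

lemma rate_bounds: "0 \<le> rate" "rate \<le> 1"
proof -
  have i: "integrable N a" by (rule N.integrable_const_bound[of _ 1]) (use a_range in auto)
  show "0 \<le> rate" unfolding rate_def using a_range by (intro integral_nonneg_AE AE_I2) auto
  show "rate \<le> 1" unfolding rate_def using a_range i by (intro N.integral_le_const AE_I2) auto
qed

lemma nn_integral_a: "(\<integral>\<^sup>+z. ennreal (a z) \<partial>N) = ennreal rate"
  unfolding rate_def by (intro nn_integral_eq_integral N.integrable_const_bound[of _ 1]) (use a_range in auto)

lemma nn_integral_reject: "(\<integral>\<^sup>+w. (if acc w then 0 else 1) \<partial>W) = ennreal (1 - rate)"
proof -
  interpret W: prob_space W by (rule prob_W)
  have "(\<integral>\<^sup>+w. (if acc w then 0 else 1) \<partial>W) + (\<integral>\<^sup>+w. (if acc w then 1 else 0) \<partial>W) =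
      (\<integral>\<^sup>+w. (if acc w then 0 else 1) + (if acc w then 1 else 0) \<partial>W)"
    by (rule nn_integral_add[symmetric]) measurable
  also have "\<dots> = (\<integral>\<^sup>+w. 1 \<partial>W)" by (rule nn_integral_cong) simp
  also have "(\<integral>\<^sup>+w. (if acc w then 1 else 0) \<partial>W) = ennreal rate"
    using nn_integral_accept[of "\<lambda>_. 1"] nn_integral_a by simp
  finally have "(\<integral>\<^sup>+w. (if acc w then 0 else 1) \<partial>W) + ennreal rate = 1" using W.emeasure_space_1 by simp
  then show ?thesis using rate_bounds
    by (metis ennreal_1 ennreal_add_diff_cancel_right ennreal_minus ennreal_neq_top)
qed

definition stops_at where "stops_at n \<omega> \<longleftrightarrow> (\<forall>i<n. \<not> acc (\<omega> !! i)) \<and> acc (\<omega> !! n)"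

lemma stops_at_measurable [measurable]: "Measurable.pred (stream_space W) (stops_at n)"
  unfolding stops_at_def[abs_def] by measurable

lemma stops_at_Suc: "stops_at (Suc n) (w ## \<omega>) \<longleftrightarrow> \<not> acc w \<and> stops_at n \<omega>"
  by (simp add: stops_at_def All_less_Suc2 conj_assoc)

text \<open>Conditioning on the first round: it rejects with probability \<open>1 - rate\<close>,
  and the remaining stream has the same law.\<close>

lemma nn_integral_stops_at:
  assumes g [measurable]: "g \<in> borel_measurable N"
  shows "(\<integral>\<^sup>+\<omega>. (if stops_at n \<omega> then g (fst (\<omega> !! n)) else 0) \<partial>stream_space W) =
    ennreal ((1 - rate) ^ n) * (\<integral>\<^sup>+z. ennreal (a z) * g z \<partial>N)"
proof -
  interpret W: prob_space W by (rule prob_W)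
  interpret S: prob_space "stream_space W" by (rule W.prob_space_stream_space)
  show ?thesis
  proof (induction n)
    case 0
    have "(\<integral>\<^sup>+\<omega>. (if stops_at 0 \<omega> then g (fst (\<omega> !! 0)) else 0) \<partial>stream_space W) =
      (\<integral>\<^sup>+w. \<integral>\<^sup>+\<omega>. (if acc w then g (fst w) else 0) \<partial>stream_space W \<partial>W)"
      by (subst W.nn_integral_stream_space) (auto simp: stops_at_def cong: if_cong)
    also have "\<dots> = (\<integral>\<^sup>+w. (if acc w then g (fst w) else 0) \<partial>W)"
      by (intro nn_integral_cong) (simp add: S.emeasure_space_1)
    finally show ?case by (simp add: nn_integral_accept)
  next
    case (Suc n)
    let ?I = "\<integral>\<^sup>+\<omega>. (if stops_at n \<omega> then g (fst (\<omega> !! n)) else 0) \<partial>stream_space W"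
    have "(\<integral>\<^sup>+\<omega>. (if stops_at (Suc n) \<omega> then g (fst (\<omega> !! Suc n)) else 0) \<partial>stream_space W) =
      (\<integral>\<^sup>+w. \<integral>\<^sup>+\<omega>. (if stops_at (Suc n) (w ## \<omega>) then g (fst ((w ## \<omega>) !! Suc n)) else 0) \<partial>stream_space W \<partial>W)"
      by (rule W.nn_integral_stream_space) measurable
    also have "\<dots> = (\<integral>\<^sup>+w. (if acc w then 0 else 1) * ?I \<partial>W)"
      by (intro nn_integral_cong) (simp add: stops_at_Suc cong: if_cong)
    also have "\<dots> = (\<integral>\<^sup>+w. (if acc w then 0 else 1) \<partial>W) * ?I"
      by (intro nn_integral_multc) measurable
    finally show ?case
      unfolding Suc nn_integral_reject using rate_bounds by (simp add: ennreal_mult mult.assoc)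
  qed
qed

lemma stops_at_unique: "stops_at n \<omega> \<Longrightarrow> stops_at n' \<omega> \<Longrightarrow> n = n'"
  unfolding stops_at_def by (cases n n' rule: linorder_cases) auto

lemma stops_at_Least: "\<exists>n. acc (\<omega> !! n) \<Longrightarrow> stops_at (LEAST n. acc (\<omega> !! n)) \<omega>"
  using LeastI_ex[of "\<lambda>n. acc (\<omega> !! n)"] not_less_Least[of _ "\<lambda>n. acc (\<omega> !! n)"] unfolding stops_at_def by auto

lemma suminf_stops_at:
  fixes f :: "nat \<Rightarrow> ennreal"
  assumes "stops_at n \<omega>"
  shows "(\<Sum>k. if stops_at k \<omega> then f k else 0) = f n"
proof -
  have "(\<Sum>k. if stops_at k \<omega> then f k else 0) = (\<Sum>k\<in>{n}. if stops_at k \<omega> then f k else 0)"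
    using stops_at_unique[OF assms] by (intro suminf_finite) auto
  then show ?thesis using assms by simp
qed

lemma suminf_geometric: "0 < rate \<Longrightarrow> (\<Sum>n. ennreal ((1 - rate) ^ n) * ennreal rate) = 1"
proof -
  assume r: "0 < rate"
  have "(\<lambda>n. (1 - rate) ^ n) sums (1 / (1 - (1 - rate)))"
    using rate_bounds r by (intro geometric_sums) auto
  then have "(\<lambda>n. (1 - rate) ^ n * rate) sums (1 / (1 - (1 - rate)) * rate)" by (rule sums_mult2)
  then have "(\<Sum>n. ennreal ((1 - rate) ^ n * rate)) = ennreal (1 / (1 - (1 - rate)) * rate)"
    using rate_bounds by (intro suminf_ennreal_eq) auto
  moreover have "ennreal ((1 - rate) ^ n * rate) = ennreal ((1 - rate) ^ n) * ennreal rate" for n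
    using rate_bounds by (intro ennreal_mult) auto
  moreover have "1 / (1 - (1 - rate)) * rate = 1" using r by simp
  ultimately show ?thesis by (simp only: ennreal_1)
qed

lemma AE_stops: "0 < rate \<Longrightarrow> AE \<omega> in stream_space W. \<exists>n. acc (\<omega> !! n)"
proof -
  assume r: "0 < rate"
  interpret W: prob_space W by (rule prob_W)
  interpret S: prob_space "stream_space W" by (rule W.prob_space_stream_space)
  let ?A = "{\<omega> \<in> space (stream_space W). \<exists>n. acc (\<omega> !! n)}"
  have [measurable]: "?A \<in> sets (stream_space W)" by measurable
  have "1 = (\<Sum>n. ennreal ((1 - rate) ^ n) * ennreal rate)" using suminf_geometric[OF r] by simp
  also have "\<dots> = (\<Sum>n. \<integral>\<^sup>+\<omega>. (if stops_at n \<omega> then 1 else 0) \<partial>stream_space W)"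
    using nn_integral_stops_at[of "\<lambda>_. 1"] nn_integral_a by simp
  also have "\<dots> = (\<integral>\<^sup>+\<omega>. (\<Sum>n. if stops_at n \<omega> then 1 else 0) \<partial>stream_space W)"
    by (intro nn_integral_suminf[symmetric]) measurable
  also have "\<dots> \<le> (\<integral>\<^sup>+\<omega>. indicator ?A \<omega> \<partial>stream_space W)"
  proof (rule nn_integral_mono)
    fix \<omega> assume w: "\<omega> \<in> space (stream_space W)"
    show "(\<Sum>n. if stops_at n \<omega> then 1 else 0 :: ennreal) \<le> indicator ?A \<omega>"
    proof (cases "\<exists>n. acc (\<omega> !! n)")
      case True
      then show ?thesis using suminf_stops_at[OF stops_at_Least[OF True], of "\<lambda>_. 1"] w by simp
    next
      case False
      then have "\<not> stops_at n \<omega>" for n by (auto simp: stops_at_def)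
      then show ?thesis by simp
    qed
  qed
  also have "\<dots> = emeasure (stream_space W) ?A" by simp
  finally have "emeasure (stream_space W) ?A = 1" using S.measure_le_1 S.emeasure_le_1 by (simp add: antisym)
  then have "S.prob ?A = 1" by (simp add: measure_def)
  then have "AE \<omega> in stream_space W. \<omega> \<in> ?A" by (subst (asm) S.prob_eq_1) auto
  then show ?thesis by auto
qed

text \<open>The function may depend on the stopping index because the query count is determined by
  it. Almost surely exactly one index stops, so the outcome is a sum over indices.\<close>

lemma nn_integral_outcome:
  assumes r: "0 < rate" and g [measurable]: "\<And>n. g n \<in> borel_measurable N"
  shows "(\<integral>\<^sup>+\<omega>. (let n = LEAST n. acc (\<omega> !! n) in g n (fst (\<omega> !! n))) \<partial>stream_space W) =
     (\<Sum>n. ennreal ((1 - rate) ^ n) * (\<integral>\<^sup>+z. ennreal (a z) * g n z \<partial>N))"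
proof -
  have pt: "(let n = LEAST n. acc (\<omega> !! n) in g n (fst (\<omega> !! n))) =
    (\<Sum>n. if stops_at n \<omega> then g n (fst (\<omega> !! n)) else 0)"
    if "\<exists>n. acc (\<omega> !! n)" for \<omega>
    unfolding Let_def by (rule suminf_stops_at[OF stops_at_Least[OF that], symmetric])
  have "(\<integral>\<^sup>+\<omega>. (let n = LEAST n. acc (\<omega> !! n) in g n (fst (\<omega> !! n))) \<partial>stream_space W) =
    (\<integral>\<^sup>+\<omega>. (\<Sum>n. if stops_at n \<omega> then g n (fst (\<omega> !! n)) else 0) \<partial>stream_space W)"
    by (rule nn_integral_cong_AE, rule eventually_mono[OF AE_stops[OF r]], rule pt)
  also have "\<dots> = (\<Sum>n. \<integral>\<^sup>+\<omega>. (if stops_at n \<omega> then g n (fst (\<omega> !! n)) else 0) \<partial>stream_space W)"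
    by (intro nn_integral_suminf) measurable
  also have "\<dots> = (\<Sum>n. ennreal ((1 - rate) ^ n) * (\<integral>\<^sup>+z. ennreal (a z) * g n z \<partial>N))"
    by (intro suminf_cong nn_integral_stops_at g)
  finally show ?thesis .
qed

text \<open>The mean of the geometric law; \<open>Suc n\<close> appears because the accepting round
  itself is counted.\<close>

lemma suminf_waiting_time: "0 < rate \<Longrightarrow> (\<Sum>n. ennreal ((1 - rate) ^ n) * ennreal rate * of_nat (Suc n)) =
  ennreal (1 / rate)"
proof -
  assume r: "0 < rate"
  have "norm (1 - rate) < 1" using rate_bounds r by simp
  then have "(\<lambda>n. of_nat (Suc n) * (1 - rate) ^ n) sums (1 / (1 - (1 - rate))\<^sup>2)"
    by (rule geometric_deriv_sums)
  then have "(\<lambda>n. of_nat (Suc n) * (1 - rate) ^ n * rate) sums (1 / (1 - (1 - rate))\<^sup>2 * rate)" by (rule sums_mult2)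
  then have "(\<Sum>n. ennreal (of_nat (Suc n) * (1 - rate) ^ n * rate)) = ennreal (1 / (1 - (1 - rate))\<^sup>2 * rate)"
    using rate_bounds by (intro suminf_ennreal_eq) auto
  moreover have "ennreal (of_nat (Suc n) * (1 - rate) ^ n * rate) =
    ennreal ((1 - rate) ^ n) * ennreal rate * of_nat (Suc n)" for n
    using rate_bounds by (simp add: ennreal_mult ennreal_of_nat_eq_real_of_nat mult_ac del: of_nat_Suc)
  moreover have "1 / (1 - (1 - rate))\<^sup>2 * rate = 1 / rate" using r by (simp add: power2_eq_square)
  ultimately show ?thesis by simp
qed

end

text \<open>With \<open>x\<close> the proximal point, the Gaussian around \<open>x\<close> scaled to
  match \<open>exp (- U y x)\<close> at its centre dominates \<open>exp (- U y z)\<close>, and the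
  acceptance probability is their ratio. The value at \<open>x\<close> is queried once and shared by
  all rounds; each round then needs one evaluation.\<close>

definition rgo_query :: "nat \<Rightarrow> real \<Rightarrow> point \<Rightarrow> rejection query_tree" where
  "rgo_query d h y = Proximal h y (\<lambda>x. Evaluate x (\<lambda>v. Return (gaussian d x h, \<lambda>z. Evaluate z (\<lambda>w.
     Return (exp (v + (edist d x y)\<^sup>2 / (2 * h) + (edist d z x)\<^sup>2 / (2 * h) - w - (edist d z y)\<^sup>2 / (2 * h)))))))"

lemma measurable_plus_nat:
  fixes f g :: "'a \<Rightarrow> nat"
  assumes f: "f \<in> M \<rightarrow>\<^sub>M count_space UNIV" and g: "g \<in> M \<rightarrow>\<^sub>M count_space UNIV"
  shows "(\<lambda>x. f x + g x) \<in> M \<rightarrow>\<^sub>M count_space UNIV"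
proof -
  have "(\<lambda>x. (f x, g x)) \<in> M \<rightarrow>\<^sub>M count_space (UNIV \<times> UNIV)"
    using measurable_Pair[OF f g] by (simp add: pair_measure_countable)
  from measurable_compose[OF this, of "\<lambda>(a, b). a + b" "count_space UNIV"] show ?thesis by simp
qed

section \<open>The rejection sampler for the restricted Gaussian\<close>

locale restricted_gaussian = smooth_convex +
  fixes h :: real
  assumes step_pos: "0 < h"

sublocale restricted_gaussian \<subseteq> P: proximal_sampler d V \<alpha> h
  by (rule proximal_sampler[OF step_pos])

context restricted_gaussian
begin

abbreviation "xhat \<equiv> prox h"

definition accept_prob where "accept_prob y z =
  exp (V (xhat y) + (edist d (xhat y) y)\<^sup>2 / (2 * h) + (edist d z (xhat y))\<^sup>2 / (2 * h) - V z
    - (edist d z y)\<^sup>2 / (2 * h))"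

definition tree where "tree y = (\<lambda>z. Evaluate z (\<lambda>w.
     Return (exp (V (xhat y) + (edist d (xhat y) y)\<^sup>2 / (2 * h) + (edist d z (xhat y))\<^sup>2 / (2 * h) - w
       - (edist d z y)\<^sup>2 / (2 * h)))))"

lemma run_rgo_query: "run_tree d V (rgo_query d h y) = ((gaussian d (xhat y) h, tree y), 1, 1)"
  by (simp add: rgo_query_def tree_def)

lemma run_tree_tree: "run_tree d V (tree y z) = (accept_prob y z, 1, 0)"
  by (simp add: tree_def accept_prob_def)

lemma accept_prob_measurable [measurable]: "accept_prob y \<in> borel_measurable (leb d)"
  unfolding accept_prob_def by measurable

lemma accept_prob_le_1: "y \<in> pts d \<Longrightarrow> z \<in> pts d \<Longrightarrow> accept_prob y z \<le> 1"
proof -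
  assume y: "y \<in> pts d" and z: "z \<in> pts d"
  have "1 / h / 2 * (edist d z (xhat y))\<^sup>2 \<le> (\<alpha> + 1 / h) / 2 * (edist d z (xhat y))\<^sup>2"
    using \<alpha>_pos by (intro mult_right_mono) auto
  then have "(edist d z (xhat y))\<^sup>2 / (2 * h) \<le> (\<alpha> + 1 / h) / 2 * (edist d z (xhat y))\<^sup>2" by simp
  then have "V (xhat y) + (edist d (xhat y) y)\<^sup>2 / (2 * h) + (edist d z (xhat y))\<^sup>2 / (2 * h) - V z
    - (edist d z y)\<^sup>2 / (2 * h) \<le> 0"
    using prox_lower[OF step_pos y z, unfolded regularized_def] by linarith
  then show ?thesis unfolding accept_prob_def by simp
qed

definition gauss_mass where "gauss_mass = (2 * pi * h) powr (real d / 2)"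
text \<open>The mean acceptance probability: the mass of \<open>exp (- U y z)\<close> relative to
  the mass of its Gaussian envelope.\<close>

definition accept_rate where "accept_rate y = exp (P.U y (xhat y)) * P.z y / gauss_mass"

lemma gauss_mass_pos: "gauss_mass > 0"
  using step_pos by (simp add: gauss_mass_def)

lemma accept_rate_pos: "accept_rate y > 0"
  using gauss_mass_pos P.z_pos[of y] by (simp add: accept_rate_def)

lemma sets_gaussian [simp]: "sets (gaussian d x h) = sets (leb d)"
  unfolding gaussian_eq_density[OF step_pos] by simp

lemma space_gaussian [simp]: "space (gaussian d x h) = pts d"
  unfolding gaussian_eq_density[OF step_pos] by (simp add: space_leb)

lemma gaussian_prob_algebra: "gaussian d x h \<in> space (prob_algebra (leb d))"
  using P.gauss.mu_prob_algebra[of x] by (simp only: P.gauss_mu)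

lemma nn_integral_accept_prob_gaussian:
  assumes [measurable]: "g \<in> borel_measurable (leb d)"
  shows "(\<integral>\<^sup>+z. ennreal (accept_prob y z) * g z \<partial>gaussian d (xhat y) h) = ennreal (accept_rate y) * (\<integral>\<^sup>+z. g z \<partial>P.mu y)"
proof -
  let ?E = "exp (P.U y (xhat y))"
  have "(\<integral>\<^sup>+z. ennreal (accept_prob y z) * g z \<partial>gaussian d (xhat y) h) =
    (\<integral>\<^sup>+z. ennreal (exp (- (edist d z (xhat y))\<^sup>2 / (2 * h)) / gauss_mass) * (ennreal (accept_prob y z) * g z) \<partial>leb d)"
    unfolding gaussian_eq_density[OF step_pos] gauss_mass_def[symmetric] by (intro nn_integral_density) measurable
  also have "\<dots> = (\<integral>\<^sup>+z. ennreal (?E / gauss_mass) * (ennreal (exp (- P.U y z)) * g z) \<partial>leb d)"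
  proof (rule nn_integral_cong)
    fix z
    let ?X = "exp (- (edist d z (xhat y))\<^sup>2 / (2 * h))"
    have eq: "?X * accept_prob y z = ?E * exp (- P.U y z)"
      unfolding accept_prob_def regularized_def exp_add[symmetric] by simp
    have "?X / gauss_mass * accept_prob y z = ?E / gauss_mass * exp (- P.U y z)"
      unfolding times_divide_eq_left eq ..
    moreover have "0 \<le> ?X / gauss_mass" "0 \<le> ?E / gauss_mass" "0 \<le> accept_prob y z" using gauss_mass_pos
      by (auto simp: accept_prob_def)
    ultimately have "ennreal (?X / gauss_mass) * ennreal (accept_prob y z) =
      ennreal (?E / gauss_mass) * ennreal (exp (- P.U y z))"
      by (metis ennreal_mult exp_ge_zero)
    then show "ennreal (?X / gauss_mass) * (ennreal (accept_prob y z) * g z) =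
      ennreal (?E / gauss_mass) * (ennreal (exp (- P.U y z)) * g z)"
      by (simp only: mult.assoc[symmetric])
  qed
  also have "\<dots> = ennreal (?E / gauss_mass) * (\<integral>\<^sup>+z. ennreal (exp (- P.U y z)) * g z \<partial>leb d)"
    by (intro nn_integral_cmult) measurable
  also have "(\<integral>\<^sup>+z. ennreal (exp (- P.U y z)) * g z \<partial>leb d) = ennreal (P.z y) * (\<integral>\<^sup>+z. g z \<partial>P.mu y)"
    by (subst P.nn_integral_mu) (auto simp: ennreal_mult_divide_cancel[OF P.z_pos])
  also have "ennreal (?E / gauss_mass) * (ennreal (P.z y) * (\<integral>\<^sup>+z. g z \<partial>P.mu y)) =
    ennreal (accept_rate y) * (\<integral>\<^sup>+z. g z \<partial>P.mu y)"
    using P.z_pos[of y] gauss_mass_pos by (simp add: accept_rate_def mult.assoc[symmetric] ennreal_mult'[symmetric])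
  finally show ?thesis .
qed

lemma rejection_rounds: "y \<in> pts d \<Longrightarrow> rejection_rounds (gaussian d (xhat y) h) (accept_prob y)"
  using prob_algebraD(1)[OF gaussian_prob_algebra] accept_prob_le_1
  by (intro rejection_rounds.intro rejection_rounds_axioms.intro)
    (auto simp: measurable_cong_sets[OF sets_gaussian refl] accept_prob_def)

lemma rate_eq: "y \<in> pts d \<Longrightarrow> rejection_rounds.rate (gaussian d (xhat y) h) (accept_prob y) = accept_rate y"
proof -
  assume y: "y \<in> pts d"
  interpret R: rejection_rounds "gaussian d (xhat y) h" "accept_prob y" by (rule rejection_rounds[OF y])
  interpret mu: prob_space "P.mu y" by (rule P.prob_space_mu)
  have "(\<integral>\<^sup>+z. 1 \<partial>P.mu y) = 1" using mu.emeasure_space_1 by simp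
  then have "ennreal R.rate = ennreal (accept_rate y)"
    using nn_integral_accept_prob_gaussian[of "\<lambda>_. 1" y] R.nn_integral_a by simp
  then show ?thesis using R.rate_bounds accept_rate_pos[of y] by (simp add: ennreal_inj)
qed

text \<open>By \<open>prox_upper\<close> the conditional density dominates a Gaussian of variance
  \<open>v\<close>, with \<open>1 / v = \<beta> + 1 / h\<close>; the bound is the ratio of the two
  Gaussian masses.\<close>

lemma accept_rate_lower:
  assumes y: "y \<in> pts d"
  shows "(1 / (1 + \<beta> * h)) powr (real d / 2) \<le> accept_rate y"
proof -
  define v where "v = h / (1 + \<beta> * h)"
  have v: "0 < v" using step_pos \<beta>_pos by (simp add: v_def add_pos_pos)
  have "exp (- P.U y (xhat y)) * (2 * pi * v) powr (real d / 2) =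
    (\<integral>x. exp (- P.U y (xhat y)) * exp (- (edist d x (xhat y))\<^sup>2 / (2 * v)) \<partial>leb d)"
    using integral_gauss[OF v, of "xhat y"] by simp
  also have "\<dots> \<le> P.z y" unfolding P.z_def
  proof (rule integral_mono[OF _ P.integrable_exp_U])
    show "integrable (leb d) (\<lambda>x. exp (- P.U y (xhat y)) * exp (- (edist d x (xhat y))\<^sup>2 / (2 * v)))"
      using integrable_gauss[OF v, of "xhat y"] by simp
    fix x assume "x \<in> space (leb d)"
    then have x: "x \<in> pts d" by (simp add: space_leb)
    have "(\<beta> + 1 / h) / 2 = 1 / (2 * v)" using step_pos by (simp add: v_def field_simps)
    then have "P.U y x \<le> P.U y (xhat y) + (edist d x (xhat y))\<^sup>2 / (2 * v)"
      using prox_upper[OF step_pos y x] by simp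
    then show "exp (- P.U y (xhat y)) * exp (- (edist d x (xhat y))\<^sup>2 / (2 * v)) \<le> exp (- P.U y x)"
      unfolding exp_add[symmetric] by simp
  qed
  finally have "exp (P.U y (xhat y)) * (exp (- P.U y (xhat y)) * (2 * pi * v) powr (real d / 2)) / gauss_mass \<le>
    exp (P.U y (xhat y)) * P.z y / gauss_mass"
    using gauss_mass_pos by (intro divide_right_mono mult_left_mono) auto
  moreover have "exp (P.U y (xhat y)) * (exp (- P.U y (xhat y)) * (2 * pi * v) powr (real d / 2)) / gauss_mass
    = (1 / (1 + \<beta> * h)) powr (real d / 2)"
  proof -
    have "exp (P.U y (xhat y)) * (exp (- P.U y (xhat y)) * (2 * pi * v) powr (real d / 2)) / gauss_mass =
      (2 * pi * v) powr (real d / 2) / gauss_mass"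
      by (simp add: mult.assoc[symmetric] exp_add[symmetric])
    also have "\<dots> = ((2 * pi * v) / (2 * pi * h)) powr (real d / 2)"
      unfolding gauss_mass_def using v step_pos by (subst powr_divide) auto
    also have "(2 * pi * v) / (2 * pi * h) = 1 / (1 + \<beta> * h)" using step_pos by (simp add: v_def)
    finally show ?thesis .
  qed
  ultimately show ?thesis by (simp add: accept_rate_def)
qed

definition rejection_scheme where "rejection_scheme y = (gaussian d (xhat y) h, tree y)"

lemma rounds_R: "y \<in> pts d \<Longrightarrow> rounds (rejection_scheme y) =
  stream_space (gaussian d (xhat y) h \<Otimes>\<^sub>M rejection_rounds.unif)"
  unfolding rounds_def rejection_scheme_def by (simp add: rejection_rounds.unif_def[OF rejection_rounds])

lemma accepts_R: "y \<in> pts d \<Longrightarrow> accepts d V (rejection_scheme y) = rejection_rounds.acc (accept_prob y)"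
  unfolding accepts_def rejection_rounds.acc_def[OF rejection_rounds] rejection_scheme_def by (simp add: run_tree_tree)

lemma rejection_outcome_R: "rejection_outcome d V (rejection_scheme y) \<omega> =
    (let n = LEAST n. accepts d V (rejection_scheme y) (\<omega> !! n) in (fst (\<omega> !! n), Suc n, 0))"
  unfolding rejection_outcome_def by (simp add: rejection_scheme_def run_tree_tree Let_def)

end

locale restricted_gaussian_sampler = restricted_gaussian +
  fixes S :: sampler
  assumes rgo_S: "rgo S = rgo_query d h" and step_S: "step_size S = h"
begin

text \<open>The index \<open>n\<close> counts from 0, so \<open>n + 1\<close> rounds and the
  preparatory evaluation make \<open>Suc (Suc n)\<close> evaluations; the single proximal query is
  made in the preparation.\<close>

lemma rgo_law_eq: "rgo_law d V S y = distr (rounds (rejection_scheme y)) (run_space d)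
    (\<lambda>\<omega>. let n = LEAST n. accepts d V (rejection_scheme y) (\<omega> !! n) in (fst (\<omega> !! n), Suc (Suc n), 1))"
  unfolding rgo_law_def rgo_S run_rgo_query rejection_scheme_def[symmetric] by (simp add: rejection_outcome_R Let_def)

lemma outcome_measurable:
  assumes y: "y \<in> pts d"
  shows "(\<lambda>\<omega>. let n = LEAST n. accepts d V (rejection_scheme y) (\<omega> !! n) in (fst (\<omega> !! n), Suc (Suc n), 1 ::
    nat)) \<in> rounds (rejection_scheme y) \<rightarrow>\<^sub>M run_space d"
proof -
  interpret R: rejection_rounds "gaussian d (xhat y) h" "accept_prob y" by (rule rejection_rounds[OF y])
  let ?L = "\<lambda>\<omega>. LEAST n. R.acc (\<omega> !! n)"
  have L: "?L \<in> stream_space R.W \<rightarrow>\<^sub>M count_space UNIV" by measurable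
  have 1: "(\<lambda>\<omega>. fst (\<omega> !! ?L \<omega>)) \<in> stream_space R.W \<rightarrow>\<^sub>M leb d"
  proof (rule measurable_compose_countable[OF _ L])
    fix i
    have "(\<lambda>\<omega>. fst (\<omega> !! i)) \<in> stream_space R.W \<rightarrow>\<^sub>M gaussian d (xhat y) h" by measurable
    then show "(\<lambda>\<omega>. fst (\<omega> !! i)) \<in> stream_space R.W \<rightarrow>\<^sub>M leb d"
      by (simp add: measurable_cong_sets[OF refl sets_gaussian])
  qed
  have 2: "(\<lambda>\<omega>. Suc (Suc (?L \<omega>))) \<in> stream_space R.W \<rightarrow>\<^sub>M count_space UNIV"
    by (rule measurable_compose[OF L]) simp
  show ?thesis
    unfolding rounds_R[OF y] accepts_R[OF y] Let_def
    by (intro measurable_Pair 1 2) simp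
qed

lemma AE_accepts: "y \<in> pts d \<Longrightarrow> AE \<omega> in rounds (rejection_scheme y). \<exists>n. accepts d V (rejection_scheme y) (\<omega> !! n)"
proof -
  assume y: "y \<in> pts d"
  interpret R: rejection_rounds "gaussian d (xhat y) h" "accept_prob y" by (rule rejection_rounds[OF y])
  show ?thesis using R.AE_stops accept_rate_pos[of y] unfolding rounds_R[OF y] accepts_R[OF y] rate_eq[OF y] by simp
qed

text \<open>The accepted point has law \<open>mu y\<close> independently of the stopping index,
  which is geometric. Exactness, measurability in \<open>y\<close> and expected cost are all read
  off from this series.\<close>

lemma nn_integral_rgo_law:
  assumes y: "y \<in> pts d" and g [measurable]: "g \<in> borel_measurable (run_space d)"
  shows "(\<integral>\<^sup>+t. g t \<partial>rgo_law d V S y) = (\<Sum>n. ennreal ((1 - accept_rate y) ^ n) * ennreal (accept_rate y) *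
    (\<integral>\<^sup>+z. g (z, Suc (Suc n), 1) \<partial>P.mu y))"
proof -
  interpret R: rejection_rounds "gaussian d (xhat y) h" "accept_prob y" by (rule rejection_rounds[OF y])
  have gn: "(\<lambda>z. g (z, Suc (Suc n), 1)) \<in> borel_measurable (leb d)" for n by measurable
  have "(\<integral>\<^sup>+t. g t \<partial>rgo_law d V S y) = (\<integral>\<^sup>+\<omega>. g (let n =
    LEAST n. accepts d V (rejection_scheme y) (\<omega> !! n) in (fst (\<omega> !! n), Suc (Suc n), 1)) \<partial>rounds (rejection_scheme y))"
    unfolding rgo_law_eq by (rule nn_integral_distr[OF outcome_measurable[OF y]]) simp
  also have "\<dots> = (\<integral>\<^sup>+\<omega>. (let n = LEAST n. R.acc (\<omega> !! n) in g (fst (\<omega> !! n), Suc (Suc n), 1)) \<partial>stream_space R.W)"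
    unfolding rounds_R[OF y] accepts_R[OF y] by (simp add: Let_def)
  also have "\<dots> = (\<Sum>n. ennreal ((1 - R.rate) ^ n) * (\<integral>\<^sup>+z. ennreal (accept_prob y z) * g (z, Suc (Suc n), 1)
    \<partial>gaussian d (xhat y) h))"
    using accept_rate_pos[of y] gn
    by (intro R.nn_integral_outcome[of "\<lambda>n z. g (z, Suc (Suc n), 1)"]) (auto simp: rate_eq[OF y]
      measurable_cong_sets[OF sets_gaussian refl])
  finally show ?thesis unfolding rate_eq[OF y] nn_integral_accept_prob_gaussian[OF gn] by (simp add: mult.assoc)
qed

lemma prob_rgo_law: "y \<in> pts d \<Longrightarrow> prob_space (rgo_law d V S y)"
proof -
  assume y: "y \<in> pts d"
  interpret R: rejection_rounds "gaussian d (xhat y) h" "accept_prob y" by (rule rejection_rounds[OF y])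
  have "prob_space (rounds (rejection_scheme y))" unfolding rounds_R[OF y]
    by (rule prob_space.prob_space_stream_space[OF R.prob_W])
  then show ?thesis unfolding rgo_law_eq by (rule prob_space.prob_space_distr) (rule outcome_measurable[OF y])
qed

lemma sets_rgo_law [simp]: "sets (rgo_law d V S y) = sets (run_space d)"
  unfolding rgo_law_eq by simp

lemma suminf_accept_rate: "y \<in> pts d \<Longrightarrow> (\<Sum>n. ennreal ((1 - accept_rate y) ^ n) * ennreal (accept_rate y)) = 1"
  using rejection_rounds.suminf_geometric[OF rejection_rounds] accept_rate_pos[of y] by (simp add: rate_eq)

lemma rgo_law_fst:
  assumes y: "y \<in> pts d"
  shows "distr (rgo_law d V S y) (leb d) fst = P.mu y"
proof (rule measure_eqI)
  fix X assume "X \<in> sets (distr (rgo_law d V S y) (leb d) fst)"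
  then have X [measurable]: "X \<in> sets (leb d)" by simp
  have f: "fst \<in> rgo_law d V S y \<rightarrow>\<^sub>M leb d" by (simp add: measurable_cong_sets[OF sets_rgo_law refl])
  have "emeasure (distr (rgo_law d V S y) (leb d) fst) X = (\<integral>\<^sup>+t. indicator X (fst t) \<partial>rgo_law d V S y)"
    using nn_integral_distr[OF f, of "indicator X"] by simp
  also have "\<dots> = (\<Sum>n. ennreal ((1 - accept_rate y) ^ n) * ennreal (accept_rate y) * (\<integral>\<^sup>+z. indicator X z \<partial>P.mu y))"
    by (subst nn_integral_rgo_law[OF y]) auto
  also have "\<dots> = (\<Sum>n. ennreal ((1 - accept_rate y) ^ n) * ennreal (accept_rate y)) * (\<integral>\<^sup>+z. indicator X z \<partial>P.mu y)"
    by (rule ennreal_suminf_multc)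
  finally show "emeasure (distr (rgo_law d V S y) (leb d) fst) X = emeasure (P.mu y) X"
    using suminf_accept_rate[OF y] by simp
qed simp

lemma accept_rate_measurable [measurable]: "accept_rate \<in> borel_measurable (leb d)"
proof -
  interpret product_sigma_finite "\<lambda>_::nat. lborel :: real measure" by standard
  interpret L: sigma_finite_measure "leb d" by (rule sigma_finite) auto
  note [measurable] = prox_measurable[OF step_pos]
  have "(\<lambda>y. P.U y (xhat y)) \<in> borel_measurable (leb d)" unfolding regularized_def by measurable
  moreover have "P.z \<in> borel_measurable (leb d)" unfolding P.z_def[abs_def] by measurable
  ultimately show ?thesis unfolding accept_rate_def[abs_def] by measurable
qed

lemma rgo_kernel [measurable]: "rgo_law d V S \<in> leb d \<rightarrow>\<^sub>M prob_algebra (run_space d)"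
proof (rule measurable_prob_algebraI)
  show p: "prob_space (rgo_law d V S y)" if "y \<in> space (leb d)" for y using prob_rgo_law that by (simp add: space_leb)
  show "rgo_law d V S \<in> leb d \<rightarrow>\<^sub>M subprob_algebra (run_space d)"
  proof (rule measurable_subprob_algebra)
    show "subprob_space (rgo_law d V S y)" if "y \<in> space (leb d)" for y
      by (rule prob_space_imp_subprob_space[OF p[OF that]])
    show "sets (rgo_law d V S y) = sets (run_space d)" for y by simp
    fix X assume X [measurable]: "X \<in> sets (run_space d)"
    have "emeasure (rgo_law d V S y) X = (\<Sum>n. ennreal ((1
      - accept_rate y) ^ n) * ennreal (accept_rate y) * (\<integral>\<^sup>+z. indicator X (z, Suc (Suc n), 1) \<partial>P.mu y))"
      if "y \<in> space (leb d)" for y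
      using nn_integral_rgo_law[of y "indicator X"] that by (simp add: space_leb)
    then have "(\<lambda>y. emeasure (rgo_law d V S y) X) \<in> borel_measurable (leb d) \<longleftrightarrow>
      (\<lambda>y. \<Sum>n. ennreal ((1 - accept_rate y) ^ n) * ennreal (accept_rate y) * (\<integral>\<^sup>+z. indicator X (z, Suc (Suc
        n), 1) \<partial>P.mu y)) \<in> borel_measurable (leb d)"
      by (rule measurable_cong)
    moreover have [measurable]: "(\<lambda>y. \<integral>\<^sup>+z. indicator X (z, Suc (Suc n), 1 :: nat) \<partial>P.mu y) \<in>
      borel_measurable (leb d)" for n
    proof -
      have "(\<lambda>z. indicator X (z, Suc (Suc n), 1 :: nat) :: ennreal) \<in> borel_measurable (leb d)" by measurable
      from measurable_compose[OF measurable_prob_algebraD[OF P.mu_kernel]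
        nn_integral_measurable_subprob_algebra[OF this]]
      show ?thesis .
    qed
    have "(\<lambda>y. \<Sum>n. ennreal ((1 - accept_rate y) ^ n) * ennreal (accept_rate y) * (\<integral>\<^sup>+z. indicator X (z, Suc
      (Suc n), 1) \<partial>P.mu y)) \<in> borel_measurable (leb d)"
      by measurable
    ultimately show "(\<lambda>y. emeasure (rgo_law d V S y) X) \<in> borel_measurable (leb d)" by simp
  qed
qed

lemma implements:
  assumes "initial_law S \<in> space (prob_algebra (leb d))"
  shows "implements_proximal_sampler d V S"
proof -
  have "fst (run_tree d V (rgo S y)) = rejection_scheme y" for y by (simp add: rgo_S run_rgo_query rejection_scheme_def)
  moreover have "fst (rejection_scheme y) = gaussian d (xhat y) h" for y by (simp add: rejection_scheme_def)
  ultimately show ?thesis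
    unfolding implements_proximal_sampler_def
    using assms step_pos rgo_kernel rgo_law_fst AE_accepts gaussian_prob_algebra by (simp add: step_S)
qed

lemma rgo_evaluations:
  assumes y: "y \<in> pts d"
  shows "(\<integral>\<^sup>+(x, e, p). of_nat e \<partial>rgo_law d V S y) = ennreal (1 + 1 / accept_rate y)"
    and "(\<integral>\<^sup>+(x, e, p). of_nat p \<partial>rgo_law d V S y) = 1"
proof -
  interpret mu: prob_space "P.mu y" by (rule P.prob_space_mu)
  have one: "emeasure (P.mu y) (pts d) = 1" using mu.emeasure_space_1 by simp
  have "(\<integral>\<^sup>+(x, e, p). of_nat e \<partial>rgo_law d V S y) =
    (\<Sum>n. ennreal ((1 - accept_rate y) ^ n) * ennreal (accept_rate y) * of_nat (Suc (Suc n)))"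
    by (subst nn_integral_rgo_law[OF y]) (auto simp: one simp del: of_nat_Suc)
  also have "\<dots> = (\<Sum>n. ennreal ((1 - accept_rate y) ^ n) * ennreal (accept_rate y) + ennreal ((1
    - accept_rate y) ^ n) * ennreal (accept_rate y) * of_nat (Suc n))"
    by (intro suminf_cong) (simp add: distrib_left add.commute)
  also have "\<dots> = (\<Sum>n. ennreal ((1 - accept_rate y) ^ n) * ennreal (accept_rate y)) + (\<Sum>n. ennreal ((1
    - accept_rate y) ^ n) * ennreal (accept_rate y) * of_nat (Suc n))"
    by (rule suminf_add[symmetric]) auto
  also have "\<dots> = 1 + ennreal (1 / accept_rate y)"
    using rejection_rounds.suminf_waiting_time[OF rejection_rounds[OF y]] accept_rate_pos[of y]
      suminf_accept_rate[OF y] by (simp add: rate_eq[OF y] del: of_nat_Suc)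
  also have "\<dots> = ennreal (1 + 1 / accept_rate y)" using accept_rate_pos[of y] by (subst ennreal_plus) auto
  finally show "(\<integral>\<^sup>+(x, e, p). of_nat e \<partial>rgo_law d V S y) = ennreal (1 + 1 / accept_rate y)" .
  show "(\<integral>\<^sup>+(x, e, p). of_nat p \<partial>rgo_law d V S y) = 1"
    using suminf_accept_rate[OF y] by (subst nn_integral_rgo_law[OF y]) (auto simp: one)
qed

section \<open>Expected number of queries of a whole run\<close>

definition step_kernel where "step_kernel t = gaussian d (fst t) h \<bind> (\<lambda>y. rgo_law d V S y \<bind>
    (\<lambda>r. return (run_space d) (fst r, fst (snd t) + fst (snd r), snd (snd t) + snd (snd r))))"

lemma run_law_Suc: "run_law d V S e p (Suc k) = run_law d V S e p k \<bind> step_kernel"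
  by (simp add: step_kernel_def[abs_def] case_prod_unfold step_S)

lemma gaussian_kernel: "(\<lambda>x. gaussian d x h) \<in> leb d \<rightarrow>\<^sub>M prob_algebra (leb d)"
  using P.gauss.mu_kernel by (simp only: P.gauss_mu)

lemma return_kernel:
  "(\<lambda>q. return (run_space d) (fst (snd q), fst (snd (fst q)) + fst (snd (snd q)), snd (snd (fst q))
    + snd (snd (snd q))))
    \<in> run_space d \<Otimes>\<^sub>M run_space d \<rightarrow>\<^sub>M prob_algebra (run_space d)"
proof (rule measurable_compose[OF _ measurable_return_prob_space])
  show "(\<lambda>q. (fst (snd q), fst (snd (fst q)) + fst (snd (snd q)), snd (snd (fst q)) + snd (snd (snd q))))
    \<in> run_space d \<Otimes>\<^sub>M run_space d \<rightarrow>\<^sub>M run_space d"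
    by (intro measurable_Pair measurable_plus_nat) measurable
qed

lemma inner_kernel:
  "(\<lambda>q. rgo_law d V S (snd q) \<bind> (\<lambda>r. return (run_space d) (fst r, fst (snd (fst q))
    + fst (snd r), snd (snd (fst q)) + snd (snd r))))
    \<in> run_space d \<Otimes>\<^sub>M leb d \<rightarrow>\<^sub>M prob_algebra (run_space d)"
proof (rule measurable_bind_prob_space2)
  show "(\<lambda>q. rgo_law d V S (snd q)) \<in> run_space d \<Otimes>\<^sub>M leb d \<rightarrow>\<^sub>M prob_algebra (run_space d)"
    by (rule measurable_compose[OF measurable_snd rgo_kernel])
  have "(\<lambda>q. (fst (fst q), snd q)) \<in> (run_space d \<Otimes>\<^sub>M leb d) \<Otimes>\<^sub>M run_space d \<rightarrow>\<^sub>M run_space d \<Otimes>\<^sub>M run_space d"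
    by measurable
  from measurable_compose[OF this return_kernel]
  show "(\<lambda>(q, r). return (run_space d) (fst r, fst (snd (fst q)) + fst (snd r), snd (snd (fst q)) + snd (snd r)))
      \<in> (run_space d \<Otimes>\<^sub>M leb d) \<Otimes>\<^sub>M run_space d \<rightarrow>\<^sub>M prob_algebra (run_space d)"
    by (simp add: case_prod_unfold)
qed

lemma step_kernel_measurable: "step_kernel \<in> run_space d \<rightarrow>\<^sub>M prob_algebra (run_space d)"
  unfolding step_kernel_def[abs_def]
  by (rule measurable_bind_prob_space2[OF measurable_compose[OF measurable_fst gaussian_kernel]])
    (use inner_kernel in \<open>simp add: case_prod_unfold\<close>)

lemma nn_integral_step_kernel:
  assumes t: "t \<in> space (run_space d)" and F [measurable]: "F \<in> borel_measurable (run_space d)"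
  shows "(\<integral>\<^sup>+u. F u \<partial>step_kernel t) = (\<integral>\<^sup>+y. \<integral>\<^sup>+r. F (fst r, fst (snd t) + fst (snd r), snd (snd t)
    + snd (snd r)) \<partial>rgo_law d V S y \<partial>gaussian d (fst t) h)"
proof -
  let ?ret = "\<lambda>r. return (run_space d) (fst r, fst (snd t) + fst (snd r), snd (snd t) + snd (snd r))"
  have 1: "(\<lambda>y. rgo_law d V S y \<bind> ?ret) \<in> gaussian d (fst t) h \<rightarrow>\<^sub>M subprob_algebra (run_space d)"
    using measurable_prob_algebraD[OF measurable_compose[OF measurable_Pair1'[OF t, of "leb d"] inner_kernel]]
    by (simp add: measurable_cong_sets[OF sets_gaussian refl])
  have 2: "?ret \<in> rgo_law d V S y \<rightarrow>\<^sub>M subprob_algebra (run_space d)" for y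
    using measurable_prob_algebraD[OF measurable_compose[OF measurable_Pair1'[OF t, of "run_space d"] return_kernel]]
    by (simp add: measurable_cong_sets[OF sets_rgo_law refl])
  have "(\<integral>\<^sup>+u. F u \<partial>step_kernel t) = (\<integral>\<^sup>+y. \<integral>\<^sup>+u. F u \<partial>(rgo_law d V S y \<bind> ?ret) \<partial>gaussian d (fst t) h)"
    unfolding step_kernel_def by (rule nn_integral_bind[OF F 1])
  also have "\<dots> = (\<integral>\<^sup>+y. \<integral>\<^sup>+r. \<integral>\<^sup>+u. F u \<partial>?ret r \<partial>rgo_law d V S y \<partial>gaussian d (fst t) h)"
    by (intro nn_integral_cong nn_integral_bind[OF F 2])
  also have "\<dots> = (\<integral>\<^sup>+y. \<integral>\<^sup>+r. F (fst r, fst (snd t) + fst (snd r), snd (snd t)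
    + snd (snd r)) \<partial>rgo_law d V S y \<partial>gaussian d (fst t) h)"
  proof (intro nn_integral_cong nn_integral_return F)
    fix y r assume "r \<in> space (rgo_law d V S y)"
    then have "fst r \<in> space (leb d)" using sets_eq_imp_space_eq[OF sets_rgo_law[of y]]
      by (auto simp: space_pair_measure)
    then show "(fst r, fst (snd t) + fst (snd r), snd (snd t) + snd (snd r)) \<in> space (run_space d)"
      by (simp add: space_pair_measure)
  qed
  finally show ?thesis .
qed

lemma run_law_prob_algebra:
  assumes i: "initial_law S \<in> space (prob_algebra (leb d))"
  shows "run_law d V S e p k \<in> space (prob_algebra (run_space d))"
proof (induction k)
  case 0
  have "(\<lambda>x. (x, e, p)) \<in> leb d \<rightarrow>\<^sub>M run_space d" by measurable
  from measurable_space[OF measurable_distr_prob_space[OF this] i] show ?case by simp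
next
  case (Suc k)
  show ?case unfolding run_law_Suc
    using measurable_space[OF measurable_bind_prob_space[OF measurable_const[OF Suc] step_kernel_measurable],
      of undefined "count_space UNIV"] by simp
qed

text \<open>The function \<open>sel\<close> stands for either query counter; additivity lets one
  induction serve both. The cost bound is uniform in \<open>y\<close>, so the law of the iterates
  does not matter.\<close>

lemma expected_cost:
  fixes sel :: "point \<times> nat \<times> nat \<Rightarrow> nat"
  assumes i: "initial_law S \<in> space (prob_algebra (leb d))"
    and sel [measurable]: "sel \<in> run_space d \<rightarrow>\<^sub>M count_space UNIV"
    and add: "\<And>t r. sel (fst r, fst (snd t) + fst (snd r), snd (snd t) + snd (snd r)) = sel t + sel r"
    and const: "\<And>x. sel (x, e, p) = n"
    and le: "\<And>y. y \<in> pts d \<Longrightarrow> (\<integral>\<^sup>+r. of_nat (sel r) \<partial>rgo_law d V S y) \<le> ennreal K" and K: "0 \<le> K"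
  shows "(\<integral>\<^sup>+t. of_nat (sel t) \<partial>run_law d V S e p k) \<le> ennreal (real n + real k * K)"
proof (induction k)
  case 0
  interpret I: prob_space "initial_law S" using prob_algebraD(1)[OF i] .
  have m: "(\<lambda>x. (x, e, p)) \<in> initial_law S \<rightarrow>\<^sub>M run_space d"
    by (simp add: measurable_cong_sets[OF prob_algebraD(2)[OF i] refl])
  have "(\<integral>\<^sup>+t. of_nat (sel t) \<partial>run_law d V S e p 0) = (\<integral>\<^sup>+x. of_nat n \<partial>initial_law S)"
    unfolding run_law.simps by (subst nn_integral_distr[OF m]) (auto simp: const)
  then show ?case using I.emeasure_space_1 by (simp add: ennreal_of_nat_eq_real_of_nat)
next
  case (Suc k)
  note L = run_law_prob_algebra[OF i, of e p k]
  interpret L: prob_space "run_law d V S e p k" using prob_algebraD(1)[OF L] .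
  have F [measurable]: "(\<lambda>t. of_nat (sel t) :: ennreal) \<in> borel_measurable (run_space d)" by measurable
  have K': "step_kernel \<in> run_law d V S e p k \<rightarrow>\<^sub>M subprob_algebra (run_space d)"
    using measurable_prob_algebraD[OF step_kernel_measurable]
      by (simp add: measurable_cong_sets[OF prob_algebraD(2)[OF L] refl])
  have step: "(\<integral>\<^sup>+u. of_nat (sel u) \<partial>step_kernel t) \<le> of_nat (sel t) + ennreal K" if t: "t \<in>
    space (run_law d V S e p k)" for t
  proof -
    have t': "t \<in> space (run_space d)" using t prob_algebraD(3)[OF L] by simp
    interpret G: prob_space "gaussian d (fst t) h" using prob_algebraD(1)[OF gaussian_prob_algebra] .
    have "(\<integral>\<^sup>+u. of_nat (sel u) \<partial>step_kernel t) =
      (\<integral>\<^sup>+y. \<integral>\<^sup>+r. of_nat (sel t) + of_nat (sel r) \<partial>rgo_law d V S y \<partial>gaussian d (fst t) h)"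
      unfolding nn_integral_step_kernel[OF t' F] add by simp
    also have "\<dots> \<le> (\<integral>\<^sup>+y. of_nat (sel t) + ennreal K \<partial>gaussian d (fst t) h)"
    proof (rule nn_integral_mono)
      fix y assume "y \<in> space (gaussian d (fst t) h)"
      then have y: "y \<in> pts d" by simp
      interpret Y: prob_space "rgo_law d V S y" by (rule prob_rgo_law[OF y])
      have "(\<integral>\<^sup>+r. of_nat (sel t) + of_nat (sel r) \<partial>rgo_law d V S y) =
        (\<integral>\<^sup>+r. of_nat (sel t) \<partial>rgo_law d V S y) + (\<integral>\<^sup>+r. of_nat (sel r) \<partial>rgo_law d V S y)"
        by (rule nn_integral_add) (auto simp: measurable_cong_sets[OF sets_rgo_law refl])
      then show "(\<integral>\<^sup>+r. of_nat (sel t) + of_nat (sel r) \<partial>rgo_law d V S y) \<le> of_nat (sel t) + ennreal K"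
        using le[OF y] Y.emeasure_space_1 by (simp add: add_left_mono)
    qed
    finally show ?thesis using G.emeasure_space_1 by simp
  qed
  have "(\<integral>\<^sup>+t. of_nat (sel t) \<partial>run_law d V S e p (Suc k)) =
    (\<integral>\<^sup>+t. \<integral>\<^sup>+u. of_nat (sel u) \<partial>step_kernel t \<partial>run_law d V S e p k)"
    unfolding run_law_Suc by (rule nn_integral_bind[OF F K'])
  also have "\<dots> \<le> (\<integral>\<^sup>+t. of_nat (sel t) + ennreal K \<partial>run_law d V S e p k)" by (rule nn_integral_mono[OF step])
  also have "\<dots> = (\<integral>\<^sup>+t. of_nat (sel t) \<partial>run_law d V S e p k) + ennreal K"
    using L.emeasure_space_1 by (subst nn_integral_add) (auto simp: measurable_cong_sets[OF prob_algebraD(2)[OF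
      L] refl])
  also have "\<dots> \<le> ennreal (real n + real k * K) + ennreal K" by (intro add_right_mono Suc)
  also have "\<dots> = ennreal (real n + real (Suc k) * K)"
    using K by (simp add: ennreal_plus[symmetric] algebra_simps del: ennreal_plus)
  finally show ?case .
qed

end

section \<open>Complexity of the proximal sampler\<close>

text \<open>The first proximal point \<open>x1\<close> of the origin satisfies \<open>|x1 - xmin| \<le> |x1| / \<alpha>\<close>, and a proximal step of size
  \<open>s\<close> contracts squared distances to \<open>xmin\<close> by \<open>1 / (1 + 2 * \<alpha> * s)\<close>; \<open>start_step\<close> is therefore large enough for
  the second proximal point to be within \<open>1 / sqrt \<alpha>\<close> of \<open>xmin\<close>, however far \<open>xmin\<close> is from the origin.\<close>

definition warm_start :: "nat \<Rightarrow> real \<Rightarrow> (point \<Rightarrow> 'r) \<Rightarrow> 'r query_tree" where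
  "warm_start d \<alpha> f = Proximal 1 (\<lambda>i\<in>{..<d}. 0) (\<lambda>x1. Proximal (start_step d \<alpha> x1) x1 (\<lambda>x0. Return (f x0)))"

text \<open>The three summands of \<open>n / k\<close> pay for the constant 5, for
  \<open>k^2\<close> and for \<open>q / \<epsilon>\<close> respectively.\<close>

lemma iteration_count:
  fixes k q \<epsilon> :: real
  assumes k: "1 \<le> k" and q: "0 < q" and \<epsilon>: "0 < \<epsilon>"
    and n: "k * (2 + 2 * ln k + ln (q / \<epsilon>)) \<le> real n"
  shows "5 * q * k\<^sup>2 * (1 / (1 + 1 / k)\<^sup>2) ^ n \<le> \<epsilon>"
proof -
  \<comment> \<open>The square in the contraction factor yields the clean rate
    \<open>exp (- n / k)\<close> from a second-order bound of exp alone.\<close>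
  have "exp (1 / k) \<le> 1 + 1 / k + (1 / k)\<^sup>2" using k by (intro exp_bound) auto
  also have "\<dots> \<le> (1 + 1 / k)\<^sup>2" using k by (simp add: power2_sum divide_right_mono)
  finally have "1 / (1 + 1 / k)\<^sup>2 \<le> 1 / exp (1 / k)" using k
    by (intro divide_left_mono mult_pos_pos zero_less_power add_pos_pos) auto
  then have "(1 / (1 + 1 / k)\<^sup>2) ^ n \<le> (1 / exp (1 / k)) ^ n" by (intro power_mono) auto
  also have "\<dots> = exp (- (real n / k))"
    by (simp add: power_divide exp_of_nat_mult[symmetric] exp_minus inverse_eq_divide)
  also have "\<dots> \<le> exp (- (2 + 2 * ln k + ln (q / \<epsilon>)))" using n k by (simp add: field_simps)
  also have "\<dots> = \<epsilon> / (exp 2 * k\<^sup>2 * q)"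
  proof -
    have "exp (2 + 2 * ln k + ln (q / \<epsilon>)) = exp 2 * (exp (ln k) * exp (ln k)) * exp (ln (q / \<epsilon>))"
      by (simp add: exp_add[symmetric])
    also have "\<dots> = exp 2 * k\<^sup>2 * (q / \<epsilon>)" using k q \<epsilon> by (simp add: power2_eq_square)
    finally show ?thesis unfolding exp_minus by (simp add: inverse_eq_divide)
  qed
  finally have "5 * q * k\<^sup>2 * (1 / (1 + 1 / k)\<^sup>2) ^ n \<le> 5 * q * k\<^sup>2 * (\<epsilon> / (exp 2 * k\<^sup>2 * q))"
    using q by (intro mult_left_mono) auto
  also have "\<dots> = 5 / exp 2 * \<epsilon>" using k q by simp
  \<comment> \<open>The quadratic Taylor polynomial of exp at 2 equals 5, which matches the constant
    5.\<close>
  also have "\<dots> \<le> 1 * \<epsilon>"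
    using exp_lower_Taylor_quadratic[of 2] \<epsilon> by (intro mult_right_mono) auto
  finally show ?thesis by simp
qed

text \<open>With \<open>\<beta> * h = 1 / d\<close> the exponent \<open>d / 2\<close> is offset by
  \<open>ln (1 + 1 / d) \<le> 1 / d\<close>, so the acceptance rate has a dimension-free lower
  bound.\<close>

lemma half_le_powr:
  assumes "1 \<le> d"
  shows "1 / 2 \<le> (1 / (1 + 1 / real d)) powr (real d / 2)"
proof -
  have d: "0 < real d" using assms by simp
  have "ln (1 + 1 / real d) \<le> 1 / real d" using d by (intro ln_add_one_self_le_self) simp
  then have "real d / 2 * ln (1 + 1 / real d) \<le> real d / 2 * (1 / real d)" by (intro mult_left_mono) auto
  then have "exp (real d / 2 * ln (1 + 1 / real d)) \<le> exp (1 / 2)" using d by simp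
  also have "\<dots> \<le> 2" using exp_half_le2 by simp
  finally have "(1 + 1 / real d) powr (real d / 2) \<le> 2" using d
    by (simp add: powr_def add_pos_pos[THEN less_imp_neq[symmetric]])
  moreover have "0 < (1 + 1 / real d) powr (real d / 2)" using d
    by (simp add: add_pos_pos[THEN less_imp_neq[symmetric]])
  moreover have "(1 / (1 + 1 / real d)) powr (real d / 2) = 1 / (1 + 1 / real d) powr (real d / 2)"
    using d by (simp add: powr_divide add_nonneg_nonneg)
  ultimately show ?thesis using divide_left_mono[of "(1 + 1 / real d) powr (real d / 2)" 2 1] by simp
qed

text \<open>The choice of \<open>h\<close> makes \<open>\<alpha> * h = 1 / k\<close>, so the one
  parameter \<open>k\<close> governs the contraction. The maximum with 1 in \<open>l\<close> keeps
  the budget meaningful for large \<epsilon>.\<close>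

lemma smooth_convex_attains:
  assumes SC: "smooth_convex d \<alpha> \<beta> V" and d: "1 \<le> d" and q: "1 < q" and \<epsilon>: "0 < \<epsilon>"
  defines "k \<equiv> \<beta> / \<alpha> * real d"
  defines "l \<equiv> max 1 (ln (q / \<epsilon>))"
  defines "h \<equiv> 1 / (\<beta> * real d)"
  defines "N \<equiv> Suc (nat \<lceil>k * (2 + 2 * ln k + l)\<rceil>)"
  shows "attains d V (warm_start d \<alpha> (\<lambda>x0. Sampler (return (leb d) x0) h N (rgo_query d h))) q \<epsilon>
    (20 * (k * l) * (1 + ln (k * l)))"
proof -
  interpret smooth_convex d \<alpha> \<beta> V by (rule SC)
  have h: "0 < h" using \<beta>_pos d by (simp add: h_def)
  have k: "1 \<le> k" unfolding k_def
    using \<alpha>_le_\<beta>[OF d] \<alpha>_pos d mult_mono[of 1 "\<beta> / \<alpha>" 1 "real d"] by simp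
  have l: "1 \<le> l" "ln (q / \<epsilon>) \<le> l" by (auto simp: l_def)
  define b where "b = k * l"
  define n where "n = nat \<lceil>k * (2 + 2 * ln k + l)\<rceil>"
  define x1 where "x1 = prox 1 (\<lambda>i\<in>{..<d}. 0)"
  define x0 where "x0 = prox (start_step d \<alpha> x1) x1"
  define S where "S = Sampler (return (leb d) x0) h N (rgo_query d h)"
  note start = start_point[folded x1_def, folded x0_def]
  have x0: "x0 \<in> pts d" unfolding x0_def by (rule prox_min(1)[OF start(2) start(1)])
  have run: "run_tree d V (warm_start d \<alpha> (\<lambda>x0. Sampler (return (leb d) x0) h N (rgo_query d h))) = (S, 0, 2)"
    by (simp add: warm_start_def S_def x0_def x1_def)
  interpret restricted_gaussian_sampler d \<alpha> \<beta> V h S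
    by (intro restricted_gaussian_sampler.intro restricted_gaussian.intro SC
        restricted_gaussian_axioms.intro restricted_gaussian_sampler_axioms.intro h) (simp_all add: S_def)
  have init: "initial_law S \<in> space (prob_algebra (leb d))"
    using x0 by (simp add: S_def space_prob_algebra space_leb prob_space_return)

  have pos: "0 \<le> k * (2 + 2 * ln k + l)" using k l by (intro mult_nonneg_nonneg add_nonneg_nonneg) auto
  have n_ge: "k * (2 + 2 * ln k + l) \<le> real n" unfolding n_def by (rule real_nat_ceiling_ge)
  have n_le: "real n \<le> k * (2 + 2 * ln k + l) + 1" using pos unfolding n_def by linarith
  have N: "N = Suc n" by (simp add: N_def n_def)

  have moment: "integrable (gibbs d V) (\<lambda>x. (edist d x0 x)\<^sup>2)"
      "(\<integral>x. (edist d x0 x)\<^sup>2 \<partial>gibbs d V) \<le> 10 * real d * (\<beta> / \<alpha>) / \<alpha>"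
    by (rule second_moment[OF d start(3)])+
  have contr: "P.contraction = 1 / (1 + 1 / k)\<^sup>2"
    unfolding P.contraction_def using \<alpha>_pos \<beta>_pos d by (simp add: h_def k_def)
  have "renyi q (proximal_law d V h (return (leb d) x0) N) (gibbs d V)
      \<le> ereal (q * P.contraction ^ n / (2 * h) * (\<integral>x. (edist d x0 x)\<^sup>2 \<partial>gibbs d V))"
    unfolding N by (rule P.renyi_proximal_law[OF x0 q moment(1)])
  also have "\<dots> \<le> ereal (q * P.contraction ^ n / (2 * h) * (10 * real d * (\<beta> / \<alpha>) / \<alpha>))"
    using moment(2) q h by (simp only: ereal_less_eq) (intro mult_left_mono, auto simp: contr)
  \<comment> \<open>Since \<open>1 / h = \<beta> * d\<close>, the prefactor and the second moment
    each contribute one factor \<open>k\<close>, after sharing the powers of \<alpha> and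
    \<beta>.\<close>
  also have "q * P.contraction ^ n / (2 * h) * (10 * real d * (\<beta> / \<alpha>) / \<alpha>) = 5 * q * k\<^sup>2 * (1 / (1 + 1 / k)\<^sup>2) ^ n"
  proof -
    have "q * w / (2 * h) * (10 * real d * (\<beta> / \<alpha>) / \<alpha>) = 5 * q * k\<^sup>2 * w" for w
      unfolding h_def k_def using \<alpha>_pos \<beta>_pos d by (simp add: power2_eq_square field_simps)
    then show ?thesis unfolding contr .
  qed
  also have "\<dots> \<le> \<epsilon>"
  proof (rule iteration_count[OF k _ \<epsilon>])
    have "k * (2 + 2 * ln k + ln (q / \<epsilon>)) \<le> k * (2 + 2 * ln k + l)" using k l by (intro mult_left_mono) auto
    then show "k * (2 + 2 * ln k + ln (q / \<epsilon>)) \<le> real n" using n_ge by linarith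
  qed (use q in simp)
  finally have renyi: "renyi q (proximal_law d V h (return (leb d) x0) N) (gibbs d V) \<le> ereal \<epsilon>" by simp

  \<comment> \<open>One preparatory evaluation plus at most two expected rounds.\<close>
  have evals: "(\<integral>\<^sup>+r. of_nat (fst (snd r)) \<partial>rgo_law d V S y) \<le> ennreal 3" if y: "y \<in> pts d" for y
  proof -
    have "\<beta> * h = 1 / real d" using \<beta>_pos by (simp add: h_def)
    then have "1 / 2 \<le> accept_rate y" using half_le_powr[OF d] accept_rate_lower[OF y] by simp
    then have "1 / accept_rate y \<le> 2" by (simp add: field_simps)
    then have "ennreal (1 + 1 / accept_rate y) \<le> ennreal 3" by (intro ennreal_leI) simp
    then show ?thesis using rgo_evaluations(1)[OF y] by (simp add: case_prod_unfold)
  qed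
  have proxs: "(\<integral>\<^sup>+r. of_nat (snd (snd r)) \<partial>rgo_law d V S y) \<le> ennreal 1" if y: "y \<in> pts d" for y
    using rgo_evaluations(2)[OF y] by (simp add: case_prod_unfold)
  have E: "(\<integral>\<^sup>+t. of_nat (fst (snd t)) \<partial>run_law d V S 0 2 N) \<le> ennreal (real 0 + real N * 3)"
    by (rule expected_cost[OF init, where sel = "\<lambda>t. fst (snd t)"]) (use evals in auto)
  have Q: "(\<integral>\<^sup>+t. of_nat (snd (snd t)) \<partial>run_law d V S 0 2 N) \<le> ennreal (real 2 + real N * 1)"
    by (rule expected_cost[OF init, where sel = "\<lambda>t. snd (snd t)"]) (use proxs in auto)

  have kb: "k \<le> b" unfolding b_def using k l mult_left_mono[of 1 l k] by simp
  have b: "1 \<le> b" using k kb by simp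
  \<comment> \<open>Replacing \<open>k\<close> by the larger \<open>b\<close> lets a single
    expression bound all terms of the iteration count; the generous factor 20 also covers the two
    warm-start queries.\<close>
  have "k * ln k \<le> b * ln b" using k kb b by (intro mult_mono) auto
  then have "real N \<le> 2 + 3 * b + 2 * (b * ln b)"
    using n_le kb unfolding N by (simp add: distrib_left b_def)
  moreover have "0 \<le> b * ln b" using b by simp
  ultimately have "real N * 3 \<le> 20 * b * (1 + ln b)" "2 + real N \<le> 20 * b * (1 + ln b)"
    using b unfolding distrib_left mult_1_right mult.assoc by linarith+
  then have "ennreal (real 0 + real N * 3) \<le> ennreal (20 * b * (1 + ln b))"
      "ennreal (real 2 + real N * 1) \<le> ennreal (20 * b * (1 + ln b))"
    by (simp_all only: of_nat_0 of_nat_numeral mult_1_right add_0_left ennreal_leI)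
  then show ?thesis
    unfolding attains_def run b_def[symmetric]
    using implements[OF init] renyi order_trans[OF E] order_trans[OF Q]
    by (simp add: S_def[symmetric] case_prod_unfold) (simp add: S_def)
qed

theorem proposition3p2:
  shows "\<exists>(C::real) (m::nat). C > 0 \<and>
    (\<forall>(d::nat) (\<alpha>::real) (\<beta>::real) (q::real) (\<epsilon>::real).
       d \<ge> 1 \<and> \<alpha> > 0 \<and> \<beta> > 0 \<and> q > 1 \<and> \<epsilon> > 0 \<longrightarrow>
       (\<exists>A :: sampler query_tree. \<forall>V :: point \<Rightarrow> real.
          strongly_convex d \<alpha> V \<and> smooth d \<beta> V \<longrightarrow>
          (let b = (\<beta> / \<alpha>) * real d * max 1 (ln (q / \<epsilon>))
           in attains d V A q \<epsilon> (C * b * (1 + ln b) ^ m))))"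
\<comment> \<open>One logarithmic factor suffices: it comes from the polynomial prefactor
  \<open>k^2\<close> in the divergence bound.\<close>
proof (intro exI[of _ "20 :: real"] exI[of _ "1 :: nat"] conjI allI impI)
  fix d :: nat and \<alpha> \<beta> q \<epsilon> :: real
  assume *: "1 \<le> d \<and> 0 < \<alpha> \<and> 0 < \<beta> \<and> 1 < q \<and> 0 < \<epsilon>"
  let ?h = "1 / (\<beta> * real d)" and ?k = "\<beta> / \<alpha> * real d"
  let ?N = "Suc (nat \<lceil>?k * (2 + 2 * ln ?k + max 1 (ln (q / \<epsilon>)))\<rceil>)"
  show "\<exists>A :: sampler query_tree. \<forall>V. strongly_convex d \<alpha> V \<and> smooth d \<beta> V \<longrightarrow>
      (let b = \<beta> / \<alpha> * real d * max 1 (ln (q / \<epsilon>)) in attains d V A q \<epsilon> (20 * b * (1 + ln b) ^ 1))"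
    unfolding Let_def power_one_right
  proof (intro exI[of _ "warm_start d \<alpha> (\<lambda>x0. Sampler (return (leb d) x0) ?h ?N (rgo_query d ?h))"] allI impI)
    fix V assume "strongly_convex d \<alpha> V \<and> smooth d \<beta> V"
    with * have "smooth_convex d \<alpha> \<beta> V" by unfold_locales auto
    with * show "attains d V (warm_start d \<alpha> (\<lambda>x0. Sampler (return (leb d) x0) ?h ?N (rgo_query d ?h))) q \<epsilon>
       (20 * (?k * max 1 (ln (q / \<epsilon>))) * (1 + ln (?k * max 1 (ln (q / \<epsilon>)))))"
      by (intro smooth_convex_attains) auto
  qed
qed simp

end
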